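(* Assume regularly varying tails $\mu(y\in Y:\varphi(y)>n)=\ell(n)n^{-\beta}$ and hypotheses (H1) and (H2) of the context. (a) If $\beta=\frac12$, then $T_n\ll\ell(n)n^{-\frac12}\int_{1/n}^\pi\ell(1/\theta)^{-2}\theta^{-1}\,d\theta$. (b) If $\beta\in(0,\frac12)$, then $T_n\ll\ell(n)n^{-\beta}$. (c) If $\beta\in(0,1)$, and $v\in\mathcal{B}$ satisfies $\int_Yv\,d\mu=0$, then $T_nv\ll\ell(n)n^{-\beta}$.
   Context: Setting. $(X,\mu)$ is an infinite measure space, $f:X\to X$ a conservative measure preserving map, $Y\subset X$ measurable with $\mu(Y)\in(0,\infty)$, and $\mu$ is rescaled so that $\mu(Y)=1$. Let $\varphi:Y\to\mathbb{Z}^+$, $\varphi(y)=\inf\{n\ge1:f^ny\in Y\}$ (finite a.e.), and $F=f^\varphi:Y\to Y$ the first return map. It is assumed that $\mu(y\in Y:\varphi(y)>n)=\ell(n)n^{-\beta}$ where $\beta\in(0,1]$ and $\ell:(0,\infty)\to(0,\infty)$ is slowly varying (measurable with $\lim_{x\to\infty}\ell(\lambda x)/\ell(x)=1$ for all $\lambda>0$). Let $L:L^1(X)\to L^1(X)$ and $R:L^1(Y)\to L^1(Y)$ be the transfer operators of $f$ and $F$: $\int_XLv\,w\,d\mu=\int_Xv\,w\circ f\,d\mu$ and $\int_YRv\,w\,d\mu=\int_Yv\,w\circ F\,d\mu$ for bounded measurable $w$. For $v$ on $Y$ set $T_nv=1_YL^n(1_Yv)$ ($n\ge0$), $R_nv=R(1_{\{\varphi=n\}}v)$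 ($n\ge1$), and $R(z)v=R(z^\varphi v)=\sum_{n\ge1}z^nR_nv$ for $z\in\bar{\mathbb{D}}=\{z\in\mathbb{C}:|z|\le1\}$. $\mathcal{B}\subset L^\infty(Y)$ is a (real) Banach space of functions containing the constants with norm satisfying $|v|_\infty\le\|v\|$ (complexified when $z$ is complex), such that: (H1) there is $C>0$ such that for all $n\ge1$, $R_n:\mathcal{B}\to\mathcal{B}$ is bounded with $\|R_n\|\le C\mu(\varphi=n)$. (H2) (i) the eigenvalue $1$ is simple and isolated in the spectrum of $R(1):\mathcal{B}\to\mathcal{B}$; (ii) for $z\in\bar{\mathbb{D}}\setminus\{1\}$ the spectrum of $R(z):\mathcal{B}\to\mathcal{B}$ does not contain $1$. Notation: $A_n\ll a_n$ means that there is $C>0$ with $\|A_n\|\le Ca_n$ for all $n\ge1$, where $\|\cdot\|$ is the operator norm on $\mathcal{B}$ if $A_n$ are operators and the norm of $\mathcal{B}$ if $A_n\in\mathcal{B}$. *)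

theory Defs
  imports "HOL-Analysis.Analysis"
begin

section \<open>Dynamics\<close>

definition measure_preserving_map :: "'a measure \<Rightarrow> ('a \<Rightarrow> 'a) \<Rightarrow> bool" where
  "measure_preserving_map M f \<longleftrightarrow> f \<in> M \<rightarrow>\<^sub>M M \<and> distr M M f = M"

definition wandering :: "'a measure \<Rightarrow> ('a \<Rightarrow> 'a) \<Rightarrow> 'a set \<Rightarrow> bool" where
  "wandering M f W \<longleftrightarrow> W \<in> sets M \<and> disjoint_family (\<lambda>n. (f ^^ n) -` W \<inter> space M)"

definition conservative :: "'a measure \<Rightarrow> ('a \<Rightarrow> 'a) \<Rightarrow> bool" where
  "conservative M f \<longleftrightarrow> (\<forall>W. wandering M f W \<longrightarrow> emeasure M W = 0)"

text \<open>Points that never return get the junk value \<open>Inf {} = 0\<close>, and are fixed by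
  \<open>first_return_map\<close>. If \<open>f\<close> is conservative, those of them that lie in \<open>Y\<close> form a
  (wandering, hence) null set.\<close>

definition return_time :: "('a \<Rightarrow> 'a) \<Rightarrow> 'a set \<Rightarrow> 'a \<Rightarrow> nat" where
  "return_time f Y y = Inf {n. n \<ge> 1 \<and> (f ^^ n) y \<in> Y}"

definition first_return_map :: "('a \<Rightarrow> 'a) \<Rightarrow> 'a set \<Rightarrow> 'a \<Rightarrow> 'a" where
  "first_return_map f Y y = (f ^^ return_time f Y y) y"

text \<open>\<open>L\<^sup>1\<close> is represented by integrable functions. The duality relation determines \<open>P v\<close>
  almost everywhere, so \<open>P\<close> is a choice of representatives for the transfer operator of \<open>g\<close>.\<close>

definition transfer_operator ::
    "'a measure \<Rightarrow> ('a \<Rightarrow> 'a) \<Rightarrow> (('a \<Rightarrow> real) \<Rightarrow> 'a \<Rightarrow> real) \<Rightarrow> bool" where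
  "transfer_operator N g P \<longleftrightarrow>
    (\<forall>v. integrable N v \<longrightarrow>
      integrable N (P v) \<and>
      (\<forall>w \<in> borel_measurable N. bounded (w ` space N) \<longrightarrow>
        (\<integral>x. P v x * w x \<partial>N) = (\<integral>x. v x * w (g x) \<partial>N)))"

definition T_fun ::
    "(('a \<Rightarrow> real) \<Rightarrow> 'a \<Rightarrow> real) \<Rightarrow> 'a set \<Rightarrow> nat \<Rightarrow> ('a \<Rightarrow> real) \<Rightarrow> 'a \<Rightarrow> real" where
  "T_fun L Y n v = (\<lambda>x. indicator Y x * (L ^^ n) (\<lambda>x. indicator Y x * v x) x)"

definition R_fun ::
    "(('a \<Rightarrow> real) \<Rightarrow> 'a \<Rightarrow> real) \<Rightarrow> ('a \<Rightarrow> nat) \<Rightarrow> nat \<Rightarrow> ('a \<Rightarrow> real) \<Rightarrow> 'a \<Rightarrow> real" where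
  "R_fun R \<phi> n v = R (\<lambda>y. indicator {y. \<phi> y = n} y * v y)"

definition slowly_varying :: "(real \<Rightarrow> real) \<Rightarrow> bool" where
  "slowly_varying l \<longleftrightarrow>
    l \<in> borel_measurable (lebesgue_on {0<..}) \<and>
    (\<forall>x>0. l x > 0) \<and>
    (\<forall>c>0. ((\<lambda>x. l (c * x) / l x) \<longlongrightarrow> 1) at_top)"


section \<open>The function space\<close>

text \<open>A Banach space contained in \<open>L\<^sup>\<infinity>(N)\<close>, with a norm dominating the essential supremum
  and containing the constants, is given as a type \<open>'b\<close> of class \<open>banach\<close> with
  a map \<open>\<iota>\<close> choosing a representative of each element. Linearity and injectivity of the inclusion
  into \<open>L\<^sup>\<infinity>(N)\<close> are therefore expressed almost everywhere.\<close>

definition banach_subspace_Linf :: "'a measure \<Rightarrow> ('b::banach \<Rightarrow> 'a \<Rightarrow> real) \<Rightarrow> bool" where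
  "banach_subspace_Linf N \<iota> \<longleftrightarrow>
    (\<forall>v. \<iota> v \<in> borel_measurable N) \<and>
    (\<forall>u v. AE y in N. \<iota> (u + v) y = \<iota> u y + \<iota> v y) \<and>
    (\<forall>c v. AE y in N. \<iota> (c *\<^sub>R v) y = c * \<iota> v y) \<and>
    (\<forall>v. (AE y in N. \<iota> v y = 0) \<longrightarrow> v = 0) \<and>
    (\<forall>v. AE y in N. \<bar>\<iota> v y\<bar> \<le> norm v) \<and>
    (\<forall>c. \<exists>v. AE y in N. \<iota> v y = c)"

definition represents :: "'a measure \<Rightarrow> ('b \<Rightarrow> 'a \<Rightarrow> real) \<Rightarrow> 'b \<Rightarrow> ('a \<Rightarrow> real) \<Rightarrow> bool" where
  "represents N \<iota> u g \<longleftrightarrow> (AE y in N. \<iota> u y = g y)"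

text \<open>\<open>A\<close> is the restriction to \<open>'b\<close> of an operator \<open>S\<close> on functions; this includes that
  \<open>S\<close> maps \<open>'b\<close> into itself.\<close>

definition restricts_to ::
    "'a measure \<Rightarrow> ('b::real_normed_vector \<Rightarrow> 'a \<Rightarrow> real) \<Rightarrow>
      (('a \<Rightarrow> real) \<Rightarrow> 'a \<Rightarrow> real) \<Rightarrow> ('b \<Rightarrow>\<^sub>L 'b) \<Rightarrow> bool" where
  "restricts_to N \<iota> S A \<longleftrightarrow> (\<forall>v. represents N \<iota> (blinfun_apply A v) (S (\<iota> v)))"

text \<open>The relation \<open>A\<^sub>n \<lless> a\<^sub>n\<close> for operators, respectively elements. The right-hand side is
  extended-valued so that a divergent integral counts as \<open>\<infinity>\<close> rather than as \<open>0\<close>.\<close>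

definition op_ll ::
    "'a measure \<Rightarrow> ('b::real_normed_vector \<Rightarrow> 'a \<Rightarrow> real) \<Rightarrow>
      (nat \<Rightarrow> ('a \<Rightarrow> real) \<Rightarrow> 'a \<Rightarrow> real) \<Rightarrow> (nat \<Rightarrow> ennreal) \<Rightarrow> bool" where
  "op_ll N \<iota> S a \<longleftrightarrow>
    (\<exists>C>0. \<forall>n\<ge>1. \<exists>A.
      restricts_to N \<iota> (S n) A \<and> ennreal (norm A) \<le> ennreal C * a n)"

definition fun_ll ::
    "'a measure \<Rightarrow> ('b::real_normed_vector \<Rightarrow> 'a \<Rightarrow> real) \<Rightarrow>
      (nat \<Rightarrow> 'a \<Rightarrow> real) \<Rightarrow> (nat \<Rightarrow> ennreal) \<Rightarrow> bool" where
  "fun_ll N \<iota> g a \<longleftrightarrow>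
    (\<exists>C>0. \<forall>n\<ge>1. \<exists>u. represents N \<iota> u (g n) \<and> ennreal (norm u) \<le> ennreal C * a n)"


section \<open>Complexification and spectrum\<close>

text \<open>The complexification of \<open>'b\<close> is \<open>'b \<times> 'b\<close>, where \<open>(x, y)\<close> stands for \<open>x + \<i>y\<close>.
  The product norm is equivalent to every complex norm whose restriction to \<open>'b\<close> is equivalent to
  the given one and for which conjugation is bounded; the notions below depend on the norm only
  up to equivalence.\<close>

lift_definition cscale :: "complex \<Rightarrow> ('b::real_normed_vector \<times> 'b) \<Rightarrow>\<^sub>L ('b \<times> 'b)" is
  "\<lambda>c x. (Re c *\<^sub>R fst x - Im c *\<^sub>R snd x, Im c *\<^sub>R fst x + Re c *\<^sub>R snd x)"
  by (intro bounded_linear_intros)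

lift_definition complexify ::
    "('b::real_normed_vector \<Rightarrow>\<^sub>L 'b) \<Rightarrow> ('b \<times> 'b) \<Rightarrow>\<^sub>L ('b \<times> 'b)" is
  "\<lambda>A x. (A (fst x), A (snd x))"
  by (intro bounded_linear_Pair bounded_linear_compose[OF _ bounded_linear_fst]
      bounded_linear_compose[OF _ bounded_linear_snd])

text \<open>For complex linear \<open>A\<close> the inverse \<open>S\<close> is automatically complex linear.\<close>

definition cspectrum ::
    "(('b::real_normed_vector \<times> 'b) \<Rightarrow>\<^sub>L ('b \<times> 'b)) \<Rightarrow> complex set" where
  "cspectrum A = {c. \<not> (\<exists>S. S o\<^sub>L (cscale c - A) = id_blinfun \<and>
                               (cscale c - A) o\<^sub>L S = id_blinfun)}"

text \<open>Algebraic simplicity in the sense of Crandall and Rabinowitz: kernel and cokernel of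
  \<open>c - A\<close> are one-dimensional over \<open>\<complex>\<close>, and the eigenvector \<open>u\<close> is not in the range.
  For an isolated point of the spectrum this says precisely that the spectral (Riesz) projection
  has rank one. Merely requiring all kernels of \<open>(c - A)\<^sup>k\<close> to be one-dimensional would be weaker:
  it admits isolated points with a spectral projection of infinite rank.\<close>

definition simple_eigenvalue ::
    "(('b::real_normed_vector \<times> 'b) \<Rightarrow>\<^sub>L ('b \<times> 'b)) \<Rightarrow> complex \<Rightarrow> bool" where
  "simple_eigenvalue A c \<longleftrightarrow>
    (\<exists>u. u \<noteq> 0 \<and>
      {x. blinfun_apply (cscale c - A) x = 0} = range (\<lambda>a. blinfun_apply (cscale a) u) \<and>
      u \<notin> range (blinfun_apply (cscale c - A)) \<and>
      (\<forall>x. \<exists>a y. x = blinfun_apply (cscale a) u + blinfun_apply (cscale c - A) y))"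

text \<open>\<open>R(z) = \<Sum>\<^sub>n\<^sub>\<ge>\<^sub>1 z\<^sup>n R\<^sub>n\<close>; for \<open>\<bar>z\<bar> \<le> 1\<close> the series converges absolutely in operator norm as soon as
  the norms of the \<open>R\<^sub>n\<close> are summable, as they are under (H1).\<close>

definition R_series ::
    "(nat \<Rightarrow> 'b::banach \<Rightarrow>\<^sub>L 'b) \<Rightarrow> complex \<Rightarrow> ('b \<times> 'b) \<Rightarrow>\<^sub>L ('b \<times> 'b)" where
  "R_series Rn z = (\<Sum>n. cscale (z ^ Suc n) o\<^sub>L complexify (Rn (Suc n)))"

definition H1 ::
    "'a measure \<Rightarrow> 'a set \<Rightarrow> ('a \<Rightarrow> nat) \<Rightarrow> (('a \<Rightarrow> real) \<Rightarrow> 'a \<Rightarrow> real) \<Rightarrow>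
      ('b::banach \<Rightarrow> 'a \<Rightarrow> real) \<Rightarrow> (nat \<Rightarrow> 'b \<Rightarrow>\<^sub>L 'b) \<Rightarrow> bool" where
  "H1 M Y \<phi> R \<iota> Rn \<longleftrightarrow>
    (\<forall>n\<ge>1. restricts_to (restrict_space M Y) \<iota> (R_fun R \<phi> n) (Rn n)) \<and>
    (\<exists>C>0. \<forall>n\<ge>1. norm (Rn n) \<le> C * measure M {y \<in> Y. \<phi> y = n})"

definition H2 :: "(nat \<Rightarrow> 'b::banach \<Rightarrow>\<^sub>L 'b) \<Rightarrow> bool" where
  "H2 Rn \<longleftrightarrow>
    simple_eigenvalue (R_series Rn 1) 1 \<and>
    1 isolated_in cspectrum (R_series Rn 1) \<and>
    (\<forall>z. norm z \<le> 1 \<and> z \<noteq> 1 \<longrightarrow> 1 \<notin> cspectrum (R_series Rn z))"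

end

theory Submission
  imports Defs "HOL-Complex_Analysis.Cauchy_Integral_Theorem"
begin

text \<open>Cutting the orbits that lead from \<open>Y\<close> to \<open>Y\<close> in \<open>n\<close> steps at their first return gives the renewal
equation \<open>T\<^sub>n = \<Sum>\<^sub>k T\<^sub>n\<^sub>-\<^sub>k R\<^sub>k\<close> (\<open>T_eq_renewal\<close>). On the function space, \<open>T\<^sub>n\<close> is therefore an operator
determined by the \<open>R\<^sub>k\<close>, and formally \<open>\<Sum> T\<^sub>n z\<^sup>n = (1 - R(z))\<^sup>-\<^sup>1\<close>. Hypothesis (H2) provides the inverse
\<open>T(z) = (1 - R(z))\<^sup>-\<^sup>1\<close> on the closed disc without \<open>1\<close>; inside the disc it is holomorphic, so that its
Fourier coefficients over a circle vanish for negative indices by Cauchy's theorem, and the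
recursion that follows from \<open>T(z) = 1 + T(z) R(z)\<close> identifies the others with \<open>T\<^sub>n\<close>
(\<open>renewal_eq_coeff\<close>). Everything then depends on the size and the smoothness of \<open>T(z)\<close> near \<open>z = 1\<close>.

Write \<open>t(n) = \<mu>(\<phi> > n)\<close> and \<open>\<tau>\<^sub>j = t(2\<^sup>j)\<close>. In the operator estimates regular variation enters through
\<open>\<tau>\<^sub>j / \<tau>\<^sub>j\<^sub>+\<^sub>1 \<rightarrow> 2\<^sup>\<beta>\<close>.
If \<open>\<bar>z - w\<bar>\<close> is of order \<open>2\<^sup>-\<^sup>j\<close>, then \<open>R(z) - R(w)\<close> is of order at most
\<open>\<Sum>\<^sub>k \<mu>(\<phi> = k) min(2, k \<bar>z - w\<bar>)\<close>, which is at most a multiple of \<open>\<tau>\<^sub>j\<close> because \<open>\<beta> < 1\<close> (\<open>R_modulus\<close>).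
In the other direction, \<open>R(1)\<close> fixes the constants, since the first return map preserves the measure,
and preserves the integral. As \<open>1\<close> is a simple eigenvalue, \<open>1 - R(1)\<close> is bounded below off the
constants (\<open>spectral_gap\<close>). In the equation \<open>(1 - R(z)) x = y\<close> the component of \<open>x\<close> along the constants
is found by integrating; up to an error of second order it is multiplied by \<open>1 - \<integral> z\<^sup>\<phi>\<close>, whose
real part is at least a multiple of \<open>\<tau>\<^sub>j\<close> if \<open>\<bar>1 - z\<bar>\<close> is of order \<open>2\<^sup>-\<^sup>j\<close>: a fixed proportion of the
tail \<open>\<phi> > 2\<^sup>j\<close> lies where \<open>z\<^sup>\<phi>\<close> has real part away from \<open>1\<close> (\<open>generating_function_lower_bound\<close>). So the norm of
\<open>T(z)\<close> is at most a multiple of \<open>1/\<tau>\<^sub>j\<close>, whereas \<open>T(z) v\<close> stays bounded if \<open>v\<close> has mean zero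
(\<open>resolvent_bound\<close>).

For the coefficients, integrate over the circle of radius \<open>n/(n+1)\<close>. Rotating by \<open>h = \<pi>/n\<close> changes the
sign of \<open>z\<^sup>-\<^sup>n\<close>, so \<open>T\<^sub>n v\<close> is controlled by the integral of the norm of
\<open>T(z) v - T(z') v = T(z) (R(z) - R(z')) T(z') v\<close> with \<open>z' = z e\<^sup>-\<^sup>i\<^sup>h\<close>. Splitting the circle
dyadically gives, for \<open>2\<^sup>J \<le> n < 2\<^sup>J\<^sup>+\<^sup>1\<close>,
a bound of order \<open>t(n) \<Sum>\<^sub>j\<^sub>\<le>\<^sub>J 2\<^sup>-\<^sup>j \<tau>\<^sub>j\<^sup>-\<^sup>2\<close> for the norm of \<open>T\<^sub>n\<close> (\<open>norm_renewal_le\<close>), and with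
\<open>\<tau>\<^sub>j\<^sup>-\<^sup>1\<close> in place of \<open>\<tau>\<^sub>j\<^sup>-\<^sup>2\<close> on functions of mean zero. The second series converges for
\<open>\<beta> < 1\<close>, which is (c), and the first one for \<open>\<beta> < 1/2\<close>, which is (b). For \<open>\<beta> = 1/2\<close> its terms are
\<open>\<ell>(2\<^sup>j)\<^sup>-\<^sup>2\<close>, and Fatou's lemma bounds them by the integrals of \<open>\<ell>(1/\<theta>)\<^sup>-\<^sup>2 \<theta>\<^sup>-\<^sup>1\<close> over the dyadic blocks
(\<open>dyadic_integral_ge\<close>), which is (a).\<close>

section \<open>The bounded inverse theorem\<close>

text \<open>By Baire's theorem the closure of the image of some ball contains a ball. Differences of its
points approximate every small \<open>y\<close>, and homogeneity does the rest.\<close>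

lemma surj_imp_approximate_preimages:
  fixes G :: "'a::banach \<Rightarrow>\<^sub>L 'c::banach"
  assumes "surj (blinfun_apply G)"
  shows "\<exists>K>0. \<forall>y. \<exists>x. norm x \<le> K * norm y \<and> norm (G x - y) \<le> norm y / 2"
proof -
  let ?F = "\<lambda>n::nat. closure (G ` cball 0 (real n))"
  have cover: "\<Union>(range ?F) = UNIV"
  proof -
    have "y \<in> \<Union>(range ?F)" for y
    proof -
      obtain x where x: "y = G x" using assms by (metis surjD)
      obtain n :: nat where "norm x \<le> n" using real_arch_simple by blast
      then have "y \<in> ?F n" using x closure_subset by fastforce
      then show ?thesis by blast
    qed
    then show ?thesis by blast
  qed
  have "\<exists>n. interior (?F n) \<noteq> {}"
  proof (rule ccontr)
    assume "\<not> ?thesis"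
    then have "Met_TC.mtopology interior_of \<Union>(range ?F) = {}"
      by (intro Met_TC.metric_Baire_category_alt)
         (auto simp: mtopology_is_euclidean mcomplete_iff_complete complete_UNIV euclidean_interior_of)
    then show False unfolding cover by (simp add: mtopology_is_euclidean euclidean_interior_of)
  qed
  then obtain n y0 where "y0 \<in> interior (?F n)" by blast
  then obtain \<epsilon> where \<epsilon>: "\<epsilon> > 0" "ball y0 \<epsilon> \<subseteq> ?F n"
    using mem_interior by blast
  define K where "K = 4 * (real n + 1) / \<epsilon>"
  have K: "K > 0" using \<epsilon> by (simp add: K_def)
  have "\<exists>x. norm x \<le> K * norm y \<and> norm (G x - y) \<le> norm y / 2" for y
  proof (cases "y = 0")
    case True
    then show ?thesis by (intro exI[of _ 0]) simp
  next
    case False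
    \<comment> \<open>the factor that scales \<open>y\<close> to norm \<open>\<epsilon>/2\<close>, inside the ball\<close>
    define s where "s = \<epsilon> / (2 * norm y)"
    have s: "s > 0" using False \<epsilon> by (simp add: s_def)
    have sy: "norm (s *\<^sub>R y) = \<epsilon> / 2" using False \<epsilon> by (simp add: s_def)
    have "y0 \<in> ?F n" "y0 + s *\<^sub>R y \<in> ?F n"
      using \<epsilon> sy by (auto intro!: subsetD[OF \<epsilon>(2)] simp: dist_norm)
    then obtain a b where ab: "norm a \<le> n" "norm (G a - y0) < \<epsilon> / 8"
        "norm b \<le> n" "norm (G b - (y0 + s *\<^sub>R y)) < \<epsilon> / 8"
      using \<epsilon>(1) unfolding closure_approachable by (force simp: dist_norm dest!: spec[of _ "\<epsilon>/8"])
    define x where "x = (1 / s) *\<^sub>R (b - a)"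
    have "norm (b - a) \<le> 2 * n" using ab norm_triangle_ineq4[of b a] by linarith
    then have "norm x \<le> (1 / s) * (2 * n)"
      using s by (simp add: x_def mult_left_mono divide_right_mono)
    also have "\<dots> \<le> K * norm y"
      using \<epsilon> False by (simp add: s_def K_def field_simps)
    finally have nx: "norm x \<le> K * norm y" .
    have split: "G (b - a) - s *\<^sub>R y = (G b - (y0 + s *\<^sub>R y)) - (G a - y0)"
      by (simp add: blinfun.diff_right)
    then have "norm (G (b - a) - s *\<^sub>R y) \<le> \<epsilon> / 4"
      unfolding split using ab norm_triangle_ineq4[of "G b - (y0 + s *\<^sub>R y)" "G a - y0"] by linarith
    moreover have "G x - y = (1 / s) *\<^sub>R (G (b - a) - s *\<^sub>R y)"
      using s by (simp add: x_def blinfun.scaleR_right blinfun.diff_right scaleR_diff_right)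
    ultimately have "norm (G x - y) \<le> (1 / s) * (\<epsilon> / 4)"
      using s by (simp only: norm_scaleR) (intro mult_mono, auto)
    also have "\<dots> = norm y / 2" using False \<epsilon> by (simp add: s_def field_simps)
    finally show ?thesis using nx by blast
  qed
  then show ?thesis using K by blast
qed

text \<open>Correcting the error of an approximate preimage again and again halves it each time, so the
corrections form a geometric series.\<close>

lemma surj_imp_bounded_preimages:
  fixes G :: "'a::banach \<Rightarrow>\<^sub>L 'c::banach"
  assumes "surj (blinfun_apply G)"
  shows "\<exists>K>0. \<forall>y. \<exists>x. G x = y \<and> norm x \<le> K * norm y"
proof -
  obtain K where K: "K > 0"
    and "\<forall>y. \<exists>x. norm x \<le> K * norm y \<and> norm (G x - y) \<le> norm y / 2"
    using surj_imp_approximate_preimages[OF assms] by blast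
  then obtain g where g: "\<And>y. norm (g y) \<le> K * norm y" "\<And>y. norm (G (g y) - y) \<le> norm y / 2"
    by metis
  have "\<exists>x. G x = y \<and> norm x \<le> (2 * K) * norm y" for y
  proof -
    define r where "r = rec_nat y (\<lambda>_ w. w - G (g w))"
    have r: "r 0 = y" "r (Suc k) = r k - G (g (r k))" for k by (simp_all add: r_def)
    have nr: "norm (r k) \<le> norm y * (1/2) ^ k" for k
    proof (induction k)
      case (Suc k)
      have "norm (r (Suc k)) \<le> norm (r k) / 2" using g(2)[of "r k"] by (simp add: r norm_minus_commute)
      with Suc show ?case by simp
    qed (simp add: r)
    have ng: "norm (g (r k)) \<le> K * norm y * (1/2) ^ k" for k
      using order_trans[OF g(1) mult_left_mono[OF nr]] K by (simp add: mult.assoc)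
    have geo: "(\<lambda>k. K * norm y * (1/2) ^ k) sums (K * norm y * 2)"
      using sums_mult[OF geometric_sums[of "1/2::real"]] by simp
    have sm: "summable (\<lambda>k. norm (g (r k)))"
      by (rule summable_comparison_test'[OF sums_summable[OF geo]]) (use ng in simp)
    define x where "x = (\<Sum>k. g (r k))"
    have "norm x \<le> (\<Sum>k. norm (g (r k)))" unfolding x_def by (rule summable_norm[OF sm])
    also have "\<dots> \<le> K * norm y * 2"
      unfolding sums_unique[OF geo] by (rule suminf_le[OF ng sm sums_summable[OF geo]])
    finally have nx: "norm x \<le> (2 * K) * norm y" by simp
    have "(\<lambda>k. G (g (r k))) sums G x"
      unfolding x_def using blinfun.bounded_linear_right summable_sums[OF summable_norm_cancel[OF sm]]
      by (rule bounded_linear.sums)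
    moreover have "(\<lambda>k. G (g (r k))) sums y"
    proof -
      have "r \<longlonglongrightarrow> 0"
      proof (rule Lim_null_comparison)
        show "\<forall>\<^sub>F k in sequentially. norm (r k) \<le> norm y * (1/2) ^ k" using nr by simp
        show "(\<lambda>k. norm y * (1/2) ^ k) \<longlonglongrightarrow> 0"
          by (intro tendsto_mult_right_zero LIMSEQ_realpow_zero) auto
      qed
      from telescope_sums'[OF this] show ?thesis by (simp add: r)
    qed
    ultimately have "G x = y" by (rule sums_unique2)
    then show ?thesis using nx by blast
  qed
  then show ?thesis using K by (intro exI[of _ "2 * K"]) auto
qed

theorem bij_blinfun_bounded_below:
  fixes G :: "'a::banach \<Rightarrow>\<^sub>L 'c::banach"
  assumes "bij (blinfun_apply G)"
  shows "\<exists>K>0. \<forall>x. norm x \<le> K * norm (G x)"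
proof -
  obtain K where "K > 0" "\<forall>y. \<exists>x. G x = y \<and> norm x \<le> K * norm y"
    using surj_imp_bounded_preimages[OF bij_is_surj[OF assms]] by blast
  then show ?thesis using bij_is_inj[OF assms] by (metis injD)
qed

section \<open>Regularly varying tails\<close>

text \<open>Here \<open>t n\<close> plays the role of \<open>\<mu>(\<phi> > n)\<close>. Regular variation enters along the powers of \<open>2\<close> only:
since \<open>t\<close> is monotone, this controls it everywhere up to constants.\<close>

locale regular_tail =
  fixes t :: "nat \<Rightarrow> real" and \<beta> :: real
  assumes t_0: "t 0 = 1" and t_dec: "decseq t" and t_lim: "t \<longlonglongrightarrow> 0" and t_pos: "\<And>n. t n > 0"
    and \<beta>: "0 < \<beta>" "\<beta> < 1"
    and t_ratio: "(\<lambda>j. t (2 ^ Suc j) / t (2 ^ j)) \<longlonglongrightarrow> 2 powr (- \<beta>)"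
begin

definition p :: "nat \<Rightarrow> real" where "p k = t (k - 1) - t k"
definition \<tau> :: "nat \<Rightarrow> real" where "\<tau> j = t (2 ^ j)"

lemma p_0 [simp]: "p 0 = 0" by (simp add: p_def)

lemma p_nonneg: "p k \<ge> 0"
  using decseqD[OF t_dec, of "k - 1" k] by (simp add: p_def)

lemma sum_p: "(\<Sum>k\<le>n. p k) = 1 - t n"
  by (induction n) (simp_all add: t_0 p_def)

lemma p_sums: "p sums 1"
proof -
  have "(\<lambda>n. 1 - t n) \<longlonglongrightarrow> 1 - 0" by (intro tendsto_intros t_lim)
  then show ?thesis unfolding sums_def_le sum_p by simp
qed

lemmas p_summable = sums_summable[OF p_sums]

lemma sum_p_Ioc: "m \<le> n \<Longrightarrow> (\<Sum>k\<in>{m<..n}. p k) = t m - t n"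
proof (induction n)
  case (Suc n)
  show ?case
  proof (cases "m = Suc n")
    case False
    with Suc have "{m<..Suc n} = insert (Suc n) {m<..n}" by auto
    with False Suc show ?thesis by (simp add: p_def)
  qed simp
qed (simp add: t_0)

lemma p_tail_sums: "(\<lambda>k. p (k + Suc n)) sums t n"
proof -
  have "(\<lambda>k. p (k + Suc n)) sums (1 - sum p {..<Suc n})"
    using p_sums by (rule sums_split_initial_segment)
  then show ?thesis using sum_p[of n] by (simp add: lessThan_Suc_atMost)
qed

lemma \<tau>_pos: "\<tau> j > 0" by (simp add: \<tau>_def t_pos)

lemma \<tau>_dec: "i \<le> j \<Longrightarrow> \<tau> j \<le> \<tau> i"
  unfolding \<tau>_def by (intro decseqD[OF t_dec]) (simp add: power_increasing)

lemma \<tau>_lim: "\<tau> \<longlonglongrightarrow> 0"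
proof -
  have "strict_mono (\<lambda>j::nat. (2::nat) ^ j)" by (simp add: strict_mono_Suc_iff)
  from LIMSEQ_subseq_LIMSEQ[OF t_lim this] show ?thesis by (simp add: \<tau>_def[abs_def] o_def)
qed

lemma \<tau>_ratio: "(\<lambda>j. \<tau> j / \<tau> (Suc j)) \<longlonglongrightarrow> 2 powr \<beta>"
proof -
  have "(\<lambda>j. inverse (t (2 ^ Suc j) / t (2 ^ j))) \<longlonglongrightarrow> inverse (2 powr (- \<beta>))"
    by (rule tendsto_inverse[OF t_ratio]) simp
  then show ?thesis by (simp add: \<tau>_def powr_minus field_simps del: power_Suc)
qed

lemma \<tau>_doubling: "\<exists>D\<ge>1. \<forall>j. \<tau> j \<le> D * \<tau> (Suc j)"
proof -
  have "Bseq (\<lambda>j. \<tau> j / \<tau> (Suc j))"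
    by (rule convergent_imp_Bseq) (use \<tau>_ratio in \<open>auto simp: convergent_def\<close>)
  then obtain K where K: "\<And>j. \<bar>\<tau> j / \<tau> (Suc j)\<bar> \<le> K" by (auto simp: Bseq_def)
  have "\<tau> j \<le> max K 1 * \<tau> (Suc j)" for j
  proof -
    have "\<tau> j / \<tau> (Suc j) \<le> max K 1" using K[of j] by linarith
    then show ?thesis using \<tau>_pos[of "Suc j"] by (simp add: pos_divide_le_eq)
  qed
  then show ?thesis by (intro exI[of _ "max K 1"]) auto
qed

text \<open>A fixed proportion of the tail beyond \<open>2\<^sup>j\<close> lies below \<open>2\<^sup>j\<^sup>+\<^sup>1\<close>; this is where \<open>\<beta> > 0\<close> is used.\<close>

lemma \<tau>_gap: "\<exists>c>0. \<forall>\<^sub>F j in sequentially. c * \<tau> j \<le> \<tau> j - \<tau> (Suc j)"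
proof -
  have "2 powr (- \<beta>) < 1" using \<beta> by (simp add: powr_less_one)
  then obtain q where q: "2 powr (- \<beta>) < q" "q < 1" using dense by blast
  have "\<forall>\<^sub>F j in sequentially. t (2 ^ Suc j) / t (2 ^ j) < q"
    using order_tendstoD(2)[OF t_ratio q(1)] .
  then have "\<forall>\<^sub>F j in sequentially. (1 - q) * \<tau> j \<le> \<tau> j - \<tau> (Suc j)"
  proof eventually_elim
    case (elim j)
    then have "\<tau> (Suc j) < q * \<tau> j" using \<tau>_pos[of j] by (simp add: \<tau>_def field_simps)
    then show ?case by (simp add: algebra_simps)
  qed
  then show ?thesis using q by (intro exI[of _ "1 - q"]) auto
qed

text \<open>A weak form of Karamata's theorem. As \<open>\<beta> < 1\<close>, the quantity \<open>2\<^sup>j \<tau>\<^sub>j\<close> grows geometrically, so the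
last dyadic block dominates the sum.\<close>

lemma sum_t_le: "\<exists>A>0. \<forall>j. (\<Sum>i<2^j. t i) \<le> A * (2 ^ j * \<tau> j)"
proof -
  define q where "q j = (\<Sum>i<2^j. t i) / (2 ^ j * \<tau> j)" for j
  have step: "q (Suc j) \<le> (q j + 1) * (\<tau> j / \<tau> (Suc j) / 2)" for j
  proof -
    have "{..<2 ^ Suc j} = {..<2 ^ j} \<union> {2 ^ j..<2 ^ Suc j :: nat}" by auto
    then have "sum t {..<2 ^ Suc j} = sum t ({..<2 ^ j} \<union> {2 ^ j..<2 ^ Suc j :: nat})" by presburger
    also have "\<dots> = (\<Sum>i<2^j. t i) + (\<Sum>i\<in>{2^j..<2^Suc j}. t i)"
      by (rule sum.union_disjoint) auto
    also have "(\<Sum>i\<in>{2^j..<2^Suc j}. t i) \<le> (\<Sum>i\<in>{2^j..<2^Suc j::nat}. \<tau> j)"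
      by (intro sum_mono) (auto simp: \<tau>_def intro: decseqD[OF t_dec])
    also have "\<dots> = 2 ^ j * \<tau> j" by simp
    finally have "(\<Sum>i<2^Suc j. t i) \<le> (q j + 1) * (2 ^ j * \<tau> j)"
      using \<tau>_pos[of j] by (simp add: q_def distrib_right)
    then show ?thesis using \<tau>_pos[of "Suc j"] by (simp add: q_def[of "Suc j"] field_simps)
  qed
  have q_nonneg: "q j \<ge> 0" for j
    unfolding q_def using \<tau>_pos[of j] by (intro divide_nonneg_pos sum_nonneg) (auto intro: less_imp_le[OF t_pos])
  have "(2::real) powr \<beta> < 2 powr 1" using \<beta> by (subst powr_less_cancel_iff) auto
  then have lt: "(2::real) powr \<beta> / 2 < 1" by simp
  then obtain \<rho> where \<rho>: "2 powr \<beta> / 2 < \<rho>" "\<rho> < 1" using dense by blast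
  have \<rho>0: "\<rho> > 0" using \<rho> by (smt (verit) powr_gt_zero divide_pos_pos)
  have "(\<lambda>j. \<tau> j / \<tau> (Suc j) / 2) \<longlonglongrightarrow> 2 powr \<beta> / 2" by (intro tendsto_intros \<tau>_ratio) simp
  from order_tendstoD(2)[OF this \<rho>(1)] obtain N where N: "\<And>j. j \<ge> N \<Longrightarrow> \<tau> j / \<tau> (Suc j) / 2 < \<rho>"
    by (auto simp: eventually_sequentially)
  \<comment> \<open>\<open>\<rho> / (1 - \<rho>)\<close> is the fixed point of \<open>q \<mapsto> \<rho> (q + 1)\<close>, which bounds one step beyond \<open>N\<close>\<close>
  define A where "A = Max (q ` {..N}) + \<rho> / (1 - \<rho>)"
  have A1: "q j \<le> A" if "j \<le> N" for j
  proof -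
    have "q j \<le> Max (q ` {..N})" using that by (intro Max_ge) auto
    then show ?thesis using \<rho> \<rho>0 by (simp add: A_def add_increasing2)
  qed
  have A2: "q (N + k) \<le> A" for k
  proof (induction k)
    case 0 show ?case using A1 by simp
  next
    case (Suc k)
    have "q (N + Suc k) \<le> (q (N + k) + 1) * (\<tau> (N+k) / \<tau> (Suc (N+k)) / 2)" using step[of "N+k"] by simp
    also have "\<dots> \<le> (A + 1) * \<rho>" using Suc q_nonneg[of "N+k"] N[of "N+k"] \<tau>_pos[of "N+k"] \<tau>_pos[of "Suc (N+k)"]
      by (intro mult_mono) auto
    also have "\<dots> \<le> A"
    proof -
      have "0 \<le> Max (q ` {..N})" using order_trans[OF q_nonneg[of 0]] by (simp add: Max_ge_iff) (use q_nonneg in blast)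
      then have "\<rho> / (1 - \<rho>) \<le> A" by (simp add: A_def)
      then show ?thesis using \<rho> by (simp add: field_simps)
    qed
    finally show ?case .
  qed
  have A: "q j \<le> A" for j using A1[of j] A2[of "j - N"] by (cases "j \<le> N") auto
  have "(\<Sum>i<2^j. t i) \<le> (A + 1) * (2 ^ j * \<tau> j)" for j
  proof -
    have "(\<Sum>i<2^j. t i) = q j * (2 ^ j * \<tau> j)" using \<tau>_pos[of j] by (simp add: q_def)
    also have "\<dots> \<le> (A + 1) * (2 ^ j * \<tau> j)" using A[of j] \<tau>_pos[of j] by (intro mult_right_mono) auto
    finally show ?thesis .
  qed
  moreover have "A + 1 > 0" using A[of 0] q_nonneg[of 0] by linarith
  ultimately show ?thesis by blast
qed

lemma sum_k_p_le: "(\<Sum>k\<le>n. real k * p k) \<le> (\<Sum>i<n. t i)"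
proof -
  have "(\<Sum>k\<le>n. real k * p k) = (\<Sum>i<n. t i) - n * t n"
    by (induction n) (simp_all add: p_def algebra_simps)
  then show ?thesis using t_pos[of n] by (simp add: mult_nonneg_nonneg less_imp_le)
qed

text \<open>The range \<open>k \<le> 2\<^sup>j\<close> is summed by parts and contributes at most \<open>\<omega>\<close> times the sum of the tail; the
remaining range has mass \<open>\<tau>\<^sub>j\<close>.\<close>

lemma truncated_mean_le:
  "\<exists>A>0. \<forall>j \<omega>. 0 \<le> \<omega> \<longrightarrow> \<omega> \<le> (1/2) ^ j \<longrightarrow> (\<Sum>k. p k * min 2 (real k * \<omega>)) \<le> A * \<tau> j"
proof -
  obtain A where A: "A > 0" "\<And>j. (\<Sum>i<2^j. t i) \<le> A * (2 ^ j * \<tau> j)" using sum_t_le by blast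
  have "(\<Sum>k. p k * min 2 (real k * \<omega>)) \<le> (A + 2) * \<tau> j" if \<omega>: "0 \<le> \<omega>" "\<omega> \<le> (1/2) ^ j" for j \<omega>
  proof -
    let ?f = "\<lambda>k. p k * min 2 (real k * \<omega>)"
    let ?n = "Suc (2 ^ j)"
    have sm: "summable ?f"
      by (rule summable_comparison_test'[OF summable_mult[OF p_summable, of 2]])
         (use p_nonneg \<omega> in \<open>simp add: mult.commute[of 2] mult_left_mono\<close>)
    have tl: "(\<Sum>k. ?f (k + ?n)) \<le> (\<Sum>k. 2 * p (k + ?n))"
    proof (rule suminf_le)
      show "?f (k + ?n) \<le> 2 * p (k + ?n)" for k
        using mult_left_mono[OF min.cobounded1[of 2 "real (k + ?n) * \<omega>"] p_nonneg[of "k + ?n"]] by (simp only: mult.commute)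
      show "summable (\<lambda>k. ?f (k + ?n))" using sm by (rule summable_ignore_initial_segment)
      show "summable (\<lambda>k. 2 * p (k + ?n))"
        by (intro summable_mult) (rule sums_summable[OF p_tail_sums])
    qed
    have "(\<Sum>k. 2 * p (k + ?n)) = 2 * \<tau> j"
      using sums_unique[OF sums_mult[OF p_tail_sums[of "2 ^ j"], of 2]] by (simp add: \<tau>_def)
    with tl have tl: "(\<Sum>k. ?f (k + ?n)) \<le> 2 * \<tau> j" by simp
    have "(\<Sum>k<?n. ?f k) \<le> (\<Sum>k<?n. \<omega> * (real k * p k))"
    proof (rule sum_mono)
      fix k show "?f k \<le> \<omega> * (real k * p k)"
        using mult_left_mono[OF min.cobounded2 p_nonneg, of k 2 "real k * \<omega>"] by (simp add: ac_simps)
    qed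
    also have "\<dots> = \<omega> * (\<Sum>k\<le>2^j. real k * p k)"
      by (simp add: sum_distrib_left lessThan_Suc_atMost)
    also have "\<dots> \<le> \<omega> * (A * (2 ^ j * \<tau> j))"
      using order_trans[OF sum_k_p_le A(2)] \<omega> by (intro mult_left_mono) auto
    also have "\<dots> \<le> (1/2) ^ j * (A * (2 ^ j * \<tau> j))"
      using \<omega> A \<tau>_pos[of j] by (intro mult_right_mono) auto
    also have "\<dots> = A * \<tau> j" by (simp add: power_one_over)
    finally have "(\<Sum>k<?n. ?f k) \<le> A * \<tau> j" .
    with tl show ?thesis
      using suminf_split_initial_segment[OF sm, of ?n] by (simp add: algebra_simps)
  qed
  then show ?thesis using A by (intro exI[of _ "A + 2"]) auto
qed

text \<open>All terms are nonnegative, so it is enough to keep \<open>2\<^sup>j\<^sup>+\<^sup>1 < k \<le> 2\<^sup>j\<^sup>+\<^sup>2\<close>. If \<open>\<bar>\<theta>\<bar> \<ge> 2\<^sup>-\<^sup>j\<^sup>-\<^sup>1\<close>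
then \<open>k \<bar>\<theta>\<bar>\<close> lies in \<open>[1, 4]\<close>, where the cosine is at most \<open>cos 1\<close>; otherwise
\<open>r\<^sup>k \<le> e\<^sup>-\<^sup>1\<close>. These \<open>k\<close> carry a fixed proportion of \<open>\<tau>\<^sub>j\<close>.\<close>

lemma generating_function_lower_bound:
  "\<exists>c>0. \<forall>\<^sub>F j in sequentially. \<forall>r \<theta>. 0 \<le> r \<longrightarrow> r \<le> 1 \<longrightarrow>
     (1/2) ^ Suc j \<le> max (1 - r) \<bar>\<theta>\<bar> \<longrightarrow> max (1 - r) \<bar>\<theta>\<bar> \<le> (1/2) ^ j \<longrightarrow>
     c * \<tau> j \<le> (\<Sum>k. p k * (1 - r ^ k * cos (real k * \<theta>)))"
proof -
  obtain c0 where c0: "c0 > 0" "\<forall>\<^sub>F j in sequentially. c0 * \<tau> j \<le> \<tau> j - \<tau> (Suc j)" using \<tau>_gap by blast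
  obtain D where D: "D \<ge> 1" "\<And>j. \<tau> j \<le> D * \<tau> (Suc j)" using \<tau>_doubling by blast
  define a where "a = min (1 - cos 1) (1 - exp (-1 :: real))"
  have "cos (1::real) < cos 0" by (intro cos_monotone_0_pi) (use pi_gt3 in auto)
  then have a: "a > 0" by (simp add: a_def)
  define c where "c = a * c0 / D"
  have c: "c > 0" using a c0 D by (simp add: c_def)
  from c0(2) obtain N where N: "\<And>j. j \<ge> N \<Longrightarrow> c0 * \<tau> j \<le> \<tau> j - \<tau> (Suc j)" by (auto simp: eventually_sequentially)
  have "c * \<tau> j \<le> (\<Sum>k. p k * (1 - r ^ k * cos (real k * \<theta>)))"
    if j: "j \<ge> N" and r: "0 \<le> r" "r \<le> 1" and lo: "(1/2) ^ Suc j \<le> max (1 - r) \<bar>\<theta>\<bar>"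
      and hi: "max (1 - r) \<bar>\<theta>\<bar> \<le> (1/2) ^ j" for j r \<theta>
  proof -
    let ?f = "\<lambda>k. p k * (1 - r ^ k * cos (real k * \<theta>))"
    let ?I = "{2 ^ Suc j<..2 ^ Suc (Suc j)}"
    have rc: "\<bar>r ^ k * cos (real k * \<theta>)\<bar> \<le> 1" for k
    proof -
      have "\<bar>r ^ k\<bar> * \<bar>cos (real k * \<theta>)\<bar> \<le> 1 * 1" using r by (intro mult_mono) (auto simp: power_le_one)
      then show ?thesis by (simp add: abs_mult)
    qed
    have f_nonneg: "?f k \<ge> 0" for k using rc[of k] p_nonneg[of k] by (intro mult_nonneg_nonneg) auto
    have "?f k \<le> 2 * p k" for k
      using mult_left_mono[OF _ p_nonneg, of "1 - r ^ k * cos (real k * \<theta>)" 2 k] rc[of k] by (simp add: mult.commute)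
    then have sm: "summable ?f"
      by (intro summable_comparison_test'[OF summable_mult[OF p_summable, of 2]]) (use f_nonneg in auto)
    have key: "a \<le> 1 - r ^ k * cos (real k * \<theta>)" if k: "k \<in> ?I" for k
    proof -
      have kk: "2 ^ Suc j \<le> real k" "real k \<le> 2 ^ Suc (Suc j)"
      proof -
        have "2 ^ Suc j \<le> k" "k \<le> 2 ^ Suc (Suc j)" using k by auto
        then have "real (2 ^ Suc j) \<le> real k" "real k \<le> real (2 ^ Suc (Suc j))" by (auto simp only: of_nat_le_iff)
        then show "2 ^ Suc j \<le> real k" "real k \<le> 2 ^ Suc (Suc j)" by simp_all
      qed
      have cancel: "2 ^ Suc j * (1/2) ^ Suc j = (1::real)" "2 ^ Suc (Suc j) * (1/2) ^ j = (4::real)"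
        by (simp_all add: power_one_over)
      show ?thesis
      proof (cases "(1/2) ^ Suc j \<le> \<bar>\<theta>\<bar>")
        case True
        have 1: "1 \<le> real k * \<bar>\<theta>\<bar>" using mult_mono[OF kk(1) True] cancel by simp
        have 4: "real k * \<bar>\<theta>\<bar> \<le> 4" using mult_mono[OF kk(2), of "\<bar>\<theta>\<bar>" "(1/2)^j"] hi cancel by simp
        have "cos (real k * \<bar>\<theta>\<bar>) \<le> cos 1"
        proof (cases "real k * \<bar>\<theta>\<bar> \<le> pi")
          case True then show ?thesis using 1 by (intro cos_monotone_0_pi_le) auto
        next
          case False
          have "cos (real k * \<bar>\<theta>\<bar>) = cos (2 * pi - real k * \<bar>\<theta>\<bar>)" by simp
          also have "\<dots> \<le> cos 1" using False 4 pi_gt3 by (intro cos_monotone_0_pi_le) auto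
          finally show ?thesis .
        qed
        moreover have "cos (real k * \<bar>\<theta>\<bar>) = cos (real k * \<theta>)" by (simp add: abs_if)
        ultimately have cs: "cos (real k * \<theta>) \<le> cos 1" by simp
        have "r ^ k * cos (real k * \<theta>) \<le> r ^ k * cos 1" using cs r by (intro mult_left_mono) auto
        also have "\<dots> \<le> 1 * cos 1" using r cos_gt_zero[of 1] pi_gt3 by (intro mult_right_mono power_le_one) auto
        finally show ?thesis by (simp add: a_def)
      next
        case False
        then have r1: "(1/2) ^ Suc j \<le> 1 - r" using lo by linarith
        have "r ^ k \<le> exp (- (1 - r)) ^ k" using exp_ge_add_one_self[of "- (1 - r)"] r by (intro power_mono) auto
        also have "\<dots> = exp (- (real k * (1 - r)))" by (simp add: exp_of_nat_mult[symmetric] algebra_simps)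
        also have "\<dots> \<le> exp (-1)" using mult_mono[OF kk(1) r1] cancel by simp
        finally have "r ^ k \<le> exp (-1)" .
        moreover have "r ^ k * cos (real k * \<theta>) \<le> r ^ k * 1" using r by (intro mult_left_mono) auto
        ultimately show ?thesis by (simp add: a_def)
      qed
    qed
    have "c * \<tau> j \<le> a * (c0 * \<tau> (Suc j))"
      using mult_left_mono[OF D(2)[of j], of "a * c0 / D"] a c0 D by (simp add: c_def)
    also have "\<dots> \<le> a * (\<tau> (Suc j) - \<tau> (Suc (Suc j)))" using N[of "Suc j"] j a by (intro mult_left_mono) auto
    also have "\<dots> = (\<Sum>k\<in>?I. p k * a)"
      using sum_p_Ioc[of "2 ^ Suc j" "2 ^ Suc (Suc j)"]
      unfolding sum_distrib_right[symmetric] by (simp add: \<tau>_def)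
    also have "\<dots> \<le> (\<Sum>k\<in>?I. ?f k)" using key p_nonneg by (intro sum_mono mult_left_mono) auto
    also have "\<dots> \<le> (\<Sum>k. ?f k)" using f_nonneg by (intro sum_le_suminf[OF sm]) auto
    finally show ?thesis .
  qed
  then show ?thesis using c by (intro exI[of _ c] conjI eventually_sequentiallyI[of N]) auto
qed

end

section \<open>Complexification and the resolvent of the operator power series\<close>

lemma cscale_apply:
  "cscale c x = (Re c *\<^sub>R fst x - Im c *\<^sub>R snd x, Im c *\<^sub>R fst x + Re c *\<^sub>R snd x)"
  by (simp add: cscale.rep_eq)

lemma complexify_apply: "complexify A x = (A (fst x), A (snd x))"
  by (simp add: complexify.rep_eq)

lemma cscale_1 [simp]: "cscale 1 x = x"
  by (simp add: cscale_apply)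

lemma cscale_mult: "cscale (a * b) x = cscale a (cscale b x)"
  by (simp add: cscale_apply algebra_simps scaleR_add_left scaleR_diff_left)

lemma cscale_of_real: "cscale (of_real r) x = r *\<^sub>R x"
  by (simp add: cscale_apply scaleR_prod_def)

lemma norm_cscale_le: "norm (cscale c x) \<le> 2 * norm c * norm x"
proof -
  have eq: "cscale c x = Re c *\<^sub>R x + Im c *\<^sub>R (- snd x, fst x)"
    by (cases x) (simp add: cscale_apply)
  have "norm (- snd x, fst x) = norm x" by (cases x) (simp add: norm_Pair add.commute)
  then have "norm (cscale c x) \<le> \<bar>Re c\<bar> * norm x + \<bar>Im c\<bar> * norm x"
    unfolding eq using norm_triangle_ineq[of "Re c *\<^sub>R x" "Im c *\<^sub>R (- snd x, fst x)"]
    by (simp only: norm_scaleR)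
  also have "\<dots> \<le> norm c * norm x + norm c * norm x"
    by (intro add_mono mult_right_mono abs_Re_le_cmod abs_Im_le_cmod) auto
  finally show ?thesis by simp
qed

lemma norm_cscale: "norm (cscale c) \<le> 2 * norm c"
  using norm_cscale_le[of c] by (intro norm_blinfun_bound) auto

lemma bounded_linear_cscale: "bounded_linear cscale"
proof (rule bounded_linear_intro)
  show "norm (cscale c :: ('a \<times> 'a) \<Rightarrow>\<^sub>L ('a \<times> 'a)) \<le> norm c * 2" for c using norm_cscale[of c] by (simp add: mult.commute)
qed (auto intro!: blinfun_eqI simp: cscale_apply blinfun.add_left blinfun.scaleR_left algebra_simps)

lemmas cscale_continuous_on [continuous_intros] = bounded_linear.continuous_on[OF bounded_linear_cscale]

lemma cscale_diff_left: "cscale (a - b) = cscale a - cscale b"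
  by (rule linear_diff[OF bounded_linear.linear[OF bounded_linear_cscale]])

lemma norm_complexify: "norm (complexify A) \<le> norm A"
proof (rule norm_blinfun_bound)
  fix x
  have "norm (complexify A x) = sqrt ((norm (A (fst x)))\<^sup>2 + (norm (A (snd x)))\<^sup>2)"
    by (simp add: complexify_apply norm_Pair)
  also have "\<dots> \<le> sqrt ((norm A * norm (fst x))\<^sup>2 + (norm A * norm (snd x))\<^sup>2)"
    by (intro real_sqrt_le_mono add_mono power_mono norm_blinfun) auto
  also have "\<dots> = norm A * norm x"
    by (simp add: norm_prod_def power_mult_distrib distrib_left[symmetric] real_sqrt_mult)
  finally show "norm (complexify A x) \<le> norm A * norm x" .
qed simp

lemma complexify_cscale: "complexify A (cscale c x) = cscale c (complexify A x)"
  by (simp add: cscale_apply complexify_apply blinfun.bilinear_simps)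

lemma complexify_sum: "complexify (\<Sum>k\<in>S. f k) x = (\<Sum>k\<in>S. complexify (f k) x)"
  by (simp add: complexify_apply blinfun.sum_left sum_prod)

lemma norm_complex_coefficient_le: 
  "norm (cscale c o\<^sub>L complexify A) \<le> 2 * norm c * norm A"
  using order_trans[OF norm_blinfun_compose mult_mono[OF norm_cscale norm_complexify]] by simp

text \<open>The solution \<open>T\<^sub>n\<close> of the renewal equation \<open>T\<^sub>n = \<Sum>\<^sub>k T\<^sub>n\<^sub>-\<^sub>k Q\<^sub>k\<close> with \<open>T\<^sub>0 = 1\<close>. The sum is indexed by \<open>k - 1\<close>.\<close>

fun renewal :: "(nat \<Rightarrow> 'b::real_normed_vector \<Rightarrow>\<^sub>L 'b) \<Rightarrow> nat \<Rightarrow> 'b \<Rightarrow>\<^sub>L 'b" where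
  "renewal Q n = (if n = 0 then id_blinfun else \<Sum>k<n. renewal Q (n - Suc k) o\<^sub>L Q (Suc k))"

declare renewal.simps [simp del]

text \<open>The dynamics is reduced to these data. The form \<open>pr u v\<close> stands for \<open>\<integral> u v d\<mu>\<close>. It supplies
the functional \<open>pr _ e\<close>, which is integration if \<open>e\<close> is the constant function \<open>1\<close>, and it
separates points, so that identities between vectors can be checked on scalars.\<close>

locale operator_renewal = regular_tail t \<beta> for t \<beta> +
  fixes Rn :: "nat \<Rightarrow> 'b::banach \<Rightarrow>\<^sub>L 'b" and pr :: "'b \<Rightarrow> 'b \<Rightarrow> real" and e :: 'b and C :: real
  assumes pr: "bounded_bilinear pr" and pr_definite: "\<And>x. pr x x = 0 \<Longrightarrow> x = 0" and pr_e: "pr e e = 1"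
    and C: "C > 0" and Rn_le: "\<And>n. norm (Rn (Suc n)) \<le> C * p (Suc n)"
    and pr_Rn_e: "\<And>n. pr (Rn (Suc n) e) e = p (Suc n)"
    and pr_R: "\<And>v. (\<lambda>n. pr (Rn (Suc n) v) e) sums pr v e"
    and R_e: "(\<lambda>n. Rn (Suc n) e) sums e"
    and H2: "H2 Rn"
begin

sublocale pr: bounded_bilinear pr by (rule pr)

abbreviation R :: "complex \<Rightarrow> ('b \<times> 'b) \<Rightarrow>\<^sub>L ('b \<times> 'b)" where "R z \<equiv> R_series Rn z"

abbreviation Rc :: "nat \<Rightarrow> ('b \<times> 'b) \<Rightarrow>\<^sub>L ('b \<times> 'b)" where "Rc k \<equiv> complexify (Rn (Suc k))"

definition R_term :: "complex \<Rightarrow> nat \<Rightarrow> ('b \<times> 'b) \<Rightarrow>\<^sub>L ('b \<times> 'b)" where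
  "R_term z k = cscale (z ^ Suc k) o\<^sub>L Rc k"

lemma norm_coefficient_le: "norm (cscale c o\<^sub>L Rc k) \<le> 2 * C * norm c * p (Suc k)"
proof -
  have "norm (cscale c o\<^sub>L Rc k) \<le> 2 * norm c * (C * p (Suc k))"
    by (rule order_trans[OF norm_complex_coefficient_le]) (intro mult_left_mono Rn_le, simp)
  then show ?thesis by (simp add: ac_simps)
qed

lemma norm_R_term: assumes "norm z \<le> 1" shows "norm (R_term z k) \<le> 2 * C * p (Suc k)"
proof -
  have "2 * C * norm (z ^ Suc k) * p (Suc k) \<le> 2 * C * 1 * p (Suc k)"
    using C p_nonneg assms by (intro mult_right_mono mult_left_mono) (auto simp: norm_power norm_mult intro!: mult_le_one power_le_one)
  then show ?thesis
    using norm_coefficient_le[of "z ^ Suc k" k] unfolding R_term_def by linarith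
qed

lemma p_Suc_summable: "summable (\<lambda>k. p (Suc k))"
  using p_summable by (simp add: summable_Suc_iff)

lemma R_term_summable: assumes "norm z \<le> 1" shows "summable (R_term z)"
  by (rule summable_norm_cancel, rule summable_comparison_test'[OF summable_mult[OF p_Suc_summable, of "2 * C"]])
     (use norm_R_term[OF assms] in auto)

lemma R_eq: "R z = suminf (R_term z)"
  by (simp add: R_series_def R_term_def[abs_def])

lemma R_sums: assumes "norm z \<le> 1" shows "(\<lambda>k. cscale (z ^ Suc k) (Rc k x)) sums R z x"
proof -
  have "(\<lambda>k. R_term z k x) sums R z x"
    unfolding R_eq using R_term_summable[OF assms]
    by (intro bounded_linear.sums[OF blinfun.bounded_linear_left] summable_sums)
  then show ?thesis by (simp add: R_term_def)
qed

lemma R_cscale: assumes "norm z \<le> 1" shows "R z (cscale c x) = cscale c (R z x)"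
proof -
  have "(\<lambda>k. cscale c (cscale (z ^ Suc k) (Rc k x))) sums cscale c (R z x)"
    by (intro bounded_linear.sums[OF blinfun.bounded_linear_right] R_sums assms)
  moreover have "cscale c (cscale (z ^ Suc k) (Rc k x)) =
      cscale (z ^ Suc k) (Rc k (cscale c x))" for k
    by (simp add: complexify_cscale cscale_mult[symmetric] mult.commute)
  ultimately have "(\<lambda>k. cscale (z ^ Suc k) (Rc k (cscale c x))) sums cscale c (R z x)"
    by (simp only:)
  from sums_unique2[OF R_sums[OF assms] this] show ?thesis .
qed

lemma R_diff_le:
  assumes "norm z \<le> 1" "norm w \<le> 1"
  shows "norm (R z - R w) \<le> 2 * C * (\<Sum>k. p k * min 2 (real k * norm (z - w)))"
proof -
  let ?f = "\<lambda>k. p k * min 2 (real k * norm (z - w))"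
  have smf: "summable ?f"
    by (rule summable_comparison_test'[OF summable_mult[OF p_summable, of 2]])
       (use p_nonneg in \<open>simp add: mult.commute[of 2] mult_left_mono\<close>)
  have sm: "summable (\<lambda>k. 2 * C * ?f (Suc k))"
    by (intro summable_mult) (use smf in \<open>subst summable_Suc_iff\<close>)
  have le: "norm (R_term z k - R_term w k) \<le> 2 * C * ?f (Suc k)" for k
  proof -
    have "norm (z ^ Suc k - w ^ Suc k) \<le> real (Suc k) * norm (z - w)"
      by (rule norm_power_diff) (use assms in auto)
    moreover have "norm (z ^ Suc k - w ^ Suc k) \<le> 1 + 1"
      by (rule order_trans[OF norm_triangle_ineq4 add_mono]) (use assms in \<open>auto simp: norm_power power_le_one simp del: power_Suc\<close>)
    ultimately have b: "norm (z ^ Suc k - w ^ Suc k) \<le> min 2 (real (Suc k) * norm (z - w))" by simp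
    have "R_term z k - R_term w k = cscale (z ^ Suc k - w ^ Suc k) o\<^sub>L Rc k"
      unfolding R_term_def cscale_diff_left by (rule blinfun_eqI) (simp add: blinfun.diff_left)
    then have "norm (R_term z k - R_term w k) \<le> 2 * C * norm (z ^ Suc k - w ^ Suc k) * p (Suc k)"
      using norm_coefficient_le[of "z ^ Suc k - w ^ Suc k" k] by simp
    also have "\<dots> \<le> 2 * C * min 2 (real (Suc k) * norm (z - w)) * p (Suc k)"
      using C p_nonneg b by (intro mult_right_mono mult_left_mono) auto
    finally show ?thesis by (simp add: ac_simps)
  qed
  have smn: "summable (\<lambda>k. norm (R_term z k - R_term w k))"
    by (rule summable_comparison_test'[OF sm]) (use le in auto)
  have "R z - R w = (\<Sum>k. R_term z k - R_term w k)"
    unfolding R_eq using R_term_summable assms by (intro suminf_diff) auto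
  also have "norm \<dots> \<le> (\<Sum>k. norm (R_term z k - R_term w k))" by (rule summable_norm[OF smn])
  also have "\<dots> \<le> (\<Sum>k. 2 * C * ?f (Suc k))" by (rule suminf_le[OF le smn sm])
  also have "\<dots> = 2 * C * (\<Sum>k. ?f (Suc k))"
    by (rule suminf_mult) (use smf in \<open>subst summable_Suc_iff\<close>)
  also have "(\<Sum>k. ?f (Suc k)) = (\<Sum>k. ?f k)" using suminf_split_head[OF smf] by simp
  finally show ?thesis .
qed

text \<open>The factor \<open>4\<close> leaves room for distances that are comparable to \<open>2\<^sup>-\<^sup>j\<close> without being below it.\<close>

lemma R_modulus:
  "\<exists>A>0. \<forall>j z w. norm z \<le> 1 \<longrightarrow> norm w \<le> 1 \<longrightarrow> norm (z - w) \<le> 4 * (1/2) ^ j \<longrightarrow> norm (R z - R w) \<le> A * \<tau> j"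
proof -
  obtain A where A: "A > 0" 
    "\<And>j \<omega>. 0 \<le> \<omega> \<Longrightarrow> \<omega> \<le> (1/2) ^ j \<Longrightarrow> (\<Sum>k. p k * min 2 (real k * \<omega>)) \<le> A * \<tau> j"
    using truncated_mean_le by blast
  have "norm (R z - R w) \<le> (8 * C * A) * \<tau> j"
    if zw: "norm z \<le> 1" "norm w \<le> 1" "norm (z - w) \<le> 4 * (1/2) ^ j" for j z w
  proof -
    define \<omega> where "\<omega> = norm (z - w) / 4"
    have sm: "summable (\<lambda>k. p k * min 2 (real k * x))" if "x \<ge> 0" for x
      by (rule summable_comparison_test'[OF summable_mult[OF p_summable, of 2]])
         (use p_nonneg that in \<open>simp add: mult.commute[of 2] mult_left_mono\<close>)
    have "(\<Sum>k. p k * min 2 (real k * norm (z - w))) \<le> (\<Sum>k. 4 * (p k * min 2 (real k * \<omega>)))"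
    proof (rule suminf_le)
      fix k
      have "min 2 (real k * norm (z - w)) \<le> 4 * min 2 (real k * \<omega>)" by (simp add: \<omega>_def min_def)
      from mult_left_mono[OF this p_nonneg, of k]
      show "p k * min 2 (real k * norm (z - w)) \<le> 4 * (p k * min 2 (real k * \<omega>))" by (simp add: ac_simps)
    qed (use sm[of \<omega>] sm[of "norm (z - w)"] in \<open>auto intro!: summable_mult simp: \<omega>_def\<close>)
    also have "\<dots> = 4 * (\<Sum>k. p k * min 2 (real k * \<omega>))"
      by (rule suminf_mult) (use sm[of \<omega>] in \<open>simp add: \<omega>_def\<close>)
    also have "\<dots> \<le> 4 * (A * \<tau> j)" using zw by (intro mult_left_mono A(2)) (auto simp: \<omega>_def)
    finally have "2 * C * (\<Sum>k. p k * min 2 (real k * norm (z - w))) \<le> 2 * C * (4 * (A * \<tau> j))"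
      using C by (intro mult_left_mono) auto
    with R_diff_le[OF zw(1,2)] show ?thesis by (simp add: ac_simps)
  qed
  then show ?thesis using A C by (intro exI[of _ "8 * C * A"]) auto
qed

lemma R_continuous: "continuous_on (cball 0 1) R"
proof -
  obtain A where A: "A > 0"
    "\<And>j z w. norm z \<le> 1 \<Longrightarrow> norm w \<le> 1 \<Longrightarrow> norm (z - w) \<le> 4 * (1/2) ^ j \<Longrightarrow> norm (R z - R w) \<le> A * \<tau> j"
    using R_modulus by blast
  show ?thesis unfolding continuous_on_iff
  proof (intro ballI allI impI)
    fix z :: complex and \<epsilon> :: real assume z: "z \<in> cball 0 1" and \<epsilon>: "0 < \<epsilon>"
    have "(\<lambda>j. A * \<tau> j) \<longlonglongrightarrow> 0" by (intro tendsto_mult_right_zero \<tau>_lim)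
    from order_tendstoD(2)[OF this \<epsilon>] obtain j where j: "A * \<tau> j < \<epsilon>" by (auto simp: eventually_sequentially)
    have "dist (R w) (R z) < \<epsilon>" if "w \<in> cball 0 1" "dist w z < (1/2) ^ j" for w
    proof -
      have "0 < (1/2 :: real) ^ j" by simp
      then have "norm (w - z) \<le> 4 * (1/2) ^ j" using that(2) unfolding dist_norm by linarith
      then have "norm (R w - R z) \<le> A * \<tau> j" using that(1) z by (intro A(2)) auto
      then show ?thesis using j by (simp add: dist_norm)
    qed
    then show "\<exists>d>0. \<forall>x'\<in>cball 0 1. dist x' z < d \<longrightarrow> dist (R x') (R z) < \<epsilon>"
      by (intro exI[of _ "(1/2) ^ j"]) auto
  qed
qed

text \<open>The resolvent \<open>(1 - R(z))\<^sup>-\<^sup>1\<close>; by (H2) it exists on the closed disc except at \<open>1\<close>.\<close>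

definition T :: "complex \<Rightarrow> ('b \<times> 'b) \<Rightarrow>\<^sub>L ('b \<times> 'b)" where
  "T z = (SOME S. S o\<^sub>L (cscale 1 - R z) = id_blinfun \<and> (cscale 1 - R z) o\<^sub>L S = id_blinfun)"

lemma T_inverse:
  assumes "norm z \<le> 1" "z \<noteq> 1"
  shows "T z (x - R z x) = x" "T z x - R z (T z x) = x"
proof -
  have "1 \<notin> cspectrum (R z)" using H2 assms unfolding H2_def by blast
  then have "\<exists>S. S o\<^sub>L (cscale 1 - R z) = id_blinfun \<and> (cscale 1 - R z) o\<^sub>L S = id_blinfun"
    by (simp add: cspectrum_def)
  from someI_ex[OF this] have T: "T z o\<^sub>L (cscale 1 - R z) = id_blinfun" "(cscale 1 - R z) o\<^sub>L T z = id_blinfun"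
    unfolding T_def by blast+
  show "T z (x - R z x) = x" using arg_cong[OF T(1), of "\<lambda>f. blinfun_apply f x"] by (simp add: blinfun.diff_left)
  show "T z x - R z (T z x) = x" using arg_cong[OF T(2), of "\<lambda>f. blinfun_apply f x"] by (simp add: blinfun.diff_left)
qed

lemma T_cscale:
  assumes "norm z \<le> 1" "z \<noteq> 1"
  shows "T z (cscale c x) = cscale c (T z x)"
proof -
  have "cscale c (T z x) - R z (cscale c (T z x)) = cscale c x"
    using T_inverse(2)[OF assms, of x] R_cscale[OF assms(1)] by (simp add: blinfun.diff_right[symmetric])
  then show ?thesis using T_inverse(1)[OF assms, of "cscale c (T z x)"] by simp
qed

lemma T_diff:
  assumes "norm z \<le> 1" "z \<noteq> 1" "norm w \<le> 1" "w \<noteq> 1"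
  shows "T z x - T w x = T z ((R z - R w) (T w x))"
proof -
  have "T z (T w x - R w (T w x)) = T z x" using T_inverse(2)[OF assms(3,4)] by simp
  then have "T z x = T z (T w x) - T z (R w (T w x))" by (simp add: blinfun.diff_right)
  moreover have "T w x = T z (T w x) - T z (R z (T w x))"
    using T_inverse(1)[OF assms(1,2), of "T w x"] by (simp add: blinfun.diff_right)
  ultimately have "T z x - T w x =
      (T z (T w x) - T z (R w (T w x))) - (T z (T w x) - T z (R z (T w x)))"
    by (rule arg_cong2)
  then show ?thesis by (simp add: blinfun.diff_left blinfun.diff_right)
qed

text \<open>Invertibility is known at every point, so the resolvent identity suffices:
\<open>T(z) - T(w) = T(z) (R(z) - R(w)) T(w)\<close> first bounds \<open>T(z)\<close> near \<open>w\<close> by twice the norm of \<open>T(w)\<close>, and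
then gives convergence.\<close>

lemma T_continuous: "continuous_on (cball 0 1 - {1}) T"
  unfolding continuous_on_def
proof
  fix w assume w: "w \<in> cball 0 1 - {1 :: complex}"
  let ?F = "at w within (cball 0 1 - {1})"
  define M where "M = norm (T w)"
  have "continuous_on (cball 0 1 - {1}) R" using R_continuous by (rule continuous_on_subset) auto
  then have Rlim: "(R \<longlongrightarrow> R w) ?F" using w by (simp add: continuous_on_def)
  then have lim0: "((\<lambda>z. norm (R z - R w)) \<longlongrightarrow> 0) ?F" by (simp add: LIM_zero tendsto_norm_zero)
  have "1 / (2 * (M + 1)) > 0" by (simp add: M_def add_nonneg_pos)
  from order_tendstoD(2)[OF lim0 this] have "\<forall>\<^sub>F z in ?F. norm (R z - R w) < 1 / (2 * (M + 1))" .
  moreover have "\<forall>\<^sub>F z in ?F. z \<in> cball 0 1 - {1}" by (simp add: eventually_at_filter)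
  ultimately have ev: "\<forall>\<^sub>F z in ?F. norm (T z - T w) \<le> 2 * M * M * norm (R z - R w)"
  proof eventually_elim
    case (elim z)
    have eq: "T z - T w = T z o\<^sub>L ((R z - R w) o\<^sub>L T w)"
      using elim(2) w T_diff[of z w] by (intro blinfun_eqI) (simp add: blinfun.diff_left)
    have "norm (T z - T w) \<le> norm (T z) * norm ((R z - R w) o\<^sub>L T w)"
      unfolding eq by (rule norm_blinfun_compose)
    also have "\<dots> \<le> norm (T z) * (norm (R z - R w) * M)"
      unfolding M_def by (intro mult_left_mono norm_blinfun_compose) auto
    finally have le: "norm (T z - T w) \<le> norm (T z) * (norm (R z - R w) * M)" .
    have "norm (R z - R w) * M \<le> 1 / (2 * (M + 1)) * M"
      using elim(1) by (intro mult_right_mono) (auto simp: M_def)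
    also have "\<dots> \<le> 1/2" using norm_ge_zero[of "T w"] unfolding M_def[symmetric] by (simp add: field_simps)
    finally have half: "norm (R z - R w) * M \<le> 1/2" .
    have "norm (T z) \<le> M + norm (T z - T w)"
      using norm_triangle_ineq[of "T w" "T z - T w"] by (simp add: M_def)
    also have "\<dots> \<le> M + norm (T z) * (1/2)"
      using le mult_left_mono[OF half, of "norm (T z)"] by simp
    finally have "norm (T z) \<le> 2 * M" by simp
    then have "norm (T z) * (norm (R z - R w) * M) \<le> 2 * M * (norm (R z - R w) * M)"
      by (rule mult_right_mono) (simp add: M_def)
    with le show ?case by (simp add: ac_simps)
  qed
  have "((\<lambda>z. 2 * M * M * norm (R z - R w)) \<longlongrightarrow> 0) ?F" by (intro tendsto_mult_right_zero lim0)
  with ev have "((\<lambda>z. T z - T w) \<longlongrightarrow> 0) ?F" by (rule Lim_null_comparison)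
  then show "(T \<longlongrightarrow> T w) ?F" by (simp add: LIM_zero_iff)
qed

end

section \<open>Fourier coefficients of the resolvent\<close>

context operator_renewal
begin

text \<open>The complex linear extension of \<open>pr _ v\<close> to the complexification.\<close>

definition cpr :: "'b \<Rightarrow> 'b \<times> 'b \<Rightarrow> complex" where
  "cpr v x = Complex (pr (fst x) v) (pr (snd x) v)"

lemma bounded_linear_cpr: "bounded_linear (cpr v)"
proof -
  have "bounded_linear (\<lambda>x. of_real (pr (fst x) v) + \<i> * of_real (pr (snd x) v) :: complex)"
    by (intro bounded_linear_add bounded_linear_const_mult bounded_linear_compose[OF bounded_linear_of_real]
        bounded_linear_compose[OF pr.bounded_linear_left bounded_linear_fst]
        bounded_linear_compose[OF pr.bounded_linear_left bounded_linear_snd])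
  then show ?thesis by (simp add: cpr_def[abs_def] Complex_eq)
qed

lemma cpr_cscale: "cpr v (cscale c x) = c * cpr v x"
  by (simp add: cpr_def cscale_apply complex_eq_iff pr.add_left pr.diff_left pr.scaleR_left)

lemma cpr_separates: assumes "\<And>v. cpr v x = 0" shows "x = 0"
proof -
  have "pr (fst x) (fst x) = 0" "pr (snd x) (snd x) = 0"
    using assms[of "fst x"] assms[of "snd x"] by (simp_all add: cpr_def complex_eq_iff)
  then show ?thesis using pr_definite by (simp add: prod_eq_iff)
qed

text \<open>The difference quotient of \<open>R\<close>, with \<open>(w\<^sup>k - z\<^sup>k) / (w - z)\<close> written out as a polynomial so that it is
also defined, and continuous, at \<open>w = z\<close>.\<close>

definition R_quot :: "complex \<Rightarrow> complex \<Rightarrow> 'b \<times> 'b \<Rightarrow> 'b \<times> 'b" where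
  "R_quot z w y = (\<Sum>k. cscale (\<Sum>i<Suc k. z ^ (Suc k - Suc i) * w ^ i) (Rc k y))"

lemma R_quot_bound:
  assumes "norm z \<le> \<rho>" "norm w \<le> \<rho>" "\<rho> < 1"
  shows "norm (cscale (\<Sum>i<Suc k. z ^ (Suc k - Suc i) * w ^ i) (Rc k y))
    \<le> 2 * C * norm y * (real (Suc k) * \<rho> ^ k)"
proof -
  let ?c = "\<Sum>i<Suc k. z ^ (Suc k - Suc i) * w ^ i"
  have \<rho>: "0 \<le> \<rho>" using assms(1) norm_ge_zero order_trans by blast
  have "norm ?c \<le> (\<Sum>i<Suc k. \<rho> ^ k)"
  proof (rule order_trans[OF norm_sum sum_mono])
    fix i assume i: "i \<in> {..<Suc k}"
    have "norm (z ^ (Suc k - Suc i) * w ^ i) \<le> \<rho> ^ (k - i) * \<rho> ^ i"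
      unfolding norm_mult norm_power diff_Suc_Suc using assms \<rho> by (intro mult_mono power_mono) auto
    also have "\<dots> = \<rho> ^ k" using i by (simp add: power_add[symmetric])
    finally show "norm (z ^ (Suc k - Suc i) * w ^ i) \<le> \<rho> ^ k" .
  qed
  then have c: "norm ?c \<le> real (Suc k) * \<rho> ^ k" by simp
  have p1: "p (Suc k) \<le> 1"
    using sum_le_suminf[OF p_summable, of "{Suc k}"] p_nonneg sums_unique[OF p_sums] by simp
  have "norm (cscale ?c (Rc k y)) \<le> norm (cscale ?c o\<^sub>L Rc k) * norm y"
    using norm_blinfun[of "cscale ?c o\<^sub>L Rc k" y] by simp
  also have "\<dots> \<le> (2 * C * norm ?c * p (Suc k)) * norm y"
    by (intro mult_right_mono norm_coefficient_le) auto
  also have "\<dots> \<le> (2 * C * (real (Suc k) * \<rho> ^ k) * 1) * norm y"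
    using C c p1 p_nonneg \<rho> by (intro mult_right_mono mult_mono mult_left_mono) auto
  finally show ?thesis by (simp add: ac_simps)
qed

lemma R_quot_summable:
  assumes "\<rho> < 1" "0 \<le> \<rho>"
  shows "summable (\<lambda>k. 2 * C * norm y * (real (Suc k) * \<rho> ^ k))"
proof -
  have "summable (\<lambda>k. of_nat (Suc k) * \<rho> ^ k)"
    using geometric_deriv_sums[of \<rho>] assms by (auto dest: sums_summable)
  then show ?thesis by (intro summable_mult) simp
qed

lemma R_quot_eq:
  assumes "norm z < 1" "norm w < 1"
  shows "R w y - R z y = cscale (w - z) (R_quot z w y)"
proof -
  define \<rho> where "\<rho> = max (norm z) (norm w)"
  have \<rho>: "norm z \<le> \<rho>" "norm w \<le> \<rho>" "\<rho> < 1" "0 \<le> \<rho>" using assms by (auto simp: \<rho>_def le_max_iff_disj)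
  have "summable (\<lambda>k. cscale (\<Sum>i<Suc k. z ^ (Suc k - Suc i) * w ^ i) (Rc k y))"
    by (rule summable_comparison_test'[OF R_quot_summable[OF \<rho>(3,4), of y]]) (rule R_quot_bound[OF \<rho>(1-3)])
  then have 1: "(\<lambda>k. cscale (w - z) (cscale (\<Sum>i<Suc k. z ^ (Suc k - Suc i) * w ^ i) (Rc k y)))
      sums cscale (w - z) (R_quot z w y)"
    unfolding R_quot_def using blinfun.bounded_linear_right summable_sums bounded_linear.sums by blast
  have 2: "(\<lambda>k. cscale (w ^ Suc k) (Rc k y) - cscale (z ^ Suc k) (Rc k y))
      sums (R w y - R z y)"
    by (intro sums_diff R_sums) (use assms in auto)
  have "cscale (w - z) (cscale (\<Sum>i<Suc k. z ^ (Suc k - Suc i) * w ^ i) x) =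
      cscale (w ^ Suc k) x - cscale (z ^ Suc k) x" for k and x :: "'b \<times> 'b"
  proof -
    have "(w - z) * (\<Sum>i<Suc k. z ^ (Suc k - Suc i) * w ^ i) = w ^ Suc k - z ^ Suc k"
      by (rule power_diff_sumr2[symmetric])
    then have "cscale (w - z) (cscale (\<Sum>i<Suc k. z ^ (Suc k - Suc i) * w ^ i) x) = cscale (w ^ Suc k - z ^ Suc k) x"
      by (simp only: cscale_mult[symmetric])
    then show ?thesis by (simp only: cscale_diff_left blinfun.diff_left)
  qed
  with 1 have "(\<lambda>k. cscale (w ^ Suc k) (Rc k y) - cscale (z ^ Suc k) (Rc k y))
      sums cscale (w - z) (R_quot z w y)" by (simp only:)
  from sums_unique2[OF 2 this] show ?thesis .
qed

lemma R_quot_isCont: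
  assumes "norm z < 1"
  shows "isCont (\<lambda>w. R_quot z w y) z"
proof -
  obtain \<rho> where \<rho>: "norm z < \<rho>" "\<rho> < 1" using assms dense by blast
  then have \<rho>0: "0 \<le> \<rho>" using norm_ge_zero[of z] by linarith
  have "uniform_limit (ball 0 \<rho>) (\<lambda>n w. \<Sum>k<n. cscale (\<Sum>i<Suc k. z ^ (Suc k - Suc i) * w ^ i) (Rc k y))
      (\<lambda>w. R_quot z w y) sequentially"
    unfolding R_quot_def
    by (rule Weierstrass_m_test[OF R_quot_bound[of z \<rho>] R_quot_summable]) (use \<rho> \<rho>0 in auto)
  then have "continuous_on (ball 0 \<rho>) (\<lambda>w. R_quot z w y)"
    by (rule uniform_limit_theorem[rotated])
       (auto intro!: always_eventually continuous_intros)
  then show ?thesis using \<rho> by (simp add: continuous_on_eq_continuous_at)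
qed

lemma T_isCont: assumes "norm z < 1" shows "isCont T z"
proof -
  have "continuous_on (ball 0 1) T" using T_continuous by (rule continuous_on_subset) auto
  then show ?thesis using assms by (simp add: continuous_on_eq_continuous_at)
qed

text \<open>By the resolvent identity the difference quotient at \<open>z\<close> is \<open>T(w)\<close> times the difference quotient of
\<open>R\<close> times \<open>T(z)\<close>, and this is continuous in \<open>w\<close>.\<close>

lemma T_holomorphic: "(\<lambda>z. cpr v (T z x)) holomorphic_on ball 0 1"
proof (rule holomorphic_onI)
  fix z :: complex assume "z \<in> ball 0 1"
  then have z: "norm z < 1" by simp
  then have z1: "z \<noteq> 1" by auto
  have "isCont (\<lambda>w. cpr v (T w (R_quot z w (T z x)))) z"
    by (intro bounded_linear.continuous[OF bounded_linear_cpr] continuous_intros T_isCont R_quot_isCont z)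
  then have lim: "((\<lambda>w. cpr v (T w (R_quot z w (T z x)))) \<longlongrightarrow> cpr v (T z (R_quot z z (T z x)))) (at z)"
    by (simp add: isCont_def)
  have "\<forall>\<^sub>F w in at z. w \<in> ball 0 1" using z by (intro eventually_at_in_open') auto
  moreover have "\<forall>\<^sub>F w in at z. w \<noteq> z" by (simp add: eventually_at_filter)
  ultimately have ev: "\<forall>\<^sub>F w in at z. cpr v (T w (R_quot z w (T z x))) = (cpr v (T w x) - cpr v (T z x)) / (w - z)"
  proof eventually_elim
    case (elim w)
    then have w: "norm w < 1" "w \<noteq> 1" by auto
    have "T w x - T z x = T w (cscale (w - z) (R_quot z w (T z x)))"
      using T_diff[of w z x] R_quot_eq[OF z w(1), of "T z x"] z w z1 by (simp add: blinfun.diff_left)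
    also have "\<dots> = cscale (w - z) (T w (R_quot z w (T z x)))" using w by (intro T_cscale) auto
    finally have "cpr v (T w x - T z x) = (w - z) * cpr v (T w (R_quot z w (T z x)))" by (simp add: cpr_cscale)
    then show ?case using elim by (simp add: linear_diff[OF bounded_linear.linear[OF bounded_linear_cpr]])
  qed
  have "((\<lambda>w. cpr v (T w x)) has_field_derivative cpr v (T z (R_quot z z (T z x)))) (at z)"
    unfolding has_field_derivative_iff by (rule Lim_transform_eventually[OF lim ev])
  then show "(\<lambda>z. cpr v (T z x)) field_differentiable at z within ball 0 1"
    using field_differentiable_at_within field_differentiable_def by blast
qed

text \<open>Over the circle of radius \<open>r\<close>, the mean of this function is the \<open>n\<close>-th Laurent coefficient of
\<open>z \<mapsto> T(z) x\<close>.\<close>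

definition coeff_integrand :: "real \<Rightarrow> int \<Rightarrow> 'b \<times> 'b \<Rightarrow> real \<Rightarrow> 'b \<times> 'b" where
  "coeff_integrand r n x \<theta> = cscale ((of_real r * cis \<theta>) powi (- n)) (T (of_real r * cis \<theta>) x)"

definition coeff :: "real \<Rightarrow> int \<Rightarrow> 'b \<times> 'b \<Rightarrow> 'b \<times> 'b" where
  "coeff r n x = integral {- pi..pi} (coeff_integrand r n x)"

context
  fixes r :: real assumes r: "0 < r" "r < 1"
begin

lemma T_circle_continuous: "continuous_on S (\<lambda>\<theta>. T (of_real r * cis \<theta>))"
proof (rule continuous_on_compose2[OF T_continuous])
  have "of_real r * cis \<theta> \<noteq> 1" for \<theta>
  proof
    assume "of_real r * cis \<theta> = 1"
    then have "norm (of_real r * cis \<theta>) = 1" by simp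
    then show False using r by (simp add: norm_mult)
  qed
  then show "(\<lambda>\<theta>. of_real r * cis \<theta>) ` S \<subseteq> cball 0 1 - {1}" using r by (auto simp: norm_mult)
qed (intro continuous_intros)

lemma coeff_integrand_continuous: "continuous_on S (coeff_integrand r n x)"
  unfolding coeff_integrand_def[abs_def] using r
  by (intro continuous_intros T_circle_continuous) auto

lemma coeff_has_integral: "(coeff_integrand r n x has_integral coeff r n x) {- pi..pi}"
  unfolding coeff_def using coeff_integrand_continuous integrable_continuous_real integrable_integral by blast

lemma circle_ne: "norm (of_real r * cis \<theta>) \<le> 1" "of_real r * cis \<theta> \<noteq> 1" "of_real r * cis \<theta> \<noteq> 0"
proof -
  have "norm (of_real r * cis \<theta>) < 1" using r by (simp add: norm_mult)
  then show "norm (of_real r * cis \<theta>) \<le> 1" "of_real r * cis \<theta> \<noteq> 1" by auto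
  show "of_real r * cis \<theta> \<noteq> 0" using r by simp
qed

text \<open>Tested against a scalar functional, the integrand becomes a holomorphic function times a
nonnegative power of \<open>z\<close>, and Cauchy's theorem applies.\<close>

lemma coeff_negative: assumes "n < 0" shows "coeff r n x = 0"
proof (rule cpr_separates)
  fix v
  define m where "m = nat (- n - 1)"
  have m: "- n = int (Suc m)" using assms by (simp add: m_def)
  let ?g = "\<lambda>z. cpr v (T z x) * z ^ m"
  have "(?g has_contour_integral 0) (part_circlepath 0 r (- pi) pi)"
  proof (rule Cauchy_theorem_disc_simple)
    show "?g holomorphic_on ball 0 1" by (intro holomorphic_intros T_holomorphic)
    show "path_image (part_circlepath 0 r (- pi) pi) \<subseteq> ball 0 1"
      using r by (auto simp: path_image_part_circlepath' norm_mult)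
    show "pathfinish (part_circlepath 0 r (- pi) pi) = pathstart (part_circlepath 0 r (- pi) pi)"
      by (simp add: exp_eq_polar cis_conv_exp[symmetric] complex_eq_iff)
  qed auto
  then have "((\<lambda>\<theta>. ?g (of_real r * cis \<theta>) * of_real r * \<i> * cis \<theta>) has_integral 0) {- pi..pi}"
    by (subst (asm) has_contour_integral_part_circlepath_iff) auto
  then have "((\<lambda>\<theta>. - \<i> * (?g (of_real r * cis \<theta>) * of_real r * \<i> * cis \<theta>)) has_integral - \<i> * 0) {- pi..pi}"
    by (rule has_integral_mult_right)
  moreover have "- \<i> * (?g (of_real r * cis \<theta>) * of_real r * \<i> * cis \<theta>) = cpr v (coeff_integrand r n x \<theta>)" for \<theta>
    unfolding coeff_integrand_def cpr_cscale m power_int_of_nat by (simp add: algebra_simps)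
  ultimately have "((\<lambda>\<theta>. cpr v (coeff_integrand r n x \<theta>)) has_integral 0) {- pi..pi}" by simp
  moreover have "((\<lambda>\<theta>. cpr v (coeff_integrand r n x \<theta>)) has_integral cpr v (coeff r n x)) {- pi..pi}"
    using has_integral_linear[OF coeff_has_integral bounded_linear_cpr] by (simp add: o_def)
  ultimately show "cpr v (coeff r n x) = 0" using has_integral_unique by blast
qed

lemma integral_character:
  "((\<lambda>\<theta>. (of_real r * cis \<theta>) powi (- int n)) has_integral (if n = 0 then of_real (2 * pi) else 0)) {- pi..pi}"
proof (cases "n = 0")
  case True
  then show ?thesis using has_integral_const_real[of "1 :: complex" "- pi" pi] by (simp add: scaleR_conv_of_real)
next
  case False
  define F where "F \<theta> = (\<i> / of_nat n) * of_real (inverse (r ^ n)) * cis (- (real n * \<theta>))" for \<theta>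
  have eq: "(of_real r * cis \<theta>) powi (- int n) = of_real (inverse (r ^ n)) * cis (- (real n * \<theta>))" for \<theta>
    using r by (simp add: power_int_minus power_mult_distrib Complex.DeMoivre cis_inverse mult.commute)
  have "((\<lambda>\<theta>. of_real (inverse (r ^ n)) * cis (- (real n * \<theta>))) has_integral F pi - F (- pi)) {- pi..pi}"
  proof (rule fundamental_theorem_of_calculus)
    fix \<theta> assume "\<theta> \<in> {- pi..pi}"
    show "(F has_vector_derivative of_real (inverse (r ^ n)) * cis (- (real n * \<theta>))) (at \<theta> within {- pi..pi})"
    proof -
      let ?G = "\<lambda>w. (\<i> / of_nat n) * of_real (inverse (r ^ n)) * exp (- (\<i> * (of_nat n * w)))"
      have "(?G has_field_derivative of_real (inverse (r ^ n)) * exp (- (\<i> * (of_nat n * of_real \<theta>)))) (at (of_real \<theta>))"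
        using False r by (auto intro!: derivative_eq_intros simp: field_simps)
      from has_vector_derivative_real_field[OF this] show ?thesis
        by (simp add: F_def[abs_def] cis_conv_exp)
    qed
  qed simp
  moreover have "F pi = F (- pi)"
  proof -
    have "cis (- (real n * pi)) = cis (real n * pi)" by (simp add: complex_eq_iff)
    then show ?thesis by (simp add: F_def)
  qed
  ultimately show ?thesis using False by (simp add: eq)
qed

lemma T_circle_bounded: "\<exists>K>0. \<forall>\<theta>\<in>{- pi..pi}. norm (T (of_real r * cis \<theta>)) \<le> K"
proof -
  have "compact ((\<lambda>\<theta>. T (of_real r * cis \<theta>)) ` {- pi..pi})"
    by (intro compact_continuous_image T_circle_continuous) auto
  then have "bounded ((\<lambda>\<theta>. T (of_real r * cis \<theta>)) ` {- pi..pi})" by (rule compact_imp_bounded)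
  then show ?thesis by (auto simp: bounded_pos)
qed

text \<open>This is \<open>T(z) x - x = T(z) R(z) x\<close>, multiplied by \<open>z\<^sup>-\<^sup>n\<close> and expanded.\<close>

lemma coeff_integrand_sums:
  "(\<lambda>k. coeff_integrand r (n - int (Suc k)) (Rc k x) \<theta>) sums
     (coeff_integrand r n x \<theta> - cscale ((of_real r * cis \<theta>) powi (- n)) x)"
proof -
  let ?z = "of_real r * cis \<theta>"
  note z = circle_ne[of \<theta>]
  have "T ?z x - T ?z (R ?z x) = x" using T_inverse(1)[OF z(1,2), of x] by (simp add: blinfun.diff_right)
  then have eq: "T ?z (R ?z x) = T ?z x - x" by (simp add: algebra_simps)
  have "(\<lambda>k. cscale (?z powi (- n)) (T ?z (cscale (?z ^ Suc k) (Rc k x)))) sums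
      cscale (?z powi (- n)) (T ?z (R ?z x))"
    by (intro bounded_linear.sums[OF blinfun.bounded_linear_right] R_sums z)
  moreover have "cscale (?z powi (- n)) (T ?z (cscale (?z ^ Suc k) y)) = coeff_integrand r (n - int (Suc k)) y \<theta>" for k y
  proof -
    have "?z powi (- n) * ?z ^ Suc k = ?z powi (- (n - int (Suc k)))"
    proof -
      have "- (n - int (Suc k)) = - n + int (Suc k)" by simp
      then show ?thesis using power_int_add[of ?z "- n" "int (Suc k)"] z(3) by (simp only: power_int_of_nat) simp
    qed
    then show ?thesis unfolding coeff_integrand_def T_cscale[OF z(1,2)] cscale_mult[symmetric] by simp
  qed
  ultimately show ?thesis by (simp add: eq blinfun.diff_right coeff_integrand_def del: of_nat_Suc power_Suc)
qed

lemma coeff_recursion: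
  "(\<lambda>k. coeff r (int n - int (Suc k)) (Rc k x)) sums
     (coeff r (int n) x - (if n = 0 then (2 * pi) *\<^sub>R x else 0))"
proof -
  let ?f = "\<lambda>k. coeff_integrand r (int n - int (Suc k)) (Rc k x)"
  obtain K where K: "K > 0" "\<And>\<theta>. \<theta> \<in> {- pi..pi} \<Longrightarrow> norm (T (of_real r * cis \<theta>)) \<le> K"
    using T_circle_bounded by blast
  define B where "B = 2 * (1 / r ^ n) * (K * (C * norm x))"
  have bound: "norm (?f k \<theta>) \<le> B * p (Suc k)" if \<theta>: "\<theta> \<in> {- pi..pi}" for k \<theta>
  proof -
    let ?z = "of_real r * cis \<theta>"
    have "norm (?z powi (- (int n - int (Suc k)))) = r powi (- (int n - int (Suc k)))"
      using r by (simp add: norm_power_int norm_mult)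
    also have "\<dots> = r ^ Suc k / r ^ n"
    proof -
      have "- (int n - int (Suc k)) = int (Suc k) - int n" by simp
      then show ?thesis using r power_int_diff[of r "int (Suc k)" "int n"] by (simp only: power_int_of_nat) simp
    qed
    also have "\<dots> \<le> 1 / r ^ n" using r by (intro divide_right_mono power_le_one) auto
    finally have 1: "norm (?z powi (- (int n - int (Suc k)))) \<le> 1 / r ^ n" .
    have "norm (Rc k x) \<le> (C * p (Suc k)) * norm x"
      by (rule order_trans[OF norm_blinfun mult_right_mono[OF order_trans[OF norm_complexify Rn_le]]]) simp
    moreover have "0 \<le> C * p (Suc k)" using C p_nonneg by simp
    ultimately have "norm (T ?z (Rc k x)) \<le> K * ((C * p (Suc k)) * norm x)"
      using K(1) by (intro order_trans[OF norm_blinfun mult_mono[OF K(2)[OF \<theta>]]]) auto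
    then have "norm (?f k \<theta>) \<le> 2 * (1 / r ^ n) * (K * ((C * p (Suc k)) * norm x))"
      unfolding coeff_integrand_def using 1 r
      by (intro order_trans[OF norm_cscale_le] mult_mono mult_left_mono) auto
    then show ?thesis by (simp add: B_def ac_simps)
  qed
  have "uniform_limit {- pi..pi} (\<lambda>N \<theta>. \<Sum>k<N. ?f k \<theta>) (\<lambda>\<theta>. \<Sum>k. ?f k \<theta>) sequentially"
    by (rule Weierstrass_m_test[OF bound summable_mult[OF p_Suc_summable]])
  also have "(\<lambda>\<theta>. \<Sum>k. ?f k \<theta>) = (\<lambda>\<theta>. coeff_integrand r n x \<theta> - cscale ((of_real r * cis \<theta>) powi (- int n)) x)"
    using coeff_integrand_sums by (intro ext sums_unique[symmetric])
  finally obtain I J where I: "\<And>N. ((\<lambda>\<theta>. \<Sum>k<N. ?f k \<theta>) has_integral I N) {- pi..pi}"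
      and J: "((\<lambda>\<theta>. coeff_integrand r n x \<theta> - cscale ((of_real r * cis \<theta>) powi (- int n)) x) has_integral J) {- pi..pi}"
      and IJ: "I \<longlonglongrightarrow> J"
    by (rule uniform_limit_integral) (auto intro!: continuous_on_sum coeff_integrand_continuous)
  have "((\<lambda>\<theta>. \<Sum>k<N. ?f k \<theta>) has_integral (\<Sum>k<N. coeff r (int n - int (Suc k)) (Rc k x))) {- pi..pi}" for N
    by (intro has_integral_sum coeff_has_integral) auto
  from has_integral_unique[OF I this]
  have IN: "I N = (\<Sum>k<N. coeff r (int n - int (Suc k)) (Rc k x))" for N .
  have "bounded_linear (\<lambda>c. cscale c x)"
    by (rule bounded_linear_compose[OF blinfun.bounded_linear_left bounded_linear_cscale])
  from has_integral_linear[OF integral_character this, of n]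
  have "((\<lambda>\<theta>. cscale ((of_real r * cis \<theta>) powi (- int n)) x) has_integral (if n = 0 then (2 * pi) *\<^sub>R x else 0)) {- pi..pi}"
    by (cases "n = 0") (simp_all add: o_def cscale_of_real[symmetric] linear_0[OF bounded_linear.linear[OF bounded_linear_cscale]])
  from has_integral_unique[OF J has_integral_diff[OF coeff_has_integral this]] IJ
  show ?thesis unfolding sums_def IN by simp
qed

text \<open>The recursion for the coefficients runs over all \<open>k \<ge> 1\<close>, but the terms with \<open>k > n\<close> have negative
index and vanish. What remains is the renewal recursion.\<close>

theorem renewal_eq_coeff: "coeff r (int n) x = (2 * pi) *\<^sub>R complexify (renewal Rn n) x"
proof (induction n arbitrary: x rule: less_induct)
  case (less n)
  let ?g = "\<lambda>k. coeff r (int n - int (Suc k)) (Rc k x)"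
  have "?g k = 0" if "k \<notin> {..<n}" for k using that by (intro coeff_negative) auto
  then have "?g sums (\<Sum>k<n. ?g k)" by (intro sums_finite) auto
  from sums_unique2[OF coeff_recursion this]
  have eq: "coeff r (int n) x = (if n = 0 then (2 * pi) *\<^sub>R x else 0) + (\<Sum>k<n. ?g k)" by (simp add: algebra_simps)
  show ?case
  proof (cases "n = 0")
    case True
    then show ?thesis using eq by (simp add: renewal.simps complexify_apply)
  next
    case False
    have "?g k = (2 * pi) *\<^sub>R complexify (renewal Rn (n - Suc k) o\<^sub>L Rn (Suc k)) x" if "k < n" for k
    proof -
      have "int n - int (Suc k) = int (n - Suc k)" using that by simp
      then show ?thesis using less.IH[of "n - Suc k" "Rc k x"] that by (simp add: complexify_apply)
    qed
    then have "(\<Sum>k<n. ?g k) = (\<Sum>k<n. (2 * pi) *\<^sub>R complexify (renewal Rn (n - Suc k) o\<^sub>L Rn (Suc k)) x)"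
      by (intro sum.cong) auto
    then show ?thesis using eq False by (subst renewal.simps) (simp add: complexify_sum scaleR_sum_right)
  qed
qed

end

end

section \<open>The resolvent near the singularity\<close>

context operator_renewal
begin

lemma cpr_e: "cpr e (e, 0) = 1"
  by (simp add: cpr_def pr_e pr.zero_left complex_eq_iff)

lemma R_1_e: "R 1 (e, 0) = (e, 0)"
proof -
  have "bounded_linear (\<lambda>x :: 'b. (x, 0 :: 'b))" by (intro bounded_linear_Pair bounded_linear_ident bounded_linear_zero)
  from bounded_linear.sums[OF this R_e] have "(\<lambda>k. (Rn (Suc k) e, 0 :: 'b)) sums (e, 0)" .
  moreover have "(\<lambda>k. (Rn (Suc k) e, 0 :: 'b)) sums R 1 (e, 0)"
    using R_sums[of 1 "(e, 0)"] by (simp add: complexify_apply)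
  ultimately show ?thesis using sums_unique2 by blast
qed

lemma cpr_R_1: "cpr e (R 1 x) = cpr e x"
proof -
  have "(\<lambda>k. cpr e (Rc k x)) sums cpr e (R 1 x)"
    using bounded_linear.sums[OF bounded_linear_cpr R_sums[of 1 x]] by simp
  moreover have "(\<lambda>k. cpr e (Rc k x)) sums cpr e x"
    using pr_R[of "fst x"] pr_R[of "snd x"] by (simp add: sums_complex_iff cpr_def complexify_apply)
  ultimately show ?thesis using sums_unique2 by blast
qed

text \<open>On the constant function \<open>1 - R(z)\<close> integrates to \<open>1 - \<integral> z\<^sup>\<phi>\<close>.\<close>

lemma Re_generating_function:
  assumes "0 \<le> r" "r \<le> 1"
  shows "Re (cpr e ((e, 0) - R (of_real r * cis \<theta>) (e, 0))) = (\<Sum>k. p k * (1 - r ^ k * cos (real k * \<theta>)))"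
proof -
  let ?z = "of_real r * cis \<theta>"
  have "norm ?z \<le> 1" using assms by (simp add: norm_mult)
  from bounded_linear.sums[OF bounded_linear_cpr R_sums[OF this]]
  have "(\<lambda>k. cpr e (cscale (?z ^ Suc k) (Rc k (e, 0)))) sums cpr e (R ?z (e, 0))" .
  moreover have "cpr e (Rc k (e, 0)) = of_real (p (Suc k))" for k
    by (simp add: cpr_def complexify_apply pr_Rn_e pr.zero_left complex_eq_iff)
  ultimately have "(\<lambda>k. ?z ^ Suc k * of_real (p (Suc k))) sums cpr e (R ?z (e, 0))"
    by (simp only: cpr_cscale)
  then have "(\<lambda>k. Re (?z ^ Suc k * of_real (p (Suc k)))) sums Re (cpr e (R ?z (e, 0)))"
    by (rule sums_Re)
  moreover have "Re (?z ^ k * of_real (p k)) = p k * (r ^ k * cos (real k * \<theta>))" for k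
    by (simp add: power_mult_distrib Complex.DeMoivre Re_divide del: of_real_power add: of_real_power[symmetric])
  ultimately have 1: "(\<lambda>k. p (Suc k) * (r ^ Suc k * cos (real (Suc k) * \<theta>))) sums Re (cpr e (R ?z (e, 0)))"
    by (simp only:)
  have "(\<lambda>k. p (Suc k)) sums 1" using p_sums by (simp add: sums_Suc_iff)
  from sums_diff[OF this 1]
  have "(\<lambda>k. p (Suc k) * (1 - r ^ Suc k * cos (real (Suc k) * \<theta>))) sums (1 - Re (cpr e (R ?z (e, 0))))"
    by (simp only: right_diff_distrib mult_1_right)
  then have S: "(\<lambda>k. p k * (1 - r ^ k * cos (real k * \<theta>))) sums (1 - Re (cpr e (R ?z (e, 0))))"
    by (subst (asm) sums_Suc_iff) simp
  have "Re (cpr e ((e, 0) - R ?z (e, 0))) = 1 - Re (cpr e (R ?z (e, 0)))"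
    by (simp add: linear_diff[OF bounded_linear.linear[OF bounded_linear_cpr]] cpr_e)
  then show ?thesis using sums_unique[OF S] by (rule trans)
qed

lemma cscale_0: "cscale 0 x = 0"
  by (simp add: cscale_apply zero_prod_def)

lemma cscale_inverse: "a \<noteq> 0 \<Longrightarrow> cscale (inverse a) (cscale a x) = x"
  by (simp add: cscale_mult[symmetric])

lemma cpr_add: "cpr v (x + y) = cpr v x + cpr v y" and cpr_diff: "cpr v (x - y) = cpr v x - cpr v y"
  using bounded_linear.linear[OF bounded_linear_cpr] by (auto simp: linear_add linear_diff)

text \<open>Simplicity of the eigenvalue \<open>1\<close> says that \<open>1 - R(1)\<close> plus the projection onto the constants along
the functions of mean zero is bijective; the bounded inverse theorem turns this into an estimate.\<close>

lemma spectral_gap: "\<exists>K>0. \<forall>x. norm (x - cscale (cpr e x) (e, 0)) \<le> K * norm (x - R 1 x)"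
proof -
  let ?E = "(e, 0 :: 'b)"
  have "e \<noteq> 0" using pr_e pr.zero_left by auto
  then have E: "?E \<noteq> 0" by (simp add: prod_eq_iff)
  obtain u where u: "{x. x - R 1 x = 0} = range (\<lambda>a. cscale a u)"
      "\<And>x. \<exists>a y. x = cscale a u + (y - R 1 y)"
    using H2 unfolding H2_def simple_eigenvalue_def by (auto simp: blinfun.diff_left)
  have "?E \<in> {x. x - R 1 x = 0}" by (simp add: R_1_e)
  then obtain a0 where a0: "?E = cscale a0 u" unfolding u(1) by blast
  have "a0 \<noteq> 0"
  proof
    assume "a0 = 0"
    then have "?E = cscale 0 u" using a0 by simp
    then have "?E = 0" by (simp add: cscale_apply zero_prod_def)
    then show False using E by simp
  qed
  then have u_eq: "u = cscale (inverse a0) ?E" unfolding a0 by (rule cscale_inverse[symmetric])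
  have ker: "\<exists>b. x = cscale b ?E" if "x - R 1 x = 0" for x
  proof -
    from that obtain a where "x = cscale a u" using u(1) by blast
    then show ?thesis unfolding u_eq cscale_mult[symmetric] by blast
  qed
  have dec: "\<exists>b y. x = cscale b ?E + (y - R 1 y)" for x
  proof -
    obtain a y where "x = cscale a u + (y - R 1 y)" using u(2) by blast
    then show ?thesis unfolding u_eq cscale_mult[symmetric] by blast
  qed
  have bl: "bounded_linear (\<lambda>x. x - R 1 x + cscale (cpr e x) ?E)"
    by (intro bounded_linear_add bounded_linear_sub bounded_linear_ident blinfun.bounded_linear_right
        bounded_linear_compose[OF blinfun.bounded_linear_left]
        bounded_linear_compose[OF bounded_linear_cscale bounded_linear_cpr])
  define G where "G = Blinfun (\<lambda>x. x - R 1 x + cscale (cpr e x) ?E)"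
  have G: "G x = x - R 1 x + cscale (cpr e x) ?E" for x
    unfolding G_def bounded_linear_Blinfun_apply[OF bl] ..
  have cG: "cpr e (G x) = cpr e x" for x
    by (simp add: G cpr_add cpr_diff cpr_R_1 cpr_cscale cpr_e)
  have "inj (blinfun_apply G)"
  proof (rule linear_injective_0[THEN iffD2])
    show "linear (blinfun_apply G)" by (rule bounded_linear.linear[OF blinfun.bounded_linear_right])
    show "\<forall>x. G x = 0 \<longrightarrow> x = 0"
    proof (intro allI impI)
      fix x assume x: "G x = 0"
      then have c0: "cpr e x = 0" using cG[of x] linear_0[OF bounded_linear.linear[OF bounded_linear_cpr]] by simp
      then have "x - R 1 x = 0" using x G[of x] by (simp add: cscale_0)
      then obtain b where b: "x = cscale b ?E" using ker by blast
      then have "b = 0" using c0 by (simp add: cpr_cscale cpr_e)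
      then show "x = 0" using b by (simp add: cscale_0)
    qed
  qed
  moreover have "surj (blinfun_apply G)"
  proof -
    have "\<exists>w. x = G w" for x
    proof -
      obtain b y where x: "x = cscale b ?E + (y - R 1 y)" using dec by blast
      \<comment> \<open>same image under \<open>1 - R(1)\<close> as \<open>y\<close>, but with constant part \<open>b\<close>\<close>
      define w where "w = y + cscale (b - cpr e y) ?E"
      have "cpr e w = b" by (simp add: w_def cpr_add cpr_cscale cpr_e)
      moreover have "w - R 1 w = y - R 1 y" by (simp add: w_def blinfun.add_right R_cscale R_1_e)
      ultimately have "G w = x" by (simp add: G x)
      then show ?thesis by blast
    qed
    then show ?thesis by (simp add: surj_def)
  qed
  ultimately obtain K where K: "K > 0" "\<And>x. norm x \<le> K * norm (G x)"
    using bij_blinfun_bounded_below[of G] by (auto simp: bij_def)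
  have "norm (x - cscale (cpr e x) ?E) \<le> K * norm (x - R 1 x)" for x
  proof -
    let ?w = "x - cscale (cpr e x) ?E"
    have "cpr e ?w = 0" by (simp add: cpr_diff cpr_cscale cpr_e)
    then have "G ?w = x - R 1 x"
      by (simp add: G blinfun.diff_right R_cscale R_1_e cscale_0 cpr_cscale cpr_e)
    then show ?thesis using K(2)[of ?w] by simp
  qed
  then show ?thesis using K(1) by blast
qed

lemma dist_1_polar: "norm (of_real r * cis \<theta> - 1) \<le> \<bar>1 - r\<bar> + \<bar>\<theta>\<bar>"
proof -
  have "of_real r * cis \<theta> - 1 = (of_real r - 1) * cis \<theta> + (cis \<theta> - 1)" by (simp add: algebra_simps)
  then have "norm (of_real r * cis \<theta> - 1) \<le> norm ((of_real r - 1) * cis \<theta>) + norm (cis \<theta> - 1)"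
    by (simp only: norm_triangle_ineq)
  also have "norm ((of_real r - 1) * cis \<theta> :: complex) = \<bar>1 - r\<bar>"
  proof -
    have "norm (complex_of_real (r - 1)) = \<bar>1 - r\<bar>" unfolding norm_of_real by (rule abs_minus_commute)
    then show ?thesis by (simp add: norm_mult)
  qed
  also have "norm (cis \<theta> - 1) \<le> \<bar>\<theta>\<bar>"
  proof -
    have "norm (exp (\<i> * of_real \<theta>) - 1) = 2 * \<bar>sin (\<theta> / 2)\<bar>"
      by (rule dist_exp_i_1)
    also have "\<dots> \<le> \<bar>\<theta>\<bar>" using abs_sin_x_le_abs_x[of "\<theta> / 2"] by simp
    finally show ?thesis by (simp add: cis_conv_exp)
  qed
  finally show ?thesis by simp
qed

text \<open>Let \<open>\<Delta> = R(z) - R(1)\<close>, so that \<open>(1 - R(1)) x = y + \<Delta> x\<close>. The spectral gap controls the part of \<open>x\<close> off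
the constants by \<open>y\<close> and by \<open>d\<close> times the norm of \<open>x\<close>. Integrating the equation kills \<open>1 - R(1)\<close> and
leaves \<open>\<integral> y = - \<integral> \<Delta> x\<close>, in which the constant part of \<open>x\<close> is multiplied by the scalar that \<open>c\<close>
bounds from below; the rest is of second order in \<open>d\<close> and is absorbed.\<close>

lemma a_priori:
  assumes K: "\<And>x. norm (x - cscale (cpr e x) (e, 0)) \<le> K * norm (x - R 1 x)" "K > 0"
    and M: "\<And>x. norm (cpr e x) \<le> M * norm x" "M > 0"
    and d: "norm (R z - R 1) \<le> d" "K * d \<le> 1/2"
    and c: "c \<le> norm (cpr e ((e, 0) - R z (e, 0)))" "8 * M * K * norm e * d * d \<le> c"
    and y: "y = x - R z x" and z: "norm z \<le> 1"
  shows "norm x \<le> 2 * K * norm y + 4 * norm e * norm (cpr e x)"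
    "norm (cpr e x) * c \<le> 2 * norm (cpr e y) + 4 * M * K * d * norm y"
proof -
  let ?E = "(e, 0 :: 'b)"
  let ?D = "R z - R 1"
  let ?a = "norm (cpr e x)"
  define w where "w = x - cscale (cpr e x) ?E"
  have nE: "norm ?E = norm e" by (simp add: norm_Pair)
  have d0: "0 \<le> d" using d(1) norm_ge_zero order_trans by blast
  have xw: "norm x \<le> norm w + 2 * ?a * norm e"
    using norm_triangle_ineq[of w "cscale (cpr e x) ?E"] norm_cscale_le[of "cpr e x" ?E] nE by (simp add: w_def)
  have "x - R 1 x = y + ?D x" by (simp add: y blinfun.diff_left)
  then have "norm w \<le> K * norm (y + ?D x)" using K(1)[of x] by (simp add: w_def)
  also have "\<dots> \<le> K * (norm y + d * norm x)"
    using K(2) norm_triangle_ineq[of y "?D x"] order_trans[OF norm_blinfun mult_right_mono[OF d(1)], of x]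
    by (intro mult_left_mono) auto
  also have "\<dots> \<le> K * norm y + (K * d) * (norm w + 2 * ?a * norm e)"
    using mult_left_mono[OF xw, of "K * d"] K(2) d0 by (simp add: distrib_left mult.assoc)
  also have "\<dots> = K * norm y + (K * d) * norm w + 2 * (K * d) * (?a * norm e)" by (simp add: algebra_simps)
  finally have w1: "norm w \<le> K * norm y + (K * d) * norm w + 2 * (K * d) * (?a * norm e)" .
  have "(K * d) * norm w \<le> 1/2 * norm w" using d(2) by (intro mult_right_mono) auto
  with w1 have w2: "norm w \<le> 2 * K * norm y + 4 * (K * d) * (?a * norm e)" by linarith
  have "(K * d) * (?a * norm e) \<le> 1/2 * (?a * norm e)" using d(2) by (intro mult_right_mono) auto
  with w2 have "norm w \<le> 2 * K * norm y + 2 * (?a * norm e)" by linarith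
  with xw show "norm x \<le> 2 * K * norm y + 4 * norm e * ?a" by (simp add: algebra_simps)
  have "cpr e y = - cpr e (?D x)"
    by (simp add: y cpr_diff blinfun.diff_left cpr_R_1)
  also have "?D x = cscale (cpr e x) (?D ?E) + ?D w"
  proof -
    have "x = cscale (cpr e x) ?E + w" by (simp add: w_def)
    from arg_cong[OF this, of "blinfun_apply ?D"]
    have "?D x = ?D (cscale (cpr e x) ?E) + ?D w" by (simp only: blinfun.add_right)
    then show ?thesis using z by (simp add: blinfun.diff_left R_cscale blinfun.diff_right)
  qed
  also have "- cpr e (cscale (cpr e x) (?D ?E) + ?D w) = cpr e x * cpr e (?E - R z ?E) - cpr e (?D w)"
    by (simp add: cpr_add cpr_cscale blinfun.diff_left R_1_e cpr_diff algebra_simps)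
  finally have "cpr e x * cpr e (?E - R z ?E) = cpr e y + cpr e (?D w)" by (simp add: algebra_simps)
  then have "?a * norm (cpr e (?E - R z ?E)) \<le> norm (cpr e y) + norm (cpr e (?D w))"
    using norm_triangle_ineq by (metis norm_mult)
  moreover have "?a * c \<le> ?a * norm (cpr e (?E - R z ?E))" using c(1) by (intro mult_left_mono) auto
  moreover have "norm (cpr e (?D w)) \<le> M * (d * norm w)"
    using M order_trans[OF M(1) mult_left_mono[OF order_trans[OF norm_blinfun mult_right_mono[OF d(1)]]]] by simp
  moreover have "M * (d * norm w) \<le> M * (d * (2 * K * norm y + 4 * (K * d) * (?a * norm e)))"
    using w2 d0 M by (intro mult_left_mono) auto
  moreover have "M * (d * (2 * K * norm y + 4 * (K * d) * (?a * norm e))) =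
      2 * M * K * d * norm y + (8 * M * K * norm e * d * d) * (?a / 2)" by (simp add: algebra_simps)
  moreover have "(8 * M * K * norm e * d * d) * (?a / 2) \<le> c * (?a / 2)" using c(2) by (intro mult_right_mono) auto
  ultimately have "?a * c \<le> norm (cpr e y) + 2 * M * K * d * norm y + ?a * c / 2"
    by (simp add: mult.commute)
  then show "?a * c \<le> 2 * norm (cpr e y) + 4 * M * K * d * norm y" by simp
qed

text \<open>Near \<open>1\<close> both the perturbation \<open>d\<close> and the scalar \<open>c\<close> of the a priori estimate are of order \<open>\<tau>\<^sub>j\<close>.
The term of order \<open>d\<^sup>2\<close> is then small against \<open>c\<close>, and dividing by \<open>c\<close> costs a factor \<open>1/\<tau>\<^sub>j\<close>, unless
\<open>\<integral> y = 0\<close>: then the right-hand side carries a factor \<open>d\<close> which cancels it.\<close>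

theorem resolvent_bound_near_1:
  "\<exists>B>0. \<exists>j0. \<forall>j\<ge>j0. \<forall>r \<theta> y. 0 \<le> r \<longrightarrow> r \<le> 1 \<longrightarrow>
     (1/2) ^ Suc j \<le> max (1 - r) \<bar>\<theta>\<bar> \<longrightarrow> max (1 - r) \<bar>\<theta>\<bar> \<le> (1/2) ^ j \<longrightarrow> of_real r * cis \<theta> \<noteq> 1 \<longrightarrow>
     norm (T (of_real r * cis \<theta>) y) \<le> B / \<tau> j * norm y \<and>
     (cpr e y = 0 \<longrightarrow> norm (T (of_real r * cis \<theta>) y) \<le> B * norm y)"
proof -
  obtain K where K: "K > 0" "\<And>x. norm (x - cscale (cpr e x) (e, 0)) \<le> K * norm (x - R 1 x)"
    using spectral_gap by blast
  obtain M where M: "M > 0" "\<And>x. norm (cpr e x) \<le> M * norm x"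
    using bounded_linear.pos_bounded[OF bounded_linear_cpr[of e]] by (auto simp: mult.commute)
  obtain A where A: "A > 0"
    "\<And>j z w. norm z \<le> 1 \<Longrightarrow> norm w \<le> 1 \<Longrightarrow> norm (z - w) \<le> 4 * (1/2) ^ j \<Longrightarrow> norm (R z - R w) \<le> A * \<tau> j"
    using R_modulus by blast
  obtain c where c: "c > 0" and ev: "\<forall>\<^sub>F j in sequentially. \<forall>r \<theta>. 0 \<le> r \<longrightarrow> r \<le> 1 \<longrightarrow>
     (1/2) ^ Suc j \<le> max (1 - r) \<bar>\<theta>\<bar> \<longrightarrow> max (1 - r) \<bar>\<theta>\<bar> \<le> (1/2) ^ j \<longrightarrow>
     c * \<tau> j \<le> (\<Sum>k. p k * (1 - r ^ k * cos (real k * \<theta>)))"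
    using generating_function_lower_bound by blast
  have l1: "(\<lambda>j. K * (A * \<tau> j)) \<longlonglongrightarrow> 0" and l2: "(\<lambda>j. 8 * M * K * norm e * A * A * \<tau> j) \<longlonglongrightarrow> 0"
    by (intro tendsto_mult_right_zero \<tau>_lim)+
  have "\<forall>\<^sub>F j in sequentially. K * (A * \<tau> j) < 1/2" by (rule order_tendstoD(2)[OF l1]) simp
  moreover have "\<forall>\<^sub>F j in sequentially. 8 * M * K * norm e * A * A * \<tau> j < c" by (rule order_tendstoD(2)[OF l2 c])
  ultimately have "\<forall>\<^sub>F j in sequentially. (K * (A * \<tau> j) < 1/2 \<and> 8 * M * K * norm e * A * A * \<tau> j < c) \<and> 
    (\<forall>r \<theta>. 0 \<le> r \<longrightarrow> r \<le> 1 \<longrightarrow>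
     (1/2) ^ Suc j \<le> max (1 - r) \<bar>\<theta>\<bar> \<longrightarrow> max (1 - r) \<bar>\<theta>\<bar> \<le> (1/2) ^ j \<longrightarrow>
     c * \<tau> j \<le> (\<Sum>k. p k * (1 - r ^ k * cos (real k * \<theta>))))"
    using ev by (intro eventually_conj)
  then obtain j0 where j0: "\<And>j. j \<ge> j0 \<Longrightarrow> K * (A * \<tau> j) < 1/2" 
     "\<And>j. j \<ge> j0 \<Longrightarrow> 8 * M * K * norm e * A * A * \<tau> j < c"
     "\<And>j r \<theta>. j \<ge> j0 \<Longrightarrow> 0 \<le> r \<Longrightarrow> r \<le> 1 \<Longrightarrow>
     (1/2) ^ Suc j \<le> max (1 - r) \<bar>\<theta>\<bar> \<Longrightarrow> max (1 - r) \<bar>\<theta>\<bar> \<le> (1/2) ^ j \<Longrightarrow>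
     c * \<tau> j \<le> (\<Sum>k. p k * (1 - r ^ k * cos (real k * \<theta>)))"
    unfolding eventually_sequentially by blast
  define B1 where "B1 = 2 * K + 4 * norm e * (4 * M * K * A / c)"
  define B2 where "B2 = 8 * norm e * M / c"
  have B: "B1 > 0" "B2 \<ge> 0" using K M A c by (auto simp: B1_def B2_def intro!: add_pos_nonneg)
  have main: "norm (T z y) \<le> (B1 + B2) / \<tau> j * norm y \<and> (cpr e y = 0 \<longrightarrow> norm (T z y) \<le> (B1 + B2) * norm y)"
    if j: "j \<ge> j0" and r: "0 \<le> r" "r \<le> 1" and lo: "(1/2) ^ Suc j \<le> max (1 - r) \<bar>\<theta>\<bar>"
      and hi: "max (1 - r) \<bar>\<theta>\<bar> \<le> (1/2) ^ j" and z: "z = of_real r * cis \<theta>" and z1: "z \<noteq> 1" for j r \<theta> y z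
  proof -
    let ?x = "T z y"
    have nz: "norm z \<le> 1" using r by (simp add: z norm_mult)
    have "norm (z - 1) \<le> (1 - r) + \<bar>\<theta>\<bar>" using dist_1_polar[of r \<theta>] r by (simp add: z)
    also have "\<dots> \<le> 2 * (1/2) ^ j" using hi by linarith
    finally have "norm (z - 1) \<le> 4 * (1/2) ^ j" using zero_le_power[of "1/2 :: real" j] by linarith
    then have d: "norm (R z - R 1) \<le> A * \<tau> j" using nz by (intro A(2)) auto
    have c1: "c * \<tau> j \<le> norm (cpr e ((e, 0) - R z (e, 0)))"
      using j0(3)[OF j r lo hi] Re_generating_function[OF r, of \<theta>] complex_Re_le_cmod order_trans
      unfolding z by metis
    have c2: "8 * M * K * norm e * (A * \<tau> j) * (A * \<tau> j) \<le> c * \<tau> j"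
      using mult_right_mono[OF less_imp_le[OF j0(2)[OF j]] less_imp_le[OF \<tau>_pos[of j]]] by (simp add: ac_simps)
    have y: "y = ?x - R z ?x" using T_inverse(2)[OF nz z1] by simp
    note ap = a_priori[OF K(2,1) M(2,1) d less_imp_le[OF j0(1)[OF j]] c1 c2 y nz]
    have a: "norm (cpr e ?x) \<le> 2 * norm (cpr e y) / (c * \<tau> j) + (4 * M * K * A / c) * norm y"
      using ap(2) c \<tau>_pos[of j] by (simp add: field_simps)
    have "norm ?x \<le> 2 * K * norm y + 4 * norm e * (2 * norm (cpr e y) / (c * \<tau> j) + (4 * M * K * A / c) * norm y)"
      using ap(1) mult_left_mono[OF a, of "4 * norm e"] by simp
    also have "\<dots> = B1 * norm y + 8 * norm e * norm (cpr e y) / (c * \<tau> j)"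
      by (simp add: B1_def algebra_simps)
    finally have x: "norm ?x \<le> B1 * norm y + 8 * norm e * norm (cpr e y) / (c * \<tau> j)" .
    have t1: "\<tau> j \<le> 1" using decseqD[OF t_dec, of 0 "2 ^ j"] by (simp add: \<tau>_def t_0)
    have "8 * norm e * norm (cpr e y) / (c * \<tau> j) \<le> 8 * norm e * (M * norm y) / (c * \<tau> j)"
      using M(2)[of y] c \<tau>_pos[of j] by (intro divide_right_mono mult_left_mono) auto
    also have "\<dots> = B2 / \<tau> j * norm y" using c by (simp add: B2_def field_simps)
    finally have 2: "8 * norm e * norm (cpr e y) / (c * \<tau> j) \<le> B2 / \<tau> j * norm y" .
    have "B1 \<le> B1 / \<tau> j" using t1 B \<tau>_pos[of j] by (simp add: pos_le_divide_eq)
    then have "B1 * norm y \<le> B1 / \<tau> j * norm y" by (rule mult_right_mono) simp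
    with x 2 have "norm ?x \<le> (B1 + B2) / \<tau> j * norm y" by (simp add: add_divide_distrib distrib_right)
    moreover have "norm ?x \<le> (B1 + B2) * norm y" if "cpr e y = 0"
      using x that B by (simp add: distrib_right add_increasing2)
    ultimately show ?thesis by blast
  qed
  show ?thesis
    by (rule exI[of _ "B1 + B2"], rule conjI, use B in simp, rule exI[of _ j0]) (use main in blast)
qed

text \<open>The bound \<open>N j\<close> holds at all points at distance at least about \<open>2\<^sup>-\<^sup>j\<^sup>-\<^sup>1\<close> from \<open>1\<close>, measured by
\<open>max (1 - r) \<bar>\<theta>\<bar>\<close>. Angles up to \<open>5\<close> are admitted so that \<open>[-4, 4]\<close>, which contains a full
period, can be shifted by up to \<open>1\<close>; as \<open>5 < 2 \<pi>\<close>, the point \<open>1\<close> is met at \<open>\<theta> = 0\<close> only.\<close>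

definition resolvent_bounded :: "'b \<times> 'b \<Rightarrow> (nat \<Rightarrow> real) \<Rightarrow> bool" where
  "resolvent_bounded x N \<longleftrightarrow> (\<forall>j r \<theta>. 0 < r \<longrightarrow> r < 1 \<longrightarrow> \<bar>\<theta>\<bar> \<le> 5 \<longrightarrow>
     (1/2) ^ Suc j \<le> max (1 - r) \<bar>\<theta>\<bar> \<longrightarrow> norm (T (of_real r * cis \<theta>) x) \<le> N j)"

text \<open>Away from \<open>1\<close> the resolvent is bounded by compactness.\<close>

theorem resolvent_bound:
  "\<exists>B>0. \<forall>y. resolvent_bounded y (\<lambda>j. B / \<tau> j * norm y) \<and>
     (cpr e y = 0 \<longrightarrow> resolvent_bounded y (\<lambda>_. B * norm y))"
proof -
  obtain B1 j0 where B1: "B1 > 0" "\<And>j r \<theta> y. j \<ge> j0 \<Longrightarrow> 0 \<le> r \<Longrightarrow> r \<le> 1 \<Longrightarrow>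
     (1/2) ^ Suc j \<le> max (1 - r) \<bar>\<theta>\<bar> \<Longrightarrow> max (1 - r) \<bar>\<theta>\<bar> \<le> (1/2) ^ j \<Longrightarrow> of_real r * cis \<theta> \<noteq> 1 \<Longrightarrow>
     norm (T (of_real r * cis \<theta>) y) \<le> B1 / \<tau> j * norm y \<and>
     (cpr e y = 0 \<longrightarrow> norm (T (of_real r * cis \<theta>) y) \<le> B1 * norm y)"
    using resolvent_bound_near_1 by blast
  define S where "S = {x :: real \<times> real. 0 \<le> fst x \<and> fst x \<le> 1 \<and> \<bar>snd x\<bar> \<le> 5 \<and> (1/2) ^ j0 \<le> max (1 - fst x) \<bar>snd x\<bar>}"
  have ne1: "of_real r * cis \<theta> \<noteq> (1 :: complex)" if "0 \<le> r" "\<bar>\<theta>\<bar> \<le> 5" "0 < max (1 - r) \<bar>\<theta>\<bar>" for r \<theta> :: real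
  proof
    assume eq: "of_real r * cis \<theta> = (1 :: complex)"
    then have "norm (of_real r * cis \<theta>) = 1" by simp
    then have r1: "r = 1" using that by (simp add: norm_mult)
    then have "cos \<theta> = 1" using eq by (simp add: complex_eq_iff)
    then obtain n :: int where n: "\<theta> = of_int n * 2 * pi" using cos_one_2pi_int by blast
    have "n = 0"
    proof (rule ccontr)
      assume "n \<noteq> 0"
      then have "1 \<le> \<bar>real_of_int n\<bar>" by linarith
      then have "1 * 6 \<le> \<bar>real_of_int n\<bar> * (2 * pi)" using pi_gt3 by (intro mult_mono) auto
      also have "\<dots> = \<bar>\<theta>\<bar>" unfolding n by (simp add: abs_mult)
      finally show False using that by simp
    qed
    then show False using n r1 that by simp
  qed
  have "compact S"
  proof (rule compact_Int_closed[of "{0..1} \<times> {-5..5}" "{x. (1/2) ^ j0 \<le> max (1 - fst x) \<bar>snd x\<bar>}", THEN back_subst[of compact]])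
    show "compact ({0..1::real} \<times> {-5..5::real})" by (intro compact_Times compact_Icc)
    show "closed {x :: real \<times> real. (1/2) ^ j0 \<le> max (1 - fst x) \<bar>snd x\<bar>}"
      by (intro closed_Collect_le continuous_intros)
  qed (auto simp: S_def abs_le_iff)
  moreover have "continuous_on S (\<lambda>x. T (of_real (fst x) * cis (snd x)))"
  proof (rule continuous_on_compose2[OF T_continuous])
    show "(\<lambda>x. of_real (fst x) * cis (snd x)) ` S \<subseteq> cball 0 1 - {1}"
    proof (rule image_subsetI)
      fix x assume x: "x \<in> S"
      then have "(1/2) ^ j0 \<le> max (1 - fst x) \<bar>snd x\<bar>" by (simp only: S_def mem_Collect_eq)
      then have "0 < max (1 - fst x) \<bar>snd x\<bar>" by (rule less_le_trans[rotated]) simp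
      then have "of_real (fst x) * cis (snd x) \<noteq> (1 :: complex)" using x by (intro ne1) (simp_all only: S_def mem_Collect_eq)
      then show "of_real (fst x) * cis (snd x) \<in> cball 0 1 - {1}" using x by (simp add: S_def norm_mult)
    qed
  qed (intro continuous_intros)
  ultimately have "bounded ((\<lambda>x. T (of_real (fst x) * cis (snd x))) ` S)"
    using compact_continuous_image compact_imp_bounded by blast
  then obtain B2 where B2: "B2 > 0" "\<And>x. x \<in> S \<Longrightarrow> norm (T (of_real (fst x) * cis (snd x))) \<le> B2"
    by (auto simp: bounded_pos)
  have main: "norm (T z y) \<le> (B1 + B2) / \<tau> j * norm y \<and> (cpr e y = 0 \<longrightarrow> norm (T z y) \<le> (B1 + B2) * norm y)"
    if r: "0 \<le> r" "r \<le> 1" and \<theta>: "\<bar>\<theta>\<bar> \<le> 5" and lo: "(1/2) ^ Suc j \<le> max (1 - r) \<bar>\<theta>\<bar>"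
      and z: "z = of_real r * cis \<theta>" for j r \<theta> y z
  proof -
    let ?\<omega> = "max (1 - r) \<bar>\<theta>\<bar>"
    have pos: "0 < ?\<omega>" using less_le_trans[OF _ lo] by simp
    have "\<exists>i. \<tau> j \<le> \<tau> i \<and> norm (T z y) \<le> (B1 + B2) / \<tau> i * norm y \<and> (cpr e y = 0 \<longrightarrow> norm (T z y) \<le> (B1 + B2) * norm y)"
    proof (cases "(1/2) ^ j0 \<le> ?\<omega>")
      case True
      then have "(r, \<theta>) \<in> S" using r \<theta> by (simp add: S_def)
      from B2(2)[OF this] have "norm (T z) \<le> B1 + B2" using B1(1) z by simp
      then have "norm (T z y) \<le> (B1 + B2) * norm y"
        by (rule order_trans[OF norm_blinfun mult_right_mono]) simp
      moreover have "(B1 + B2) * norm y \<le> (B1 + B2) / \<tau> j * norm y"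
      proof (rule mult_right_mono)
        have "\<tau> j \<le> 1" using decseqD[OF t_dec, of 0 "2 ^ j"] by (simp add: \<tau>_def t_0)
        then show "B1 + B2 \<le> (B1 + B2) / \<tau> j" using B1(1) B2(1) \<tau>_pos[of j] by (simp add: pos_le_divide_eq)
      qed simp
      ultimately show ?thesis by (intro exI[of _ j]) auto
    next
      case False
      \<comment> \<open>the dyadic scale of the point itself, which may be coarser than \<open>j\<close>\<close>
      define i where "i = (LEAST i. (1/2) ^ Suc i \<le> ?\<omega>)"
      have i1: "(1/2) ^ Suc i \<le> ?\<omega>" unfolding i_def using lo by (rule LeastI)
      have ij: "i \<le> j" unfolding i_def using lo by (rule Least_le)
      have i0: "j0 \<le> i"
      proof (rule ccontr)
        assume "\<not> j0 \<le> i"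
        then have "(1/2 :: real) ^ j0 \<le> (1/2) ^ Suc i" by (intro power_decreasing) auto
        then show False using i1 False by linarith
      qed
      have i2: "?\<omega> \<le> (1/2) ^ i"
      proof (cases i)
        case 0
        then have "j0 = 0" using i0 by simp
        then show ?thesis using False unfolding 0 by (simp only: power_0)
      next
        case (Suc k)
        then have "\<not> (1/2) ^ Suc k \<le> ?\<omega>" using not_less_Least[of k "\<lambda>i. (1/2) ^ Suc i \<le> ?\<omega>"] unfolding i_def by simp
        then show ?thesis using Suc by simp
      qed
      have "z \<noteq> 1" unfolding z by (rule ne1[OF r(1) \<theta> pos])
      then have *: "norm (T z y) \<le> B1 / \<tau> i * norm y \<and> (cpr e y = 0 \<longrightarrow> norm (T z y) \<le> B1 * norm y)"
        using B1(2)[OF i0 r i1 i2, of y] unfolding z by blast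
      have "B1 / \<tau> i * norm y \<le> (B1 + B2) / \<tau> i * norm y" "B1 * norm y \<le> (B1 + B2) * norm y"
        using B2(1) \<tau>_pos[of i] by (intro mult_right_mono divide_right_mono; simp)+
      then show ?thesis using * \<tau>_dec[OF ij] by (intro exI[of _ i]) linarith
    qed
    then obtain i where i: "\<tau> j \<le> \<tau> i" "norm (T z y) \<le> (B1 + B2) / \<tau> i * norm y"
        "cpr e y = 0 \<longrightarrow> norm (T z y) \<le> (B1 + B2) * norm y" by blast
    have "(B1 + B2) / \<tau> i * norm y \<le> (B1 + B2) / \<tau> j * norm y"
      using i(1) B1(1) B2(1) \<tau>_pos[of j] by (intro mult_right_mono divide_left_mono) auto
    with i show ?thesis by linarith
  qed
  have "resolvent_bounded y (\<lambda>j. (B1 + B2) / \<tau> j * norm y) \<and>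
      (cpr e y = 0 \<longrightarrow> resolvent_bounded y (\<lambda>_. (B1 + B2) * norm y))" for y
    unfolding resolvent_bounded_def using main[OF less_imp_le less_imp_le _ _ refl] by blast
  then show ?thesis using B1(1) B2(1) by (intro exI[of _ "B1 + B2"]) auto
qed

end

section \<open>Decay of the Fourier coefficients\<close>

lemma integral_le_const:
  fixes g :: "real \<Rightarrow> real"
  assumes "continuous_on {a..b} g" "\<And>\<theta>. \<theta> \<in> {a..b} \<Longrightarrow> g \<theta> \<le> c" "a \<le> b"
  shows "integral {a..b} g \<le> c * (b - a)"
proof -
  have "integral {a..b} g \<le> integral {a..b} (\<lambda>_. c)"
    by (intro integral_le integrable_continuous_real assms continuous_on_const)
  then show ?thesis using assms(3) by (simp add: mult.commute)
qed

text \<open>The interval is peeled off from outside by halving; each of the two outer pieces of step \<open>i\<close> has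
length \<open>2 \<cdot> 2\<^sup>-\<^sup>i\<close>.\<close>

lemma dyadic_integral_bound:
  fixes g :: "real \<Rightarrow> real"
  assumes cont: "continuous_on {-4..4} g"
    and far: "\<And>i \<theta>. i < I \<Longrightarrow> 2 * (1/2) ^ i \<le> \<bar>\<theta>\<bar> \<Longrightarrow> \<bar>\<theta>\<bar> \<le> 4 * (1/2) ^ i \<Longrightarrow> g \<theta> \<le> c i"
    and near: "\<And>\<theta>. \<bar>\<theta>\<bar> \<le> 4 * (1/2) ^ I \<Longrightarrow> g \<theta> \<le> d"
  shows "integral {-4..4} g \<le> (\<Sum>i<I. 4 * (1/2) ^ i * c i) + 8 * (1/2) ^ I * d"
proof -
  have sub: "continuous_on {a..b} g" if "-4 \<le> a" "b \<le> 4" for a b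
    using cont by (rule continuous_on_subset) (use that in auto)
  have le4: "4 * (1/2) ^ m \<le> (4 :: real)" for m by (simp add: power_le_one)
  have "integral {-4..4} g \<le> (\<Sum>i<m. 4 * (1/2) ^ i * c i) + integral {- (4 * (1/2) ^ m)..4 * (1/2) ^ m} g"
    if "m \<le> I" for m
    using that
  proof (induction m)
    case (Suc m)
    define a :: real where "a = 2 * (1/2) ^ m"
    have a: "0 < a" "2 * a \<le> 4" using le4[of m] by (auto simp: a_def)
    have int: "g integrable_on {u..v}" if "-(2 * a) \<le> u" "v \<le> 2 * a" for u v
      using that a by (intro integrable_continuous_real sub) auto
    have "integral {-(2 * a)..-a} g + integral {-a..a} g = integral {-(2 * a)..a} g"
      by (rule Henstock_Kurzweil_Integration.integral_combine) (use a int in auto)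
    moreover have "integral {-(2 * a)..a} g + integral {a..2 * a} g = integral {-(2 * a)..2 * a} g"
      by (rule Henstock_Kurzweil_Integration.integral_combine) (use a int in auto)
    moreover have far': "g \<theta> \<le> c m" if "a \<le> \<bar>\<theta>\<bar>" "\<bar>\<theta>\<bar> \<le> 2 * a" for \<theta>
      using far[of m \<theta>] that Suc.prems by (simp add: a_def)
    moreover have "integral {-(2 * a)..-a} g \<le> c m * (- a - (-(2 * a)))"
      using a by (intro integral_le_const sub far') auto
    moreover have "integral {a..2 * a} g \<le> c m * (2 * a - a)"
      using a by (intro integral_le_const sub far') auto
    ultimately have step: "integral {-(2 * a)..2 * a} g \<le> 2 * a * c m + integral {-a..a} g"
      by (simp add: algebra_simps)
    have e1: "4 * (1/2) ^ m = 2 * a" and e2: "4 * (1/2) ^ Suc m = a" by (simp_all add: a_def)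
    have "integral {-4..4} g \<le> (\<Sum>i<m. 4 * (1/2) ^ i * c i) + integral {-(2 * a)..2 * a} g"
      using Suc unfolding e1 by simp
    then show ?case using step unfolding e2 sum.lessThan_Suc e1 by linarith
  qed simp
  from this[of I] have "integral {-4..4} g \<le>
      (\<Sum>i<I. 4 * (1/2) ^ i * c i) + integral {- (4 * (1/2) ^ I)..4 * (1/2) ^ I} g" by simp
  also have "integral {- (4 * (1/2) ^ I)..4 * (1/2) ^ I} g \<le> d * (4 * (1/2) ^ I - - (4 * (1/2) ^ I))"
    using le4[of I] by (intro integral_le_const sub near) auto
  finally show ?thesis by (simp add: algebra_simps)
qed

text \<open>The two pieces in which the shifted interval differs from the original one are translates by
\<open>2 \<pi>\<close> of each other.\<close>

lemma integral_periodic_shift: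
  fixes f :: "real \<Rightarrow> 'a::banach"
  assumes f: "\<And>S. continuous_on S f" and per: "\<And>\<theta>. f (\<theta> + 2 * pi) = f \<theta>" and h: "0 \<le> h" "h \<le> 2 * pi"
  shows "integral {-pi..pi} (\<lambda>\<theta>. f (\<theta> - h)) = integral {-pi..pi} f"
proof -
  have int: "f integrable_on {a..b}" for a b by (intro integrable_continuous_real f)
  have "integral {-pi..pi} (f \<circ> (+) (- h)) = integral {-pi + - h..pi + - h} f"
    by (rule integral_shift_Icc_real)
  then have 1: "integral {-pi..pi} (\<lambda>\<theta>. f (\<theta> - h)) = integral {-pi - h..pi - h} f"
    by (simp add: o_def)
  have "integral {-pi - h..-pi} (f \<circ> (+) (2 * pi)) = integral {-pi - h + 2 * pi..-pi + 2 * pi} f"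
    by (rule integral_shift_Icc_real)
  then have 2: "integral {-pi - h..-pi} f = integral {pi - h..pi} f"
    by (simp add: o_def per add.commute[of "2 * pi"])
  have "integral {-pi - h..-pi} f + integral {-pi..pi - h} f = integral {-pi - h..pi - h} f"
    using h by (intro Henstock_Kurzweil_Integration.integral_combine int) auto
  moreover have "integral {-pi..pi - h} f + integral {pi - h..pi} f = integral {-pi..pi} f"
    using h by (intro Henstock_Kurzweil_Integration.integral_combine int) auto
  ultimately show ?thesis using 1 2 by (simp add: add.commute)
qed

context operator_renewal
begin

text \<open>Shifting \<open>\<theta>\<close> by \<open>\<pi>/n\<close> changes the sign of \<open>z\<^sup>-\<^sup>n\<close>. Averaging the integral and its shifted version
therefore produces the difference in the second bound.\<close>

lemma coeff_bounds:
  assumes r: "0 < r" "r < 1" and rn: "1/4 \<le> r ^ n" and n: "n \<ge> 1"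
  shows "norm (coeff r (int n) x) \<le> 8 * integral {-pi..pi} (\<lambda>\<theta>. norm (T (of_real r * cis \<theta>) x))"
    and "norm (coeff r (int n) x) \<le> 4 * integral {-pi..pi}
      (\<lambda>\<theta>. norm (T (of_real r * cis \<theta>) x - T (of_real r * cis (\<theta> - pi / n)) x))"
proof -
  let ?h = "pi / real n"
  let ?F = "\<lambda>\<theta>. T (of_real r * cis \<theta>) x"
  let ?G = "coeff_integrand r (int n) x"
  let ?w = "\<lambda>\<theta>. (of_real r * cis \<theta>) powi (- int n) :: complex"
  have Fc: "continuous_on S ?F" for S by (intro continuous_intros T_circle_continuous r)
  have Fc': "continuous_on S (\<lambda>\<theta>. ?F (\<theta> - ?h))" for S
    by (rule continuous_on_compose2[OF Fc[of UNIV]]) (auto intro!: continuous_intros)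
  have wc: "continuous_on S ?w" for S using r by (intro continuous_intros) auto
  have w: "norm (cscale (?w \<theta>) y) \<le> 8 * norm y" for \<theta> and y :: "'b \<times> 'b"
  proof -
    have "norm (?w \<theta>) = 1 / r ^ n" using r by (simp add: norm_inverse norm_power norm_mult power_int_minus divide_inverse)
    also have "\<dots> \<le> 4" using rn r by (simp add: field_simps)
    finally have "2 * norm (?w \<theta>) * norm y \<le> 8 * norm y" by (intro mult_right_mono) auto
    then show ?thesis using norm_cscale_le[of "?w \<theta>" y] by linarith
  qed
  have coeff: "coeff r (int n) x = integral {-pi..pi} ?G" by (simp add: coeff_def)
  have "norm (integral {-pi..pi} ?G) \<le> integral {-pi..pi} (\<lambda>\<theta>. 8 * norm (?F \<theta>))"
  proof (rule integral_norm_bound_integral)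
    show "?G integrable_on {-pi..pi}" by (intro integrable_continuous_real coeff_integrand_continuous r)
    show "(\<lambda>\<theta>. 8 * norm (?F \<theta>)) integrable_on {-pi..pi}" by (intro integrable_continuous_real continuous_intros Fc)
  qed (auto simp: coeff_integrand_def intro!: w)
  then show "norm (coeff r (int n) x) \<le> 8 * integral {-pi..pi} (\<lambda>\<theta>. norm (?F \<theta>))"
    by (simp add: coeff)
  have half: "cis (\<theta> - ?h) powi (- int n) = - (cis \<theta> powi (- int n))" for \<theta>
  proof -
    have "cis (\<theta> - ?h) ^ n = cis (real n * \<theta> - pi)" using n by (simp add: Complex.DeMoivre right_diff_distrib)
    also have "\<dots> = - (cis \<theta> ^ n)" by (simp add: Complex.DeMoivre complex_eq_iff cos_diff sin_diff)
    finally show ?thesis by (simp add: power_int_minus)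
  qed
  \<comment> \<open>the half period: \<open>e\<^sup>i\<^sup>n\<^sup>h = -1\<close> for \<open>h = \<pi>/n\<close>\<close>
  have G_shift: "?G (\<theta> - ?h) = - cscale (?w \<theta>) (?F (\<theta> - ?h))" for \<theta>
  proof -
    have "?w (\<theta> - ?h) = - ?w \<theta>" by (simp add: power_int_mult_distrib half)
    moreover have "cscale (- c) y = - cscale c y" for c and y :: "'b \<times> 'b" by (simp add: cscale_apply)
    ultimately show ?thesis by (simp add: coeff_integrand_def)
  qed
  have "?h \<le> pi / 1" using n by (intro divide_left_mono) auto
  then have "?h \<le> 2 * pi" using pi_ge_zero by linarith
  then have "integral {-pi..pi} (\<lambda>\<theta>. ?G (\<theta> - ?h)) = integral {-pi..pi} ?G"
  proof (intro integral_periodic_shift coeff_integrand_continuous r)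
    have "cis (\<theta> + 2 * pi) = cis \<theta>" for \<theta> by (simp add: complex_eq_iff)
    then show "?G (\<theta> + 2 * pi) = ?G \<theta>" for \<theta> by (simp only: coeff_integrand_def)
  qed simp
  then have "coeff r (int n) x + coeff r (int n) x = integral {-pi..pi} ?G + integral {-pi..pi} (\<lambda>\<theta>. ?G (\<theta> - ?h))"
    by (simp add: coeff)
  also have "\<dots> = integral {-pi..pi} (\<lambda>\<theta>. ?G \<theta> + ?G (\<theta> - ?h))"
    unfolding G_shift
    by (intro integral_add[symmetric] integrable_continuous_real coeff_integrand_continuous r continuous_intros wc Fc')
  also have "\<dots> = integral {-pi..pi} (\<lambda>\<theta>. cscale (?w \<theta>) (?F \<theta> - ?F (\<theta> - ?h)))"
    unfolding G_shift by (simp add: coeff_integrand_def blinfun.diff_right)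
  finally have two: "2 *\<^sub>R coeff r (int n) x = integral {-pi..pi} (\<lambda>\<theta>. cscale (?w \<theta>) (?F \<theta> - ?F (\<theta> - ?h)))"
    by (simp add: scaleR_2)
  have "norm (integral {-pi..pi} (\<lambda>\<theta>. cscale (?w \<theta>) (?F \<theta> - ?F (\<theta> - ?h)))) \<le>
      integral {-pi..pi} (\<lambda>\<theta>. 8 * norm (?F \<theta> - ?F (\<theta> - ?h)))"
    by (rule integral_norm_bound_integral)
       (auto intro!: integrable_continuous_real continuous_intros wc Fc Fc' w)
  then have "2 * norm (coeff r (int n) x) \<le> 8 * integral {-pi..pi} (\<lambda>\<theta>. norm (?F \<theta> - ?F (\<theta> - ?h)))"
    unfolding two[symmetric] by simp
  then show "norm (coeff r (int n) x) \<le> 4 * integral {-pi..pi} (\<lambda>\<theta>. norm (?F \<theta> - ?F (\<theta> - ?h)))" by simp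
qed

text \<open>The radius \<open>n/(n+1)\<close> makes \<open>z\<^sup>-\<^sup>n\<close> bounded and keeps the circle at distance \<open>1/(n+1)\<close> from the
singularity. On the block \<open>\<bar>\<theta>\<bar> \<approx> 2\<^sup>-\<^sup>i\<close> the resolvent identity bounds the difference of the two
resolvents by \<open>\<tau>\<^sub>J N\<^sub>i / \<tau>\<^sub>i\<close> up to constants. The innermost interval, of length about
\<open>2\<^sup>-\<^sup>J\<close>, is estimated trivially by \<open>N\<^sub>J\<close> and fits into the sum as the term \<open>i = J\<close>.\<close>

theorem renewal_bound:
  "\<exists>D>0. \<forall>v N n J. resolvent_bounded (v, 0) N \<longrightarrow> 2 ^ J \<le> n \<longrightarrow> n < 2 ^ Suc J \<longrightarrow>
     norm (renewal Rn n v) \<le> D * \<tau> J * (\<Sum>i\<le>J. (1/2) ^ i * N i / \<tau> i)"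
proof -
  obtain A where A: "A > 0"
    "\<And>j z w. norm z \<le> 1 \<Longrightarrow> norm w \<le> 1 \<Longrightarrow> norm (z - w) \<le> 4 * (1/2) ^ j \<Longrightarrow> norm (R z - R w) \<le> A * \<tau> j"
    using R_modulus by blast
  obtain B where B: "B > 0" "\<And>y. resolvent_bounded y (\<lambda>j. B / \<tau> j * norm y)"
    using resolvent_bound by blast
  note BT = B(2)[unfolded resolvent_bounded_def, rule_format]
  define D where "D = 4 * B * A + 32"
  have D: "D \<ge> 32" using A B by (simp add: D_def)
  have "norm (renewal Rn n v) \<le> D * \<tau> J * (\<Sum>i\<le>J. (1/2) ^ i * N i / \<tau> i)"
    if bd: "resolvent_bounded (v, 0) N" and J: "2 ^ J \<le> n" "n < 2 ^ Suc J" for v N n J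
  proof -
    note N = bd[unfolded resolvent_bounded_def, rule_format]
    have n: "1 \<le> n" "2 ^ J \<le> n" "n < 2 ^ Suc J" using J by (cases n; simp)+
    define r where "r = real n / (real n + 1)"
    let ?h = "pi / real n"
    let ?F = "\<lambda>\<theta>. T (of_real r * cis \<theta>) (v, 0)"
    let ?S = "\<Sum>i\<le>J. (1/2) ^ i * N i / \<tau> i"
    have r: "0 < r" "r < 1" using n by (simp_all add: r_def)
    have "n + 1 \<le> 2 ^ Suc J" using n by simp
    then have "real (n + 1) \<le> real (2 ^ Suc J)" by (simp only: of_nat_le_iff)
    then have "real n + 1 \<le> 2 ^ Suc J" by simp
    then have "1 / 2 ^ Suc J \<le> 1 / (real n + 1)" by (intro divide_left_mono) auto
    also have "1 / (real n + 1) = 1 - r" by (simp add: r_def field_simps)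
    finally have r1: "(1/2) ^ Suc J \<le> 1 - r" by (simp add: power_one_over)
    have rn: "1/4 \<le> r ^ n"
    proof -
      have "(1 + 1 / real n) ^ n \<le> exp (1 / real n) ^ n" by (intro power_mono exp_ge_add_one_self) auto
      also have "\<dots> = exp 1" using n by (simp add: exp_of_nat_mult[symmetric])
      also have "\<dots> \<le> 4" using e_less_272 by simp
      finally have "(1 + 1 / real n) ^ n \<le> 4" .
      moreover have "1 + 1 / real n = 1 / r" using n by (simp add: r_def field_simps)
      then have "(1 + 1 / real n) ^ n = 1 / r ^ n" by (simp add: power_one_over)
      ultimately have "1 / r ^ n \<le> 4" by simp
      then show ?thesis using r by (simp add: field_simps)
    qed
    have N0: "0 \<le> N i" for i
    proof -
      have "(1/2) ^ Suc i \<le> (1 :: real)" by (rule power_le_one) auto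
      then have "norm (T (of_real (1/2) * cis 1) (v, 0)) \<le> N i" by (intro N) auto
      then show ?thesis by (rule order_trans[OF norm_ge_zero])
    qed
    have term0: "0 \<le> (1/2) ^ i * N i / \<tau> i" for i using N0[of i] \<tau>_pos[of i] by simp
    have last: "(1/2) ^ J * N J \<le> \<tau> J * ?S"
    proof -
      have "(1/2) ^ J * N J / \<tau> J \<le> ?S" using term0 by (intro member_le_sum) auto
      then show ?thesis using \<tau>_pos[of J] by (simp add: field_simps)
    qed
    have S0: "0 \<le> \<tau> J * ?S" using term0 \<tau>_pos[of J] by (intro mult_nonneg_nonneg sum_nonneg) auto
    have FJ: "norm (?F \<theta>) \<le> N J" if "\<bar>\<theta>\<bar> \<le> 5" for \<theta> using r1 by (intro N r that) linarith
    have Fc: "continuous_on S ?F" for S by (intro continuous_intros T_circle_continuous r)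
    have "2 * pi * norm (renewal Rn n v) = norm (coeff r (int n) (v, 0))"
      by (simp add: renewal_eq_coeff[OF r] complexify_apply norm_Pair blinfun.zero_right)
    \<comment> \<open>for the finitely many \<open>n < 4\<close> the shift by \<open>\<pi>/n\<close> is too long, and the undifferenced bound is enough\<close>
    also have "\<dots> \<le> 2 * pi * (D * (\<tau> J * ?S))"
    proof (cases "J < 2")
      case True
      have "integral {-pi..pi} (\<lambda>\<theta>. norm (?F \<theta>)) \<le> N J * (pi - - pi)"
        by (intro integral_le_const continuous_intros Fc FJ) (use pi_less_4 in auto)
      then have "8 * integral {-pi..pi} (\<lambda>\<theta>. norm (?F \<theta>)) \<le> 2 * pi * (8 * N J)"
        by (simp add: algebra_simps)
      with coeff_bounds(1)[OF r rn n(1), of "(v, 0)"]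
      have "norm (coeff r (int n) (v, 0)) \<le> 2 * pi * (8 * N J)" by linarith
      also have "\<dots> \<le> 2 * pi * (D * (\<tau> J * ?S))"
      proof (intro mult_left_mono)
        have "1/2 \<le> (1/2 :: real) ^ J" using True by (cases J) (auto simp: less_Suc_eq)
        then have "1/2 * N J \<le> (1/2) ^ J * N J" using N0 by (intro mult_right_mono)
        with last have "8 * N J \<le> 16 * (\<tau> J * ?S)" by linarith
        also have "\<dots> \<le> D * (\<tau> J * ?S)" using D S0 by (intro mult_right_mono) auto
        finally show "8 * N J \<le> D * (\<tau> J * ?S)" .
      qed simp
      finally show ?thesis .
    next
      case False
      have hJ: "?h \<le> 4 * (1/2) ^ J"
      proof -
        have "real (2 ^ J) \<le> real n" using n(2) by (simp only: of_nat_le_iff)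
        then have "pi / real n \<le> 4 / 2 ^ J" using pi_less_4 by (intro frac_le) auto
        then show ?thesis by (simp add: power_one_over)
      qed
      have "(1/2 :: real) ^ J \<le> (1/2) ^ 2" using False by (intro power_decreasing) auto
      with hJ have h1: "?h \<le> 1" by (simp add: power2_eq_square)
      have h0: "0 \<le> ?h" by simp
      let ?g = "\<lambda>\<theta>. norm (?F \<theta> - ?F (\<theta> - ?h))"
      have gc: "continuous_on S ?g" for S
        by (intro continuous_intros Fc continuous_on_compose2[OF Fc[of UNIV]]) auto
      have "integral {-pi..pi} ?g \<le> integral {-4..4} ?g"
        by (intro integral_subset_le integrable_continuous_real gc) (use pi_less_4 in auto)
      also have "\<dots> \<le> (\<Sum>i<J - 1. 4 * (1/2) ^ i * (B / \<tau> i * (A * \<tau> J * N i))) + 8 * (1/2) ^ (J - 1) * (2 * N J)"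
      proof (rule dyadic_integral_bound[OF gc])
        fix i and \<theta> :: real assume i: "i < J - 1" and lo: "2 * (1/2) ^ i \<le> \<bar>\<theta>\<bar>" and hi: "\<bar>\<theta>\<bar> \<le> 4 * (1/2) ^ i"
        have i1: "(1/2 :: real) ^ i \<le> 1" by (rule power_le_one) auto
        have i0: "0 \<le> (1/2 :: real) ^ i" by simp
        have "(1/2 :: real) ^ J \<le> (1/2) ^ (i + 2)" using i by (intro power_decreasing) auto
        then have "4 * (1/2 :: real) ^ J \<le> (1/2) ^ i" by (simp add: power_add power2_eq_square)
        then have hi': "?h \<le> (1/2) ^ i" using hJ by linarith
        have \<theta>: "\<bar>\<theta>\<bar> \<le> 4" using hi i1 by linarith
        have \<theta>': "\<bar>\<theta> - ?h\<bar> \<le> 5" using \<theta> h1 h0 by linarith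
        have lo': "(1/2) ^ i \<le> \<bar>\<theta> - ?h\<bar>" using lo hi' h0 by linarith
        have ih: "(1/2 :: real) ^ Suc i \<le> (1/2) ^ i" by simp
        let ?z = "of_real r * cis \<theta>" and ?z' = "of_real r * cis (\<theta> - ?h)"
        have nz: "norm ?z \<le> 1" "norm ?z' \<le> 1" "?z \<noteq> 1" "?z' \<noteq> 1" using circle_ne[OF r] by auto
        have "norm (?z - ?z') \<le> ?h"
        proof -
          have "?z - ?z' = of_real r * cis (\<theta> - ?h) * (of_real 1 * cis ?h - 1)"
            by (simp add: algebra_simps cis_mult)
          then have "norm (?z - ?z') = r * norm (of_real 1 * cis ?h - 1)" using r by (simp add: norm_mult)
          also have "\<dots> \<le> 1 * ?h" using dist_1_polar[of 1 ?h] r h0 by (intro mult_mono) auto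
          finally show ?thesis by simp
        qed
        then have RR: "norm (R ?z - R ?z') \<le> A * \<tau> J" using hJ nz by (intro A(2)) auto
        have F': "norm (?F (\<theta> - ?h)) \<le> N i"
          using lo' ih \<theta>' by (intro N r) (auto simp: le_max_iff_disj intro: order_trans)
        have "?F \<theta> - ?F (\<theta> - ?h) = T ?z ((R ?z - R ?z') (?F (\<theta> - ?h)))" using T_diff nz by blast
        then have "?g \<theta> = norm (T ?z ((R ?z - R ?z') (?F (\<theta> - ?h))))" by simp
        also have "\<dots> \<le> B / \<tau> i * norm ((R ?z - R ?z') (?F (\<theta> - ?h)))"
        proof (rule BT)
          have "(1/2) ^ Suc i \<le> \<bar>\<theta>\<bar>" using lo ih i0 by linarith
          then show "(1/2) ^ Suc i \<le> max (1 - r) \<bar>\<theta>\<bar>" by linarith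
        qed (use r \<theta> in auto)
        also have "\<dots> \<le> B / \<tau> i * (A * \<tau> J * N i)"
          using B(1) \<tau>_pos[of i] \<tau>_pos[of J] A(1) RR F'
          by (intro mult_left_mono order_trans[OF norm_blinfun mult_mono]) auto
        finally show "?g \<theta> \<le> B / \<tau> i * (A * \<tau> J * N i)" .
      next
        fix \<theta> :: real assume hi: "\<bar>\<theta>\<bar> \<le> 4 * (1/2) ^ (J - 1)"
        have "(1/2 :: real) ^ (J - 1) \<le> 1" by (rule power_le_one) auto
        then have "\<bar>\<theta>\<bar> \<le> 4" using hi by linarith
        then have "\<bar>\<theta>\<bar> \<le> 5" "\<bar>\<theta> - ?h\<bar> \<le> 5" using h1 h0 by linarith+
        from FJ[OF this(1)] FJ[OF this(2)] norm_triangle_ineq4[of "?F \<theta>" "?F (\<theta> - ?h)"]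
        show "?g \<theta> \<le> 2 * N J" by linarith
      qed
      also have "(\<Sum>i<J - 1. 4 * (1/2) ^ i * (B / \<tau> i * (A * \<tau> J * N i))) \<le> 4 * B * A * (\<tau> J * ?S)"
      proof -
        have "(\<Sum>i<J - 1. 4 * (1/2) ^ i * (B / \<tau> i * (A * \<tau> J * N i))) =
            4 * B * A * \<tau> J * (\<Sum>i<J - 1. (1/2) ^ i * N i / \<tau> i)"
          unfolding sum_distrib_left by (intro sum.cong) (auto simp: field_simps)
        also have "\<dots> \<le> 4 * B * A * \<tau> J * ?S"
          using A B \<tau>_pos[of J] term0 by (intro mult_left_mono sum_mono2) auto
        finally show ?thesis by (simp add: mult.assoc)
      qed
      also have "8 * (1/2) ^ (J - 1) * (2 * N J) \<le> 32 * (\<tau> J * ?S)"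
      proof -
        have "(1/2 :: real) ^ (J - 1) = 2 * (1/2) ^ J" using False by (cases J) auto
        then show ?thesis using last by simp
      qed
      finally have "integral {-pi..pi} ?g \<le> D * (\<tau> J * ?S)" by (simp add: D_def distrib_right)
      then have "norm (coeff r (int n) (v, 0)) \<le> 4 * (D * (\<tau> J * ?S))"
        using coeff_bounds(2)[OF r rn n(1), of "(v, 0)"] by linarith
      also have "\<dots> \<le> 2 * pi * (D * (\<tau> J * ?S))"
      proof (rule mult_right_mono)
        show "0 \<le> D * (\<tau> J * ?S)" by (rule mult_nonneg_nonneg[OF _ S0]) (use D in simp)
      qed (use pi_gt3 in simp)
      finally show ?thesis .
    qed
    finally have "norm (renewal Rn n v) \<le> D * (\<tau> J * ?S)" by simp
    then show ?thesis by (simp add: mult.assoc)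
  qed
  then show ?thesis using D by (intro exI[of _ D] conjI allI impI) auto
qed

end

section \<open>The first return map and the renewal equation\<close>

locale first_return =
  fixes M :: "'a measure" and f :: "'a \<Rightarrow> 'a" and Y :: "'a set"
  assumes mp: "measure_preserving_map M f" and cons: "conservative M f"
    and Y [measurable]: "Y \<in> sets M" and emeasure_Y: "emeasure M Y = 1"
begin

abbreviation N :: "'a measure" where "N \<equiv> restrict_space M Y"
abbreviation \<phi> :: "'a \<Rightarrow> nat" where "\<phi> \<equiv> return_time f Y"
abbreviation F :: "'a \<Rightarrow> 'a" where "F \<equiv> first_return_map f Y"

lemma f_measurable [measurable]: "f \<in> M \<rightarrow>\<^sub>M M"
  using mp by (simp add: measure_preserving_map_def)

lemma funpow_measurable [measurable]: "f ^^ n \<in> M \<rightarrow>\<^sub>M M"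
  by (induction n) (simp_all add: id_def o_def)

lemma funpow_measurable' [measurable]: "(\<lambda>x. (f ^^ n) x) \<in> M \<rightarrow>\<^sub>M M"
  using funpow_measurable by (simp add: eta_contract_eq)

lemma distr_funpow: "distr M M (f ^^ n) = M"
proof (induction n)
  case (Suc n)
  have "distr M M (f ^^ Suc n) = distr (distr M M (f ^^ n)) M f"
    by (subst distr_distr) auto
  then show ?case using Suc mp by (simp only: measure_preserving_map_def)
qed (simp add: id_def distr_id2)

lemma emeasure_funpow_vimage: "A \<in> sets M \<Longrightarrow> emeasure M ((f ^^ n) -` A \<inter> space M) = emeasure M A"
  using arg_cong[OF distr_funpow, of "\<lambda>M'. emeasure M' A" n] by (simp add: emeasure_distr)

lemma Y_space: "Y \<subseteq> space M" using sets.sets_into_space[OF Y] .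

lemma Y_Int_space [simp]: "Y \<inter> space M = Y" using Y_space by blast

lemma space_N [simp]: "space N = Y"
  by (simp add: space_restrict_space)

lemma emeasure_N: "emeasure N Y = 1"
  by (simp add: emeasure_restrict_space emeasure_Y)

sublocale N: finite_measure N
  by (rule finite_measureI) (simp add: emeasure_N)

lemma measure_N [simp]: "measure N Y = 1"
  by (simp add: measure_def emeasure_N)

lemma return_time_measurable [measurable]: "\<phi> \<in> M \<rightarrow>\<^sub>M count_space UNIV"
  unfolding return_time_def Inf_nat_def mem_Collect_eq by measurable

lemma id_measurable_N [measurable]: "(\<lambda>x. x) \<in> N \<rightarrow>\<^sub>M M"
  by (rule measurable_restrict_space1) simp

lemma return_time_measurable_N [measurable]: "\<phi> \<in> N \<rightarrow>\<^sub>M count_space UNIV"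
  by (rule measurable_restrict_space1) measurable

lemma first_return_map_measurable [measurable]: "F \<in> M \<rightarrow>\<^sub>M M"
  unfolding first_return_map_def[abs_def] by (rule measurable_compose_countable) measurable

lemma first_return_map_measurable_N [measurable]: "F \<in> N \<rightarrow>\<^sub>M M"
  by (rule measurable_restrict_space1) measurable

text \<open>The points of \<open>Y\<close> that never return form a wandering set.\<close>

lemma returns_AE: "AE y in N. \<exists>n\<ge>1. (f ^^ n) y \<in> Y"
proof -
  define W where "W = {y \<in> space M. y \<in> Y \<and> (\<forall>n\<ge>1. (f ^^ n) y \<notin> Y)}"
  have W [measurable]: "W \<in> sets M" unfolding W_def by measurable
  have "disjoint_family (\<lambda>n. (f ^^ n) -` W \<inter> space M)"
  proof -
    have False if "m < n" "x \<in> (f ^^ m) -` W" "x \<in> (f ^^ n) -` W" for m n x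
    proof -
      have "(f ^^ (n - m)) ((f ^^ m) x) = (f ^^ n) x"
        using that(1) funpow_add[of "n - m" m f] by simp
      moreover have "(f ^^ n) x \<in> Y" "(f ^^ (n - m)) ((f ^^ m) x) \<notin> Y" using that by (auto simp: W_def)
      ultimately show False by simp
    qed
    then have "m = n" if "x \<in> (f ^^ m) -` W" "x \<in> (f ^^ n) -` W" for m n x
      using that by (meson linorder_neqE_nat)
    then show ?thesis by (fastforce simp: disjoint_family_on_def)
  qed
  then have "W \<in> null_sets M" using cons W unfolding conservative_def wandering_def by auto
  then have "AE y in M. y \<notin> W" by (rule AE_not_in)
  then show ?thesis using Y by (subst AE_restrict_space_iff) (auto simp: W_def)
qed

lemma return_time_eq_iff:
  assumes "\<exists>n\<ge>1. (f ^^ n) y \<in> Y"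
  shows "\<phi> y = k \<longleftrightarrow> k \<ge> 1 \<and> (f ^^ k) y \<in> Y \<and> (\<forall>i\<ge>1. i < k \<longrightarrow> (f ^^ i) y \<notin> Y)"
proof -
  let ?P = "\<lambda>n. 1 \<le> n \<and> (f ^^ n) y \<in> Y"
  have \<phi>: "\<phi> y = (LEAST n. ?P n)" by (simp add: return_time_def Inf_nat_def)
  have P: "?P (\<phi> y)" unfolding \<phi> by (rule LeastI_ex[OF assms])
  have min: "\<not> ?P i" if "i < \<phi> y" for i
    using that unfolding \<phi> by (rule not_less_Least)
  show ?thesis
  proof
    assume k: "k \<ge> 1 \<and> (f ^^ k) y \<in> Y \<and> (\<forall>i\<ge>1. i < k \<longrightarrow> (f ^^ i) y \<notin> Y)"
    then have "\<not> k < \<phi> y" using min by blast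
    moreover have "\<not> \<phi> y < k" using k P by blast
    ultimately show "\<phi> y = k" by simp
  qed (use P min in auto)
qed

text \<open>Let \<open>D\<^sub>k\<close> be the set of points of \<open>Y\<close> which return first at time \<open>k\<close>, and in \<open>A\<close>. The preimages of
\<open>D\<^sub>k\<close> under \<open>f\<^sup>n\<^sup>-\<^sup>k\<close>, for \<open>1 \<le> k \<le> n\<close>, consist of points of \<open>f\<^sup>-\<^sup>n (A \<inter> Y)\<close> whose last visit to \<open>Y\<close> before
time \<open>n\<close> takes place at time \<open>n - k\<close>. Hence they are disjoint, and by invariance the measures of
\<open>D\<^sub>1, \<dots>, D\<^sub>n\<close> add up to at most the measure of \<open>A \<inter> Y\<close>.\<close>

lemma emeasure_first_return_le:
  assumes A [measurable]: "A \<in> sets M"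
  shows "emeasure M {y \<in> Y. F y \<in> A} \<le> emeasure M (A \<inter> Y)"
proof -
  define D where "D k = {y \<in> space M. y \<in> Y \<and> (f ^^ k) y \<in> A \<inter> Y \<and> (\<forall>i\<ge>1. i < k \<longrightarrow> (f ^^ i) y \<notin> Y)}" for k
  have D [measurable]: "D k \<in> sets M" for k unfolding D_def by measurable
  have part: "(\<Sum>k<n. emeasure M (D (Suc k))) \<le> emeasure M (A \<inter> Y)" for n
  proof -
    let ?B = "\<lambda>k. (f ^^ (n - Suc k)) -` D (Suc k) \<inter> space M"
    have split: "(f ^^ i) ((f ^^ j) x) = (f ^^ (i + j)) x" for i j x by (simp add: funpow_add)
    have disj: "?B k \<inter> ?B l = {}" if "k < l" "l < n" for k l
    proof -
      have False if "x \<in> ?B k" "x \<in> ?B l" for x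
      proof -
        have "(f ^^ (n - Suc k)) x \<in> Y" using that(1) by (simp add: D_def)
        moreover have "(f ^^ (l - k)) ((f ^^ (n - Suc l)) x) = (f ^^ (n - Suc k)) x"
          using \<open>k < l\<close> \<open>l < n\<close> by (simp add: split)
        moreover have "(f ^^ (l - k)) ((f ^^ (n - Suc l)) x) \<notin> Y"
          using that(2) \<open>k < l\<close> by (auto simp: D_def)
        ultimately show False by simp
      qed
      then show ?thesis by blast
    qed
    have "(\<Sum>k<n. emeasure M (D (Suc k))) = (\<Sum>k<n. emeasure M (?B k))"
      by (simp add: emeasure_funpow_vimage)
    also have "\<dots> = emeasure M (\<Union>k<n. ?B k)"
    proof (rule sum_emeasure)
      show "disjoint_family_on ?B {..<n}"
        unfolding disjoint_family_on_def using disj by (metis inf_commute lessThan_iff linorder_neqE_nat)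
    qed auto
    also have "\<dots> \<le> emeasure M ((f ^^ n) -` (A \<inter> Y) \<inter> space M)"
    proof (rule emeasure_mono)
      have "(f ^^ n) x \<in> A \<inter> Y" if "k < n" "x \<in> ?B k" for k x
      proof -
        have "(f ^^ Suc k) ((f ^^ (n - Suc k)) x) \<in> A \<inter> Y" using that(2) by (auto simp: D_def)
        moreover have "Suc k + (n - Suc k) = n" using that by simp
        ultimately show ?thesis by (simp only: split)
      qed
      then show "(\<Union>k<n. ?B k) \<subseteq> (f ^^ n) -` (A \<inter> Y) \<inter> space M" by auto
    qed measurable
    also have "\<dots> = emeasure M (A \<inter> Y)" by (intro emeasure_funpow_vimage) measurable
    finally show ?thesis .
  qed
  have dD: "disjoint_family (\<lambda>k. D (Suc k))"
  proof -
    have "D (Suc k) \<inter> D (Suc l) = {}" if "k < l" for k l using that by (auto simp: D_def)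
    then show ?thesis unfolding disjoint_family_on_def by (metis inf_commute linorder_neqE_nat)
  qed
  have "AE y in M. y \<in> Y \<longrightarrow> (\<exists>n\<ge>1. (f ^^ n) y \<in> Y)"
    using returns_AE by (subst (asm) AE_restrict_space_iff) auto
  then have "emeasure M {y \<in> Y. F y \<in> A} \<le> emeasure M (\<Union>k. D (Suc k))"
  proof (intro emeasure_mono_AE, elim AE_mp, intro AE_I2 impI)
    fix y assume y: "y \<in> space M" "y \<in> Y \<longrightarrow> (\<exists>n\<ge>1. (f ^^ n) y \<in> Y)" "y \<in> {y \<in> Y. F y \<in> A}"
    then have "\<exists>n\<ge>1. (f ^^ n) y \<in> Y" by simp
    from return_time_eq_iff[OF this, of "\<phi> y"]
    have "\<phi> y \<ge> 1" "(f ^^ \<phi> y) y \<in> Y" "\<forall>i\<ge>1. i < \<phi> y \<longrightarrow> (f ^^ i) y \<notin> Y" by simp_all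
    then have "y \<in> D (Suc (\<phi> y - 1))" using y by (simp add: D_def first_return_map_def)
    then show "y \<in> (\<Union>k. D (Suc k))" by blast
  qed measurable
  also have "\<dots> = (\<Sum>k. emeasure M (D (Suc k)))" using dD by (intro suminf_emeasure[symmetric]) auto
  also have "\<dots> \<le> emeasure M (A \<inter> Y)" using part by (intro suminf_le_const) auto
  finally show ?thesis .
qed

lemma first_return_in_Y_AE: "AE y in N. F y \<in> Y \<and> \<phi> y \<ge> 1"
  using returns_AE
proof eventually_elim
  case (elim y)
  from return_time_eq_iff[OF this, of "\<phi> y"] show ?case by (simp add: first_return_map_def)
qed

text \<open>The inequality for \<open>A\<close> and for its complement, together with equality of the total masses, forces
equality.\<close>

lemma distr_first_return: "distr N M F = distr N M (\<lambda>x. x)"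
proof (rule measure_eqI)
  fix A assume "A \<in> sets (distr N M F)"
  then have A [measurable]: "A \<in> sets M" by simp
  have em: "emeasure N (B \<inter> Y) = emeasure M (B \<inter> Y)" for B
    by (rule emeasure_restrict_space) auto
  have F_N: "emeasure (distr N M F) B = emeasure M {y \<in> Y. F y \<in> B}" if "B \<in> sets M" for B
  proof -
    have "F -` B \<inter> Y = {y \<in> Y. F y \<in> B} \<inter> Y" by auto
    then show ?thesis using that em[of "{y \<in> Y. F y \<in> B}"] by (simp add: emeasure_distr Int_absorb2 Collect_conj_eq)
  qed
  have A' [measurable]: "space M - A \<in> sets M" by measurable
  note le = emeasure_first_return_le[OF A] emeasure_first_return_le[OF A']
  have "emeasure (distr N M F) A + emeasure (distr N M F) (space M - A) = emeasure (distr N M F) (A \<union> (space M - A))"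
    by (rule plus_emeasure) auto
  moreover have "A \<union> (space M - A) = space M" using sets.sets_into_space[OF A] by auto
  moreover have "emeasure (distr N M F) (space M) = 1"
  proof -
    have "F -` space M \<inter> Y = Y" using measurable_space[OF first_return_map_measurable_N] by auto
    then show ?thesis by (simp add: emeasure_distr emeasure_N)
  qed
  ultimately have s1: "emeasure (distr N M F) A + emeasure (distr N M F) (space M - A) = 1" by simp
  have s2: "emeasure M ((space M - A) \<inter> Y) + emeasure M (A \<inter> Y) = 1"
  proof -
    have "emeasure M ((A \<inter> Y) \<union> ((space M - A) \<inter> Y)) = emeasure M (A \<inter> Y) + emeasure M ((space M - A) \<inter> Y)"
      by (rule plus_emeasure[symmetric]) auto
    moreover have "(A \<inter> Y) \<union> ((space M - A) \<inter> Y) = Y" using Y_space by auto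
    ultimately show ?thesis using emeasure_Y by (simp add: add.commute)
  qed
  have le1: "emeasure (distr N M F) A \<le> emeasure M (A \<inter> Y)"
    and le2: "emeasure (distr N M F) (space M - A) \<le> emeasure M ((space M - A) \<inter> Y)"
    using le F_N[of A] F_N[of "space M - A"] by auto
  have "emeasure M ((space M - A) \<inter> Y) + emeasure M (A \<inter> Y) \<le>
      emeasure M ((space M - A) \<inter> Y) + emeasure (distr N M F) A"
    unfolding s2 s1[symmetric] using le2 by (subst add.commute) (rule add_right_mono)
  moreover have "emeasure M ((space M - A) \<inter> Y) \<noteq> top"
  proof
    assume "emeasure M ((space M - A) \<inter> Y) = top"
    then show False using s2 by simp
  qed
  ultimately have "emeasure M (A \<inter> Y) \<le> emeasure (distr N M F) A"
    using ennreal_add_left_cancel_le by (metis infinity_ennreal_def)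
  with le1 have "emeasure (distr N M F) A = emeasure M (A \<inter> Y)" by (rule antisym)
  also have "\<dots> = emeasure (distr N M (\<lambda>x. x)) A" using em[of A] by (simp add: emeasure_distr)
  finally show "emeasure (distr N M F) A = emeasure (distr N M (\<lambda>x. x)) A" .
qed simp

lemma integral_first_return:
  fixes w :: "'a \<Rightarrow> real"
  assumes "w \<in> borel_measurable M"
  shows "(\<integral>y. w (F y) \<partial>N) = (\<integral>y. w y \<partial>N)"
proof -
  show ?thesis
    using arg_cong[OF distr_first_return, of "\<lambda>M'. integral\<^sup>L M' w"] assms
    by (simp add: integral_distr)
qed

text \<open>Almost every point belongs to exactly one of the level sets of the return time with positive
value; dominated convergence applies to the partial sums.\<close>

lemma partition_sums:
  fixes g :: "'a \<Rightarrow> real"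
  assumes g: "integrable N g"
  shows "(\<lambda>k. (\<integral>y. indicator {y. \<phi> y = Suc k} y * g y \<partial>N)) sums (\<integral>y. g y \<partial>N)"
proof -
  have [measurable]: "g \<in> borel_measurable N" using g by auto
  have int: "integrable N (\<lambda>y. indicator {y. \<phi> y = k} y * g y)" for k
    by (rule Bochner_Integration.integrable_bound[OF g]) (auto simp: indicator_def)
  have eq: "(\<Sum>k<n. indicator {y. \<phi> y = Suc k} y * g y) = (if 1 \<le> \<phi> y \<and> \<phi> y \<le> n then g y else 0)" for n y
    by (induction n) (auto simp: indicator_def)
  have "(\<lambda>n. \<integral>y. (\<Sum>k<n. indicator {y. \<phi> y = Suc k} y * g y) \<partial>N) \<longlonglongrightarrow> (\<integral>y. g y \<partial>N)"
  proof (rule integral_dominated_convergence[where w="\<lambda>y. \<bar>g y\<bar>"])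
    show "AE y in N. (\<lambda>n. \<Sum>k<n. indicator {y. \<phi> y = Suc k} y * g y) \<longlonglongrightarrow> g y"
      using first_return_in_Y_AE
    proof eventually_elim
      case (elim y)
      then have "\<forall>n\<ge>\<phi> y. (\<Sum>k<n. indicator {y. \<phi> y = Suc k} y * g y) = g y" by (simp add: eq)
      then have "\<forall>\<^sub>F n in sequentially. (\<Sum>k<n. indicator {y. \<phi> y = Suc k} y * g y) = g y"
        unfolding eventually_sequentially by blast
      then show ?case by (rule tendsto_eventually)
    qed
    show "AE y in N. norm (\<Sum>k<n. indicator {y. \<phi> y = Suc k} y * g y) \<le> \<bar>g y\<bar>" for n
      by (simp add: eq)
    show "integrable N (\<lambda>y. \<bar>g y\<bar>)" using g by simp
  qed measurable
  moreover have "(\<integral>y. (\<Sum>k<n. indicator {y. \<phi> y = Suc k} y * g y) \<partial>N) =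
      (\<Sum>k<n. (\<integral>y. indicator {y. \<phi> y = Suc k} y * g y \<partial>N))" for n
    by (rule Bochner_Integration.integral_sum) (rule int)
  ultimately show ?thesis unfolding sums_def by (simp only:)
qed

lemma N_measurable_extend:
  fixes w :: "'a \<Rightarrow> real"
  shows "w \<in> borel_measurable N \<Longrightarrow> (\<lambda>x. indicator Y x * w x) \<in> borel_measurable M"
  by (subst (asm) borel_measurable_restrict_space_iff) auto

lemma N_integrable_extend:
  fixes w :: "'a \<Rightarrow> real"
  shows "integrable N w \<longleftrightarrow> integrable M (\<lambda>x. indicator Y x * w x)"
  by (subst integrable_restrict_space) auto

lemma N_integral_extend:
  fixes w :: "'a \<Rightarrow> real"
  shows "(\<integral>y. w y \<partial>N) = (\<integral>x. indicator Y x * w x \<partial>M)"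
  by (subst integral_restrict_space) auto

text \<open>Test against the sign of the difference.\<close>

lemma AE_eq_by_duality:
  fixes g h :: "'a \<Rightarrow> real"
  assumes g: "integrable N g" and h: "integrable N h"
    and eq: "\<And>w. w \<in> borel_measurable N \<Longrightarrow> bounded (w ` Y) \<Longrightarrow> (\<integral>y. g y * w y \<partial>N) = (\<integral>y. h y * w y \<partial>N)"
  shows "AE y in N. g y = h y"
proof -
  have [measurable]: "g \<in> borel_measurable N" "h \<in> borel_measurable N" using g h by auto
  define w where "w y = sgn (g y - h y)" for y
  have w [measurable]: "w \<in> borel_measurable N" unfolding w_def[abs_def] by measurable
  have b: "\<bar>w y\<bar> \<le> 1" for y by (simp add: w_def sgn_if)
  then have "bounded (w ` Y)" by (intro boundedI[of _ 1]) auto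
  from eq[OF w this] have e: "(\<integral>y. g y * w y \<partial>N) = (\<integral>y. h y * w y \<partial>N)" .
  have bd: "\<bar>u * w y\<bar> \<le> \<bar>u\<bar>" for u y using mult_left_mono[OF b[of y], of "\<bar>u\<bar>"] by (simp add: abs_mult)
  have gw: "integrable N (\<lambda>y. g y * w y)" and hw: "integrable N (\<lambda>y. h y * w y)"
    by (rule Bochner_Integration.integrable_bound[OF g], use bd in auto)
       (rule Bochner_Integration.integrable_bound[OF h], use bd in auto)
  have "(\<integral>y. \<bar>g y - h y\<bar> \<partial>N) = (\<integral>y. g y * w y - h y * w y \<partial>N)"
    by (intro Bochner_Integration.integral_cong) (auto simp: w_def abs_sgn left_diff_distrib[symmetric])
  also have "\<dots> = 0" using gw hw e by simp
  finally have "(\<integral>y. \<bar>g y - h y\<bar> \<partial>N) = 0" .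
  then have "AE y in N. \<bar>g y - h y\<bar> = 0"
    using g h by (subst (asm) integral_nonneg_eq_0_iff_AE) auto
  then show ?thesis by simp
qed

end

locale first_return_operators = first_return M f Y
  for M :: "'a measure" and f :: "'a \<Rightarrow> 'a" and Y :: "'a set" +
  fixes L R :: "('a \<Rightarrow> real) \<Rightarrow> 'a \<Rightarrow> real" and \<iota> :: "'b::banach \<Rightarrow> 'a \<Rightarrow> real" and Rn :: "nat \<Rightarrow> 'b \<Rightarrow>\<^sub>L 'b"
  assumes L: "transfer_operator M f L" and R: "transfer_operator N F R"
    and \<iota>: "banach_subspace_Linf N \<iota>"
    and H1: "H1 M Y \<phi> R \<iota> Rn"
begin

lemma \<iota>_measurable [measurable]: "\<iota> v \<in> borel_measurable N"
  and \<iota>_add: "AE y in N. \<iota> (u + v) y = \<iota> u y + \<iota> v y"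
  and \<iota>_scale: "AE y in N. \<iota> (c *\<^sub>R v) y = c * \<iota> v y"
  and \<iota>_zero: "(AE y in N. \<iota> v y = 0) \<Longrightarrow> v = 0"
  and \<iota>_bound: "AE y in N. \<bar>\<iota> v y\<bar> \<le> norm v"
  using \<iota> by (auto simp: banach_subspace_Linf_def)

lemma \<iota>_integrable: "integrable N (\<iota> v)"
  by (rule N.integrable_const_bound[of _ "norm v"]) (use \<iota>_bound in auto)

lemma \<iota>_times_integrable: 
  assumes [measurable]: "w \<in> borel_measurable N" and "AE y in N. \<bar>w y\<bar> \<le> B"
  shows "integrable N (\<lambda>y. \<iota> v y * w y)"
proof (rule N.integrable_const_bound[of _ "norm v * B"])
  show "AE y in N. norm (\<iota> v y * w y) \<le> norm v * B"
    using \<iota>_bound[of v] assms(2)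
  proof eventually_elim
    case (elim y)
    then show ?case by (simp add: abs_mult mult_mono')
  qed
qed measurable

definition pr :: "'b \<Rightarrow> 'b \<Rightarrow> real" where "pr u v = (\<integral>y. \<iota> u y * \<iota> v y \<partial>N)"

text \<open>Only bounded functions enter, and the measure has total mass one.\<close>

lemma pr_bilinear: "bounded_bilinear pr"
proof
  note int = \<iota>_times_integrable[OF \<iota>_measurable \<iota>_bound]
  show add_left: "pr (a + a') b = pr a b + pr a' b" for a a' b
  proof -
    have "pr (a + a') b = (\<integral>y. \<iota> a y * \<iota> b y + \<iota> a' y * \<iota> b y \<partial>N)"
      unfolding pr_def using \<iota>_add[of a a'] by (intro integral_cong_AE) (auto simp: distrib_right)
    then show ?thesis using int by (simp add: pr_def)
  qed
  have sym: "pr a b = pr b a" for a b by (simp add: pr_def mult.commute)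
  show "pr a (b + b') = pr a b + pr a b'" for a b b' using add_left[of b b' a] by (simp add: sym[of a])
  show scale: "pr (r *\<^sub>R a) b = r *\<^sub>R pr a b" for r a b
  proof -
    have "pr (r *\<^sub>R a) b = (\<integral>y. r * (\<iota> a y * \<iota> b y) \<partial>N)"
      unfolding pr_def using \<iota>_scale[of r a] by (intro integral_cong_AE) auto
    then show ?thesis by (simp add: pr_def)
  qed
  show "pr a (r *\<^sub>R b) = r *\<^sub>R pr a b" for r a b using scale[of r b a] by (simp add: sym[of a])
  have "norm (pr a b) \<le> norm a * norm b * 1" for a b
  proof -
    have "norm (pr a b) \<le> (\<integral>y. norm a * norm b \<partial>N)" unfolding pr_def
    proof (rule order_trans[OF integral_norm_bound integral_mono_AE])
      show "AE y in N. norm (\<iota> a y * \<iota> b y) \<le> norm a * norm b"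
        using \<iota>_bound[of a] \<iota>_bound[of b] by eventually_elim (simp add: abs_mult mult_mono')
    qed (use int in auto)
    then show ?thesis by simp
  qed
  then show "\<exists>K. \<forall>a b. norm (pr a b) \<le> norm a * norm b * K" by blast
qed

lemma pr_definite: assumes "pr v v = 0" shows "v = 0"
proof (rule \<iota>_zero)
  have "AE y in N. \<iota> v y * \<iota> v y = 0"
    using assms \<iota>_times_integrable[OF \<iota>_measurable \<iota>_bound, of v v]
    unfolding pr_def by (subst (asm) integral_nonneg_eq_0_iff_AE) auto
  then show "AE y in N. \<iota> v y = 0" by simp
qed

lemma Rn_AE: "n \<ge> 1 \<Longrightarrow> AE y in N. \<iota> (Rn n v) y = R (\<lambda>y. indicator {y. \<phi> y = n} y * \<iota> v y) y"
  using H1 by (simp add: H1_def restricts_to_def represents_def R_fun_def)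

lemma Rn_duality:
  assumes n: "n \<ge> 1" and w [measurable]: "w \<in> borel_measurable N" "bounded (w ` Y)"
  shows "(\<integral>y. \<iota> (Rn n v) y * w y \<partial>N) = (\<integral>y. indicator {y. \<phi> y = n} y * (\<iota> v y * w (F y)) \<partial>N)"
proof -
  let ?u = "\<lambda>y. indicator {y. \<phi> y = n} y * \<iota> v y"
  have u: "integrable N ?u"
    by (rule Bochner_Integration.integrable_bound[OF \<iota>_integrable[of v]]) (auto simp: indicator_def)
  have Ru: "integrable N (R ?u)" and dual: "(\<integral>y. R ?u y * w y \<partial>N) = (\<integral>y. ?u y * w (F y) \<partial>N)"
    using R u w unfolding transfer_operator_def by auto
  have [measurable]: "R ?u \<in> borel_measurable N" using Ru by auto
  have "(\<integral>y. \<iota> (Rn n v) y * w y \<partial>N) = (\<integral>y. R ?u y * w y \<partial>N)"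
    using Rn_AE[OF n, of v] by (intro integral_cong_AE) auto
  also have "\<dots> = (\<integral>y. indicator {y. \<phi> y = n} y * (\<iota> v y * w (F y)) \<partial>N)" unfolding dual by (simp add: mult.assoc)
  finally show ?thesis .
qed

lemma L_funpow:
  assumes "integrable M v"
  shows "integrable M ((L ^^ n) v)"
    and "w \<in> borel_measurable M \<Longrightarrow> bounded (w ` space M) \<Longrightarrow>
      (\<integral>x. (L ^^ n) v x * w x \<partial>M) = (\<integral>x. v x * w ((f ^^ n) x) \<partial>M)"
proof -
  have *: "integrable M ((L ^^ n) v) \<and> (\<forall>w. w \<in> borel_measurable M \<longrightarrow> bounded (w ` space M) \<longrightarrow>
      (\<integral>x. (L ^^ n) v x * w x \<partial>M) = (\<integral>x. v x * w ((f ^^ n) x) \<partial>M))" for n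
  proof (induction n)
    case (Suc n)
    then have i: "integrable M ((L ^^ n) v)" by simp
    have "integrable M (L ((L ^^ n) v))" and d: "\<And>w. w \<in> borel_measurable M \<Longrightarrow> bounded (w ` space M) \<Longrightarrow>
        (\<integral>x. L ((L ^^ n) v) x * w x \<partial>M) = (\<integral>x. (L ^^ n) v x * w (f x) \<partial>M)"
      using L i unfolding transfer_operator_def by auto
    moreover have "(\<integral>x. (L ^^ n) v x * w (f x) \<partial>M) = (\<integral>x. v x * w ((f ^^ Suc n) x) \<partial>M)"
      if w [measurable]: "w \<in> borel_measurable M" and b: "bounded (w ` space M)" for w
    proof -
      have "(\<lambda>x. w (f x)) ` space M \<subseteq> w ` space M" using measurable_space[OF f_measurable] by auto
      then have "bounded ((\<lambda>x. w (f x)) ` space M)" using b bounded_subset by blast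
      then show ?thesis using Suc by simp
    qed
    ultimately show ?case by simp
  qed (use assms in simp)
  show "integrable M ((L ^^ n) v)" using * by blast
  show "w \<in> borel_measurable M \<Longrightarrow> bounded (w ` space M) \<Longrightarrow>
      (\<integral>x. (L ^^ n) v x * w x \<partial>M) = (\<integral>x. v x * w ((f ^^ n) x) \<partial>M)" using * by blast
qed

lemma T_integrable: "integrable N (T_fun L Y n (\<iota> v))"
proof -
  have "integrable M (\<lambda>x. indicator Y x * \<iota> v x)" using \<iota>_integrable N_integrable_extend by blast
  then have i: "integrable M ((L ^^ n) (\<lambda>x. indicator Y x * \<iota> v x))" by (rule L_funpow)
  have "integrable M (\<lambda>x. indicator Y x * (indicator Y x * (L ^^ n) (\<lambda>x. indicator Y x * \<iota> v x) x))"
  proof (rule Bochner_Integration.integrable_bound[OF i])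
    have [measurable]: "(L ^^ n) (\<lambda>x. indicator Y x * \<iota> v x) \<in> borel_measurable M" using i by auto
    show "(\<lambda>x. indicator Y x * (indicator Y x * (L ^^ n) (\<lambda>x. indicator Y x * \<iota> v x) x)) \<in> borel_measurable M"
      by measurable
  qed (auto simp: indicator_def)
  then show ?thesis by (simp add: N_integrable_extend T_fun_def)
qed

lemma T_duality:
  assumes w: "w \<in> borel_measurable N" "bounded (w ` Y)"
  shows "(\<integral>y. T_fun L Y n (\<iota> v) y * w y \<partial>N) = (\<integral>y. \<iota> v y * (indicator Y ((f ^^ n) y) * w ((f ^^ n) y)) \<partial>N)"
proof -
  let ?v = "\<lambda>x. indicator Y x * \<iota> v x" and ?w = "\<lambda>x. indicator Y x * w x"
  have v: "integrable M ?v" using \<iota>_integrable N_integrable_extend by blast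
  have wm: "?w \<in> borel_measurable M" using w(1) by (rule N_measurable_extend)
  obtain B where "\<And>y. y \<in> Y \<Longrightarrow> norm (w y) \<le> B" "0 \<le> B"
    using w(2) by (metis bounded_pos image_eqI less_imp_le)
  then have "bounded (?w ` space M)" by (intro boundedI[of _ B]) (auto simp: indicator_def)
  from L_funpow(2)[OF v wm this, of n]
  have "(\<integral>x. (L ^^ n) ?v x * ?w x \<partial>M) = (\<integral>x. ?v x * ?w ((f ^^ n) x) \<partial>M)" .
  moreover have "(\<integral>y. T_fun L Y n (\<iota> v) y * w y \<partial>N) = (\<integral>x. (L ^^ n) ?v x * ?w x \<partial>M)"
    unfolding N_integral_extend T_fun_def by (intro Bochner_Integration.integral_cong) (auto simp: indicator_def)
  ultimately show ?thesis unfolding N_integral_extend by (simp add: mult.assoc)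
qed

text \<open>Both sides are tested against a bounded function \<open>w\<close>. If \<open>f\<^sup>n y \<in> Y\<close> with \<open>n \<ge> 1\<close> then the return time
of \<open>y\<close> is some \<open>k \<le> n\<close>, and \<open>f\<^sup>n y = f\<^sup>n\<^sup>-\<^sup>k (F y)\<close>; the duality relation for \<open>R\<close> turns the part with
return time \<open>k\<close> into \<open>T\<^sub>n\<^sub>-\<^sub>k R\<^sub>k\<close>.\<close>

theorem T_eq_renewal: "AE y in N. \<iota> (renewal Rn n v) y = T_fun L Y n (\<iota> v) y"
proof (induction n arbitrary: v rule: less_induct)
  case (less n)
  show ?case
  proof (cases "n = 0")
    case True
    have "AE y in N. y \<in> space N" by (rule AE_space)
    then show ?thesis using True by (auto simp: renewal.simps[of Rn 0] T_fun_def indicator_def)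
  next
    case False
    have sum_AE: "AE y in N. \<iota> (\<Sum>k<m. g k) y = (\<Sum>k<m. \<iota> (g k) y)" for m :: nat and g
    proof (induction m)
      case 0
      show ?case using \<iota>_scale[of 0 0] by simp
    next
      case (Suc m)
      then show ?case using \<iota>_add[of "\<Sum>k<m. g k" "g m"] by eventually_elim simp
    qed
    have "AE y in N. \<forall>k\<in>{..<n}. \<iota> (renewal Rn (n - Suc k) (Rn (Suc k) v)) y = T_fun L Y (n - Suc k) (\<iota> (Rn (Suc k) v)) y"
      using less by (intro AE_finite_allI) auto
    then have A: "AE y in N. \<iota> (renewal Rn n v) y = (\<Sum>k<n. T_fun L Y (n - Suc k) (\<iota> (Rn (Suc k) v)) y)"
      using sum_AE[of "\<lambda>k. renewal Rn (n - Suc k) (Rn (Suc k) v)" n]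
    proof eventually_elim
      case (elim y)
      have "renewal Rn n v = (\<Sum>k<n. renewal Rn (n - Suc k) (Rn (Suc k) v))"
        using False by (subst renewal.simps) (simp add: blinfun.sum_left)
      with elim show ?case by simp
    qed
    have "AE y in N. (\<Sum>k<n. T_fun L Y (n - Suc k) (\<iota> (Rn (Suc k) v)) y) = T_fun L Y n (\<iota> v) y"
    proof (rule AE_eq_by_duality)
      fix w :: "'a \<Rightarrow> real" assume w: "w \<in> borel_measurable N" "bounded (w ` Y)"
      let ?w = "\<lambda>x. indicator Y x * w x"
      have wm [measurable]: "?w \<in> borel_measurable M" using w(1) by (rule N_measurable_extend)
      obtain B where B: "\<And>y. y \<in> Y \<Longrightarrow> norm (w y) \<le> B" "0 \<le> B"
        using w(2) by (metis bounded_pos image_eqI less_imp_le)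
      then have wB: "\<bar>?w x\<bar> \<le> B" for x by (auto simp: indicator_def)
      have comp [measurable]: "(\<lambda>y. ?w ((f ^^ m) y)) \<in> borel_measurable N" for m
        by (rule measurable_restrict_space1) measurable
      have int: "integrable N (\<lambda>y. \<iota> u y * ?w ((f ^^ m) y))" for u m
        using wB by (intro \<iota>_times_integrable[of _ B] comp) auto
      have bd: "bounded ((\<lambda>y. ?w ((f ^^ m) y)) ` Y)" for m using wB by (intro boundedI[of _ B]) auto
      have "(\<integral>y. (\<Sum>k<n. T_fun L Y (n - Suc k) (\<iota> (Rn (Suc k) v)) y) * w y \<partial>N) =
          (\<Sum>k<n. (\<integral>y. T_fun L Y (n - Suc k) (\<iota> (Rn (Suc k) v)) y * w y \<partial>N))"
      proof -
        have "integrable N (\<lambda>y. T_fun L Y m (\<iota> u) y * w y)" for m u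
        proof (rule Bochner_Integration.integrable_bound[OF integrable_mult_right[OF T_integrable, of B]])
          have "T_fun L Y m (\<iota> u) \<in> borel_measurable N" using T_integrable by auto
          then show "(\<lambda>y. T_fun L Y m (\<iota> u) y * w y) \<in> borel_measurable N" using w(1) by measurable
          show "AE y in N. norm (T_fun L Y m (\<iota> u) y * w y) \<le> norm (B * T_fun L Y m (\<iota> u) y)"
            using B by (intro AE_I2) (simp add: abs_mult mult.commute mult_right_mono)
        qed
        then show ?thesis unfolding sum_distrib_right by (intro Bochner_Integration.integral_sum)
      qed
      also have "\<dots> = (\<Sum>k<n. (\<integral>y. \<iota> (Rn (Suc k) v) y * ?w ((f ^^ (n - Suc k)) y) \<partial>N))"
        using T_duality[OF w] by simp
      also have "\<dots> = (\<Sum>k<n. (\<integral>y. indicator {y. \<phi> y = Suc k} y * (\<iota> v y * ?w ((f ^^ n) y)) \<partial>N))"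
      proof (rule sum.cong)
        fix k assume k: "k \<in> {..<n}"
        have "(\<integral>y. \<iota> (Rn (Suc k) v) y * ?w ((f ^^ (n - Suc k)) y) \<partial>N) =
            (\<integral>y. indicator {y. \<phi> y = Suc k} y * (\<iota> v y * ?w ((f ^^ (n - Suc k)) (F y))) \<partial>N)"
          by (rule Rn_duality[OF _ comp bd]) simp
        also have "\<dots> = (\<integral>y. indicator {y. \<phi> y = Suc k} y * (\<iota> v y * ?w ((f ^^ n) y)) \<partial>N)"
        proof (rule Bochner_Integration.integral_cong)
          fix y
          have "(f ^^ (n - Suc k)) (F y) = (f ^^ n) y" if "\<phi> y = Suc k"
          proof -
            have "n = (n - Suc k) + Suc k" using k by simp
            then have "(f ^^ n) y = (f ^^ (n - Suc k)) ((f ^^ Suc k) y)" by (metis comp_apply funpow_add)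
            then show ?thesis using that by (simp only: first_return_map_def)
          qed
          then show "indicator {y. \<phi> y = Suc k} y * (\<iota> v y * ?w ((f ^^ (n - Suc k)) (F y))) =
              indicator {y. \<phi> y = Suc k} y * (\<iota> v y * ?w ((f ^^ n) y))"
            by (cases "\<phi> y = Suc k") (simp_all only: indicator_simps mem_Collect_eq mult_zero_left simp_thms)
        qed simp
        finally show "(\<integral>y. \<iota> (Rn (Suc k) v) y * ?w ((f ^^ (n - Suc k)) y) \<partial>N) =
            (\<integral>y. indicator {y. \<phi> y = Suc k} y * (\<iota> v y * ?w ((f ^^ n) y)) \<partial>N)" .
      qed simp
      also have "\<dots> = (\<integral>y. (\<Sum>k<n. indicator {y. \<phi> y = Suc k} y * (\<iota> v y * ?w ((f ^^ n) y))) \<partial>N)"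
      proof (rule Bochner_Integration.integral_sum[symmetric])
        fix k
        show "integrable N (\<lambda>y. indicator {y. \<phi> y = Suc k} y * (\<iota> v y * ?w ((f ^^ n) y)))"
          by (rule Bochner_Integration.integrable_bound[OF int[of v n]]) (measurable, auto simp: indicator_def)
      qed
      also have "\<dots> = (\<integral>y. \<iota> v y * ?w ((f ^^ n) y) \<partial>N)"
      proof (rule integral_cong_AE)
        show "AE y in N. (\<Sum>k<n. indicator {y. \<phi> y = Suc k} y * (\<iota> v y * ?w ((f ^^ n) y))) = \<iota> v y * ?w ((f ^^ n) y)"
          using returns_AE
        proof eventually_elim
          case (elim y)
          let ?g = "\<iota> v y * ?w ((f ^^ n) y)"
          note \<phi> = return_time_eq_iff[OF elim, of "\<phi> y"]
          show ?case
          proof (cases "(f ^^ n) y \<in> Y")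
            case True
            then have "\<phi> y \<le> n" using \<phi> False by (meson linorder_not_le less_one)
            moreover have "\<phi> y \<ge> 1" using \<phi> by simp
            ultimately have k: "\<phi> y - 1 \<in> {..<n}" "Suc (\<phi> y - 1) = \<phi> y" by auto
            have "(\<Sum>k<n. indicator {y. \<phi> y = Suc k} y * ?g) = (\<Sum>k<n. if k = \<phi> y - 1 then ?g else 0)"
              using \<open>\<phi> y \<ge> 1\<close> by (intro sum.cong) (auto simp: indicator_def)
            then show ?thesis using k(1) by simp
          qed simp
        qed
      qed measurable
      also have "\<dots> = (\<integral>y. T_fun L Y n (\<iota> v) y * w y \<partial>N)" using T_duality[OF w] by simp
      finally show "(\<integral>y. (\<Sum>k<n. T_fun L Y (n - Suc k) (\<iota> (Rn (Suc k) v)) y) * w y \<partial>N) = \<dots>" .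
    qed (auto intro: T_integrable)
    with A show ?thesis by eventually_elim simp
  qed
qed

end

section \<open>Bounds for the renewal operators\<close>

lemma dyadic_block: "n \<ge> 1 \<Longrightarrow> \<exists>J. 2 ^ J \<le> n \<and> n < 2 ^ Suc J" for n :: nat
  using ex_power_ivl1[of 2 n] by auto

context regular_tail
begin

text \<open>Ratio test: consecutive terms have ratio tending to \<open>2\<^sup>\<beta>\<^sup>-\<^sup>1 < 1\<close>.\<close>

lemma summable_over_tail: "summable (\<lambda>i. (1/2) ^ i / \<tau> i)"
proof -
  have "(2::real) powr \<beta> < 2 powr 1" using \<beta> by (subst powr_less_cancel_iff) auto
  then have "(2::real) powr \<beta> / 2 < 1" by simp
  then obtain c where c: "2 powr \<beta> / 2 < c" "c < 1" using dense by blast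
  have "(\<lambda>j. \<tau> j / \<tau> (Suc j) / 2) \<longlonglongrightarrow> 2 powr \<beta> / 2" by (intro tendsto_intros \<tau>_ratio) simp
  from order_tendstoD(2)[OF this c(1)] obtain m where m: "\<And>j. j \<ge> m \<Longrightarrow> \<tau> j / \<tau> (Suc j) / 2 < c"
    by (auto simp: eventually_sequentially)
  show ?thesis
  proof (rule summable_ratio_test[OF c(2), of m])
    fix j assume j: "m \<le> j"
    have "(1/2) ^ Suc j / \<tau> (Suc j) = (\<tau> j / \<tau> (Suc j) / 2) * ((1/2) ^ j / \<tau> j)"
      using \<tau>_pos[of j] \<tau>_pos[of "Suc j"] by (simp add: field_simps)
    also have "\<dots> \<le> c * ((1/2) ^ j / \<tau> j)"
      using m[OF j] \<tau>_pos[of j] by (intro mult_right_mono) auto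
    finally show "norm ((1/2) ^ Suc j / \<tau> (Suc j)) \<le> c * norm ((1/2) ^ j / \<tau> j)"
      using \<tau>_pos[of j] \<tau>_pos[of "Suc j"] by simp
  qed
qed

text \<open>The ratio of consecutive terms tends to \<open>2\<^sup>2\<^sup>\<beta>\<^sup>-\<^sup>1\<close> here.\<close>

lemma summable_over_tail_squared:
  assumes "\<beta> < 1/2"
  shows "summable (\<lambda>i. (1/2) ^ i / (\<tau> i)\<^sup>2)"
proof -
  have "(2::real) powr (2 * \<beta>) < 2 powr 1" using assms by (subst powr_less_cancel_iff) auto
  moreover have "(2::real) powr (2 * \<beta>) = (2 powr \<beta>)\<^sup>2" by (simp add: power2_eq_square powr_add[symmetric])
  ultimately have "((2::real) powr \<beta>)\<^sup>2 / 2 < 1" by simp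
  then obtain c where c: "(2 powr \<beta>)\<^sup>2 / 2 < c" "c < 1" using dense by blast
  have "(\<lambda>j. (\<tau> j / \<tau> (Suc j))\<^sup>2 / 2) \<longlonglongrightarrow> (2 powr \<beta>)\<^sup>2 / 2" by (intro tendsto_intros \<tau>_ratio) simp
  from order_tendstoD(2)[OF this c(1)] obtain m where m: "\<And>j. j \<ge> m \<Longrightarrow> (\<tau> j / \<tau> (Suc j))\<^sup>2 / 2 < c"
    by (auto simp: eventually_sequentially)
  show ?thesis
  proof (rule summable_ratio_test[OF c(2), of m])
    fix j assume j: "m \<le> j"
    have "(1/2) ^ Suc j / (\<tau> (Suc j))\<^sup>2 = ((\<tau> j / \<tau> (Suc j))\<^sup>2 / 2) * ((1/2) ^ j / (\<tau> j)\<^sup>2)"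
      using \<tau>_pos[of j] \<tau>_pos[of "Suc j"] by (simp add: field_simps)
    also have "\<dots> \<le> c * ((1/2) ^ j / (\<tau> j)\<^sup>2)"
      using m[OF j] \<tau>_pos[of j] by (intro mult_right_mono) auto
    finally show "norm ((1/2) ^ Suc j / (\<tau> (Suc j))\<^sup>2) \<le> c * norm ((1/2) ^ j / (\<tau> j)\<^sup>2)"
      using \<tau>_pos[of j] \<tau>_pos[of "Suc j"] by simp
  qed
qed

lemma t_dyadic: "\<exists>D\<ge>1. \<forall>n J. n < 2 ^ Suc J \<longrightarrow> \<tau> J \<le> D * t n"
proof -
  obtain D where D: "D \<ge> 1" "\<And>j. \<tau> j \<le> D * \<tau> (Suc j)" using \<tau>_doubling by blast
  have "\<tau> J \<le> D * t n" if "n < 2 ^ Suc J" for n J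
  proof -
    have "\<tau> (Suc J) \<le> t n" unfolding \<tau>_def using that by (intro decseqD[OF t_dec]) simp
    then have "D * \<tau> (Suc J) \<le> D * t n" using D(1) by (intro mult_left_mono) auto
    with D(2)[of J] show ?thesis by linarith
  qed
  then show ?thesis using D(1) by blast
qed

end

context operator_renewal
begin

text \<open>This is the integral estimate with \<open>N\<^sub>i\<close> of order \<open>1/\<tau>\<^sub>i\<close>; by monotonicity and doubling, \<open>\<tau>\<^sub>J\<close> may be
replaced by \<open>t(n)\<close>.\<close>

theorem norm_renewal_le:
  "\<exists>D>0. \<forall>n J. 2 ^ J \<le> n \<longrightarrow> n < 2 ^ Suc J \<longrightarrow>
     norm (renewal Rn n) \<le> D * t n * (\<Sum>i\<le>J. (1/2) ^ i / (\<tau> i)\<^sup>2)"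
proof -
  obtain B where B: "B > 0" "\<And>y. resolvent_bounded y (\<lambda>j. B / \<tau> j * norm y)"
    using resolvent_bound by blast
  obtain D1 where D1: "D1 > 0" "\<And>v N n J. resolvent_bounded (v, 0) N \<Longrightarrow> 2 ^ J \<le> n \<Longrightarrow> n < 2 ^ Suc J \<Longrightarrow>
     norm (renewal Rn n v) \<le> D1 * \<tau> J * (\<Sum>i\<le>J. (1/2) ^ i * N i / \<tau> i)"
    using renewal_bound by blast
  obtain D2 where D2: "D2 \<ge> 1" "\<And>n J. n < 2 ^ Suc J \<Longrightarrow> \<tau> J \<le> D2 * t n" using t_dyadic by blast
  have "norm (renewal Rn n) \<le> (D1 * D2 * B) * t n * (\<Sum>i\<le>J. (1/2) ^ i / (\<tau> i)\<^sup>2)"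
    if n: "2 ^ J \<le> n" "n < 2 ^ Suc J" for n J
  proof (rule norm_blinfun_bound)
    let ?S = "\<Sum>i\<le>J. (1/2) ^ i / (\<tau> i)\<^sup>2"
    have S: "0 \<le> ?S" by (intro sum_nonneg) auto
    show "0 \<le> (D1 * D2 * B) * t n * ?S"
      using D1(1) D2(1) B(1) S t_pos[of n] by (intro mult_nonneg_nonneg) auto
    fix v :: 'b
    have nv: "norm (v, 0 :: 'b) = norm v" by (simp add: norm_Pair)
    have "norm (renewal Rn n v) \<le> D1 * \<tau> J * (\<Sum>i\<le>J. (1/2) ^ i * (B / \<tau> i * norm v) / \<tau> i)"
      using D1(2)[OF B(2) n, of v] unfolding nv .
    also have "(\<Sum>i\<le>J. (1/2) ^ i * (B / \<tau> i * norm v) / \<tau> i) = B * norm v * ?S"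
      unfolding sum_distrib_left by (intro sum.cong) (auto simp: power2_eq_square)
    also have "D1 * \<tau> J * (B * norm v * ?S) \<le> D1 * (D2 * t n) * (B * norm v * ?S)"
      using D1(1) B(1) S D2(2)[OF n(2)] by (intro mult_right_mono mult_left_mono) auto
    finally show "norm (renewal Rn n v) \<le> (D1 * D2 * B) * t n * ?S * norm v" by (simp add: ac_simps)
  qed
  then show ?thesis using D1(1) D2(1) B(1) by (intro exI[of _ "D1 * D2 * B"]) auto
qed

text \<open>For mean zero \<open>N\<^sub>i\<close> is constant, so only one factor \<open>1/\<tau>\<^sub>i\<close> remains in the sum, and it converges.\<close>

theorem norm_renewal_mean_zero_le:
  "\<exists>D>0. \<forall>v n. pr v e = 0 \<longrightarrow> 1 \<le> n \<longrightarrow> norm (renewal Rn n v) \<le> D * norm v * t n"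
proof -
  obtain B where B: "B > 0" "\<And>y. cpr e y = 0 \<Longrightarrow> resolvent_bounded y (\<lambda>_. B * norm y)"
    using resolvent_bound by blast
  obtain D1 where D1: "D1 > 0" "\<And>v N n J. resolvent_bounded (v, 0) N \<Longrightarrow> 2 ^ J \<le> n \<Longrightarrow> n < 2 ^ Suc J \<Longrightarrow>
     norm (renewal Rn n v) \<le> D1 * \<tau> J * (\<Sum>i\<le>J. (1/2) ^ i * N i / \<tau> i)"
    using renewal_bound by blast
  obtain D2 where D2: "D2 \<ge> 1" "\<And>n J. n < 2 ^ Suc J \<Longrightarrow> \<tau> J \<le> D2 * t n" using t_dyadic by blast
  define S where "S = (\<Sum>i. (1/2) ^ i / \<tau> i)"
  have S0: "0 \<le> (1/2) ^ i / \<tau> i" for i using \<tau>_pos[of i] by simp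
  have S: "(\<Sum>i\<le>J. (1/2) ^ i / \<tau> i) \<le> S" for J
    unfolding S_def using S0 by (intro sum_le_suminf summable_over_tail) auto
  have "0 < 1 / \<tau> 0" using \<tau>_pos[of 0] by simp
  moreover have "1 / \<tau> 0 \<le> S" using S[of 0] by simp
  ultimately have Spos: "0 < S" by linarith
  have "norm (renewal Rn n v) \<le> (D1 * D2 * B * S) * norm v * t n"
    if v: "pr v e = 0" and n: "1 \<le> n" for n v
  proof -
    obtain J where J: "2 ^ J \<le> n" "n < 2 ^ Suc J" using dyadic_block[OF n] by blast
    have nv: "norm (v, 0 :: 'b) = norm v" by (simp add: norm_Pair)
    have cv: "cpr e (v, 0) = 0" using v by (simp add: cpr_def pr.zero_left complex_eq_iff)
    have "norm (renewal Rn n v) \<le> D1 * \<tau> J * (\<Sum>i\<le>J. (1/2) ^ i * (B * norm v) / \<tau> i)"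
      using D1(2)[OF B(2)[OF cv] J] unfolding nv .
    also have "(\<Sum>i\<le>J. (1/2) ^ i * (B * norm v) / \<tau> i) = B * norm v * (\<Sum>i\<le>J. (1/2) ^ i / \<tau> i)"
      unfolding sum_distrib_left by (intro sum.cong) auto
    also have "D1 * \<tau> J * (B * norm v * (\<Sum>i\<le>J. (1/2) ^ i / \<tau> i)) \<le> D1 * (D2 * t n) * (B * norm v * S)"
      using D1(1) D2(1) B(1) S D2(2)[OF J(2)] S0 t_pos[of n]
      by (intro mult_mono mult_left_mono mult_nonneg_nonneg sum_nonneg) auto
    finally show ?thesis by (simp add: ac_simps)
  qed
  then show ?thesis using D1(1) D2(1) B(1) Spos by (intro exI[of _ "D1 * D2 * B * S"]) auto
qed

end

context first_return_operators
begin

abbreviation tail :: "nat \<Rightarrow> real" where "tail n \<equiv> measure M {y \<in> Y. \<phi> y > n}"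

lemma measure_N_eq: "A \<subseteq> Y \<Longrightarrow> measure N A = measure M A"
  by (rule measure_restrict_space) auto

lemma integral_indicator_N: "(\<integral>y. indicator {y. \<phi> y = k} y \<partial>N) = measure M {y \<in> Y. \<phi> y = k}"
proof -
  have "(\<integral>y. indicator {y. \<phi> y = k} y \<partial>N) = (\<integral>y. indicator {y \<in> Y. \<phi> y = k} y \<partial>N :: real)"
    by (intro Bochner_Integration.integral_cong) (auto simp: indicator_def)
  also have "\<dots> = measure N ({y \<in> Y. \<phi> y = k} \<inter> space N)" by (rule Bochner_Integration.integral_indicator)
  also have "\<dots> = measure M {y \<in> Y. \<phi> y = k}" by (subst measure_N_eq) (auto intro: arg_cong[where f="measure M"])
  finally show ?thesis .
qed

lemma level_set_N [measurable]: "{y \<in> Y. P (\<phi> y)} \<in> sets N"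
proof -
  have "{y \<in> space N. P (\<phi> y)} \<in> sets N" by measurable
  then show ?thesis by simp
qed

lemma tail_0: "tail 0 = 1"
proof -
  have "AE y in N. (y \<in> {y \<in> Y. \<phi> y > 0}) = (y \<in> Y)"
    using first_return_in_Y_AE by eventually_elim auto
  then have "measure N {y \<in> Y. \<phi> y > 0} = measure N Y" 
    by (rule measure_eq_AE) (use sets.top[of N] in auto)
  then show ?thesis by (simp add: measure_N_eq)
qed

lemma tail_diff: "tail k - tail (Suc k) = measure M {y \<in> Y. \<phi> y = Suc k}"
proof -
  have "measure N ({y \<in> Y. \<phi> y > Suc k} \<union> {y \<in> Y. \<phi> y = Suc k}) = measure N {y \<in> Y. \<phi> y > Suc k} + measure N {y \<in> Y. \<phi> y = Suc k}"
    by (rule N.finite_measure_Union) auto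
  moreover have "{y \<in> Y. \<phi> y > Suc k} \<union> {y \<in> Y. \<phi> y = Suc k} = {y \<in> Y. \<phi> y > k}" by auto
  ultimately show ?thesis by (simp add: measure_N_eq)
qed

lemma tail_decseq: "decseq tail"
proof (rule decseq_SucI)
  show "tail (Suc n) \<le> tail n" for n
    using tail_diff[of n] measure_nonneg[of M "{y \<in> Y. \<phi> y = Suc n}"] by linarith
qed

lemma tail_lim: "tail \<longlonglongrightarrow> 0"
proof -
  have "(\<lambda>k. (\<integral>y. indicator {y. \<phi> y = Suc k} y * (1::real) \<partial>N)) sums (\<integral>y. 1 \<partial>N)"
    by (rule partition_sums) simp
  moreover have "(\<integral>y. (1 :: real) \<partial>N) = 1" by simp
  ultimately have "(\<lambda>k. tail k - tail (Suc k)) sums 1" by (simp only: mult_1_right integral_indicator_N tail_diff)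
  then have "(\<lambda>n. \<Sum>k<n. tail k - tail (Suc k)) \<longlonglongrightarrow> 1" by (simp add: sums_def)
  moreover have "(\<Sum>k<n. tail k - tail (Suc k)) = 1 - tail n" for n
    by (rule trans[OF sum_lessThan_telescope'[of "\<lambda>n. tail n" n]]) (simp only: tail_0)
  ultimately have "(\<lambda>n. 1 - tail n) \<longlonglongrightarrow> 1" by simp
  from tendsto_diff[OF tendsto_const[of 1] this] show ?thesis by simp
qed

text \<open>The one property that is not immediate is that \<open>\<Sum>\<^sub>k R\<^sub>k e = e\<close>. The difference \<open>d\<close> of the two sides is
paired with itself: \<open>\<Sum>\<^sub>k \<integral> R\<^sub>k e \<cdot> d = \<Sum>\<^sub>k \<integral>\<^bsub>\<phi> = k\<^esub> d \<circ> F = \<integral> d \<circ> F = \<integral> d\<close>, since the first return map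
preserves the measure, and \<open>\<integral> d\<close> is also the pairing of \<open>e\<close> with \<open>d\<close>.\<close>

lemma operator_renewal_first_return:
  assumes rt: "regular_tail tail \<beta>" and e: "AE y in N. \<iota> e y = 1" and H2: "H2 Rn"
    and C: "C > 0" "\<And>n. n \<ge> 1 \<Longrightarrow> norm (Rn n) \<le> C * measure M {y \<in> Y. \<phi> y = n}"
  shows "operator_renewal tail \<beta> Rn pr e C"
proof -
  interpret RT: regular_tail tail \<beta> by (rule rt)
  have p: "RT.p (Suc n) = measure M {y \<in> Y. \<phi> y = Suc n}" for n by (simp add: RT.p_def tail_diff)
  have pr_e: "pr v e = (\<integral>y. \<iota> v y \<partial>N)" for v
    unfolding pr_def using e by (intro integral_cong_AE) auto
  have pr_Rn: "pr (Rn (Suc n) v) e = (\<integral>y. indicator {y. \<phi> y = Suc n} y * \<iota> v y \<partial>N)" for n v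
  proof -
    have "bounded ((\<lambda>_. 1 :: real) ` Y)" by (intro boundedI[of _ 1]) auto
    then show ?thesis unfolding pr_e using Rn_duality[of "Suc n" "\<lambda>_. 1" v] by simp
  qed
  have pr_Rn_e: "pr (Rn (Suc n) e) e = RT.p (Suc n)" for n
  proof -
    have "pr (Rn (Suc n) e) e = (\<integral>y. indicator {y. \<phi> y = Suc n} y \<partial>N)"
      unfolding pr_Rn using e by (intro integral_cong_AE) auto
    then show ?thesis by (simp only: integral_indicator_N p)
  qed
  have "summable (\<lambda>n. C * RT.p (Suc n))"
    using RT.p_summable by (intro summable_mult) (simp add: summable_Suc_iff)
  then have "summable (\<lambda>n. norm (Rn (Suc n) e))"
  proof (rule summable_comparison_test'[OF summable_mult2[of _ "norm e"]])
    fix n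
    show "norm (norm (Rn (Suc n) e)) \<le> C * RT.p (Suc n) * norm e"
      using order_trans[OF norm_blinfun mult_right_mono[OF C(2)[of "Suc n"]]] p by simp
  qed
  then have sm: "summable (\<lambda>n. Rn (Suc n) e)" by (rule summable_norm_cancel)
  have "(\<Sum>n. Rn (Suc n) e) - e = 0"
  proof (rule pr_definite)
    let ?d = "(\<Sum>n. Rn (Suc n) e) - e"
    \<comment> \<open>test functions must be bounded everywhere, not just almost everywhere, hence the truncation\<close>
    define w where "w y = max (- norm ?d) (min (norm ?d) (\<iota> ?d y))" for y
    have w [measurable]: "w \<in> borel_measurable N" unfolding w_def[abs_def] by measurable
    have wb: "\<bar>w y\<bar> \<le> norm ?d" for y unfolding w_def by (auto simp: abs_le_iff)
    have w_AE: "AE y in N. \<iota> ?d y = w y"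
      using \<iota>_bound[of ?d] by eventually_elim (auto simp: w_def abs_le_iff)
    have pr_w: "pr v ?d = (\<integral>y. \<iota> v y * w y \<partial>N)" for v
      unfolding pr_def using w_AE by (intro integral_cong_AE) auto
    let ?w = "\<lambda>x. indicator Y x * w x"
    have wM [measurable]: "?w \<in> borel_measurable M" by (rule N_measurable_extend) (rule w)
    have "pr (Rn (Suc n) e) ?d = (\<integral>y. indicator {y. \<phi> y = Suc n} y * ?w (F y) \<partial>N)" for n
    proof -
      have "pr (Rn (Suc n) e) ?d = (\<integral>y. \<iota> (Rn (Suc n) e) y * ?w y \<partial>N)"
        unfolding pr_w by (intro Bochner_Integration.integral_cong) auto
      also have "\<dots> = (\<integral>y. indicator {y. \<phi> y = Suc n} y * (\<iota> e y * ?w (F y)) \<partial>N)"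
      proof (rule Rn_duality)
        show "?w \<in> borel_measurable N" by (rule measurable_restrict_space1) measurable
        show "bounded (?w ` Y)" using wb by (intro boundedI[of _ "norm ?d"]) auto
      qed simp
      also have "\<dots> = (\<integral>y. indicator {y. \<phi> y = Suc n} y * ?w (F y) \<partial>N)"
        using e by (intro integral_cong_AE) auto
      finally show ?thesis .
    qed
    moreover have "(\<lambda>n. (\<integral>y. indicator {y. \<phi> y = Suc n} y * ?w (F y) \<partial>N)) sums (\<integral>y. ?w (F y) \<partial>N)"
    proof (rule partition_sums)
      show "integrable N (\<lambda>y. ?w (F y))"
      proof (rule N.integrable_const_bound[of _ "norm ?d"])
        show "AE y in N. norm (?w (F y)) \<le> norm ?d" using wb by (auto simp: indicator_def)
        show "(\<lambda>y. ?w (F y)) \<in> borel_measurable N"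
          by (rule measurable_compose[OF first_return_map_measurable_N wM])
      qed
    qed
    moreover have "(\<integral>y. ?w (F y) \<partial>N) = pr e ?d"
    proof -
      have "(\<integral>y. ?w (F y) \<partial>N) = (\<integral>y. ?w y \<partial>N)" by (rule integral_first_return) (rule wM)
      also have "\<dots> = (\<integral>y. \<iota> e y * w y \<partial>N)"
      proof (rule integral_cong_AE)
        show "AE y in N. ?w y = \<iota> e y * w y" using e AE_space[of N] by eventually_elim simp
        show "?w \<in> borel_measurable N" by (rule measurable_restrict_space1[OF wM])
        show "(\<lambda>y. \<iota> e y * w y) \<in> borel_measurable N" by measurable
      qed
      finally show ?thesis by (simp add: pr_w)
    qed
    ultimately have 1: "(\<lambda>n. pr (Rn (Suc n) e) ?d) sums pr e ?d" by simp
    have "(\<lambda>n. pr (Rn (Suc n) e) ?d) sums pr (\<Sum>n. Rn (Suc n) e) ?d"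
      by (rule bounded_linear.sums[OF bounded_bilinear.bounded_linear_left[OF pr_bilinear] summable_sums[OF sm]])
    from sums_unique2[OF this 1] have "pr (\<Sum>n. Rn (Suc n) e) ?d = pr e ?d" .
    then show "pr ?d ?d = 0" using bounded_bilinear.diff_left[OF pr_bilinear] by simp
  qed
  then have R_e: "(\<lambda>n. Rn (Suc n) e) sums e" using summable_sums[OF sm] by simp
  show ?thesis
  proof (intro operator_renewal.intro operator_renewal_axioms.intro rt pr_bilinear pr_definite C(1) H2 R_e pr_Rn_e)
    have "(\<integral>y. \<iota> e y \<partial>N) = (\<integral>y. 1 \<partial>N)" using e by (intro integral_cong_AE) auto
    then show "pr e e = 1" by (simp add: pr_e)
    show "norm (Rn (Suc n)) \<le> C * RT.p (Suc n)" for n using C(2)[of "Suc n"] p by simp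
    show "(\<lambda>n. pr (Rn (Suc n) v) e) sums pr v e" for v
      unfolding pr_Rn unfolding pr_e by (rule partition_sums[OF \<iota>_integrable])
  qed
qed

end

section \<open>The bound at exponent one half\<close>

text \<open>For Lebesgue measurable functions composition with \<open>\<theta> \<mapsto> 1/\<theta>\<close> needs an argument: the map is its own
inverse, so preimages are images under a differentiable map, and these are measurable.\<close>

lemma lebesgue_on_inverse_measurable:
  fixes l :: "real \<Rightarrow> real"
  assumes l: "l \<in> borel_measurable (lebesgue_on {0<..})"
  shows "(\<lambda>\<theta>. l (1 / \<theta>)) \<in> borel_measurable (lebesgue_on {0<..})"
proof (rule borel_measurableI)
  fix S :: "real set" assume "open S"
  then have "l -` S \<inter> {0<..} \<in> sets (lebesgue_on {0<..})"
    using measurable_sets[OF l, of S] by simp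
  then have "l -` S \<inter> {0<..} \<in> sets lebesgue" by (subst (asm) sets_restrict_space_iff) auto
  then have "(\<lambda>x. 1 / x) ` (l -` S \<inter> {0<..}) \<in> sets lebesgue"
    by (rule differentiable_image_in_sets_lebesgue)
       (auto intro!: differentiable_at_withinI derivative_intros simp: differentiable_on_def)
  moreover have "(\<lambda>x. 1 / x) ` (l -` S \<inter> {0<..}) = (\<lambda>\<theta>. l (1 / \<theta>)) -` S \<inter> {0<..}"
    by (force simp: image_iff intro!: bexI[of _ "1 / _"])
  ultimately show "(\<lambda>\<theta>. l (1 / \<theta>)) -` S \<inter> space (lebesgue_on {0<..}) \<in> sets (lebesgue_on {0<..})"
    by (subst sets_restrict_space_iff) auto
qed

lemma nn_integral_lebesgue_scale:
  fixes H :: "real \<Rightarrow> ennreal"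
  assumes H: "H \<in> borel_measurable lebesgue" and c: "c > 0"
  shows "(\<integral>\<^sup>+ s. ennreal c * H (c * s) \<partial>lebesgue) = (\<integral>\<^sup>+ \<theta>. H \<theta> \<partial>lebesgue)"
    and "(\<lambda>s. H (c * s)) \<in> borel_measurable lebesgue"
proof -
  have T: "(\<lambda>x. 0 + c * x) \<in> lebesgue \<rightarrow>\<^sub>M lebesgue"
    using lebesgue_affine_measurable[of "\<lambda>_. c" "0 :: real"] c by simp
  show m: "(\<lambda>s. H (c * s)) \<in> borel_measurable lebesgue" using measurable_compose[OF T H] by simp
  have "(\<integral>\<^sup>+ \<theta>. H \<theta> \<partial>lebesgue) = (\<integral>\<^sup>+ \<theta>. H \<theta> \<partial>density (distr lebesgue lebesgue (\<lambda>x. 0 + c * x)) (\<lambda>_. ennreal \<bar>c\<bar>))"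
    using lebesgue_real_affine[of c 0] c by simp
  also have "\<dots> = (\<integral>\<^sup>+ \<theta>. ennreal \<bar>c\<bar> * H \<theta> \<partial>distr lebesgue lebesgue (\<lambda>x. 0 + c * x))"
    using H by (intro nn_integral_density) auto
  also have "\<dots> = (\<integral>\<^sup>+ s. ennreal \<bar>c\<bar> * H (0 + c * s) \<partial>lebesgue)"
    using H by (intro nn_integral_distr T) auto
  finally show "(\<integral>\<^sup>+ s. ennreal c * H (c * s) \<partial>lebesgue) = (\<integral>\<^sup>+ \<theta>. H \<theta> \<partial>lebesgue)" using c by simp
qed

text \<open>The integrand of the bound at \<open>\<beta> = 1/2\<close>, extended-valued as there.\<close>

definition kernel :: "(real \<Rightarrow> real) \<Rightarrow> real \<Rightarrow> ennreal" where
  "kernel l \<theta> = ennreal (1 / ((l (1 / \<theta>))\<^sup>2 * \<theta>))"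

lemma kernel_measurable:
  assumes "l \<in> borel_measurable (lebesgue_on {0<..})" and A: "A \<in> sets lebesgue" "A \<subseteq> {0<..}"
  shows "(\<lambda>\<theta>. kernel l \<theta> * indicator A \<theta>) \<in> borel_measurable lebesgue"
proof -
  have id: "(\<lambda>\<theta>. \<theta>) \<in> borel_measurable (lebesgue_on {0 :: real<..})"
    by (intro measurable_restrict_space1 measurable_completion) simp
  have [measurable]: "(\<lambda>\<theta>. l (1 / \<theta>)) \<in> borel_measurable (lebesgue_on {0<..})"
    using assms(1) by (rule lebesgue_on_inverse_measurable)
  have "kernel l \<in> borel_measurable (lebesgue_on {0<..})"
    unfolding kernel_def[abs_def] using id by measurable
  then have "(\<lambda>\<theta>. kernel l \<theta> * indicator {0<..} \<theta>) \<in> borel_measurable lebesgue"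
    by (subst (asm) borel_measurable_restrict_space_iff_ennreal) auto
  then have "(\<lambda>\<theta>. kernel l \<theta> * indicator {0<..} \<theta> * indicator A \<theta>) \<in> borel_measurable lebesgue"
    using A(1) by measurable
  moreover have "kernel l \<theta> * indicator {0<..} \<theta> * indicator A \<theta> = kernel l \<theta> * indicator A \<theta>" for \<theta>
    using A(2) by (auto simp: indicator_def)
  ultimately show ?thesis by simp
qed

definition dyadic :: "nat \<Rightarrow> real set" where "dyadic j = {(1/2) ^ Suc j<..(1/2) ^ j}"

lemma dyadic_pos: "dyadic j \<subseteq> {0<..}"
proof
  fix x assume x: "x \<in> dyadic j"
  have "0 < (1/2 :: real) ^ Suc j" by simp
  also have "\<dots> < x" using x by (simp add: dyadic_def)
  finally show "x \<in> {0<..}" by simp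
qed

lemma dyadic_disjoint: "i < j \<Longrightarrow> dyadic i \<inter> dyadic j = {}"
proof -
  assume "i < j"
  then have "(1/2 :: real) ^ j \<le> (1/2) ^ Suc i" by (intro power_decreasing) auto
  then show ?thesis by (auto simp: dyadic_def)
qed

text \<open>After scaling the block to \<open>(1/2, 1]\<close> the integrand becomes \<open>(\<ell>(2\<^sup>j) / \<ell>(2\<^sup>j/s))\<^sup>2 / s\<close>, which tends
pointwise to \<open>1/s \<ge> 1\<close> by slow variation. Fatou's lemma turns this into the lower bound.\<close>

lemma dyadic_integral_ge:
  assumes l: "slowly_varying l"
  shows "\<forall>\<^sub>F j in sequentially. ennreal (1 / 4) \<le> ennreal ((l (2 ^ j))\<^sup>2) * (\<integral>\<^sup>+ \<theta>. kernel l \<theta> * indicator (dyadic j) \<theta> \<partial>lebesgue)"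
proof -
  have lm: "l \<in> borel_measurable (lebesgue_on {0<..})" and lpos: "\<And>x. x > 0 \<Longrightarrow> l x > 0"
    and lsv: "\<And>c. c > 0 \<Longrightarrow> ((\<lambda>x. l (c * x) / l x) \<longlongrightarrow> 1) at_top"
    using l by (auto simp: slowly_varying_def)
  define H where "H j \<theta> = kernel l \<theta> * indicator (dyadic j) \<theta>" for j \<theta>
  have H: "H j \<in> borel_measurable lebesgue" for j
    unfolding H_def[abs_def] using lm by (rule kernel_measurable) (use dyadic_pos in \<open>auto simp: dyadic_def\<close>)
  define u where "u j s = ennreal ((l (2 ^ j))\<^sup>2) * (ennreal ((1/2) ^ j) * H j ((1/2) ^ j * s))" for j s
  have u: "u j \<in> borel_measurable lebesgue" for j
    unfolding u_def[abs_def] using nn_integral_lebesgue_scale(2)[OF H, of "(1/2) ^ j" j] by measurable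
  have int_u: "(\<integral>\<^sup>+ s. u j s \<partial>lebesgue) = ennreal ((l (2 ^ j))\<^sup>2) * (\<integral>\<^sup>+ \<theta>. H j \<theta> \<partial>lebesgue)" for j
  proof -
    have "(\<lambda>s. ennreal ((1/2) ^ j) * H j ((1/2) ^ j * s)) \<in> borel_measurable lebesgue"
      using nn_integral_lebesgue_scale(2)[OF H, of "(1/2) ^ j" j] by measurable
    then show ?thesis
      unfolding u_def using nn_integral_lebesgue_scale(1)[OF H, of "(1/2) ^ j" j] by (subst nn_integral_cmult) auto
  qed
  have liminf: "indicator {1/2<..1} s \<le> liminf (\<lambda>j. u j s)" for s :: real
  proof (cases "s \<in> {1/2<..1}")
    case True
    then have s: "1/2 < s" "s \<le> 1" by auto
    have mem: "(1/2) ^ j * s \<in> dyadic j" for j using s by (simp add: dyadic_def)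
    have "u j s = ennreal ((1 / (l ((1/s) * 2 ^ j) / l (2 ^ j)))\<^sup>2 / s)" for j
    proof -
      have arg: "1 / ((1/2) ^ j * s) = (1/s) * 2 ^ j" using s by (simp add: power_one_over field_simps)
      have lp: "0 < l (2 ^ j)" "0 < l ((1/s) * 2 ^ j)" using s by (auto intro!: lpos)
      have gen: "ennreal a * (ennreal b * ennreal q) = ennreal (a * (b * q))" if "0 \<le> a" "0 \<le> b" "0 \<le> q" for a b q :: real
        using that by (simp add: ennreal_mult)
      have "H j ((1/2) ^ j * s) = ennreal (1 / ((l ((1/s) * 2 ^ j))\<^sup>2 * ((1/2) ^ j * s)))"
        unfolding H_def kernel_def arg using mem[of j] by simp
      then have "u j s = ennreal ((l (2 ^ j))\<^sup>2) * (ennreal ((1/2) ^ j) * ennreal (1 / ((l ((1/s) * 2 ^ j))\<^sup>2 * ((1/2) ^ j * s))))"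
        by (simp only: u_def)
      also have "\<dots> = ennreal ((l (2 ^ j))\<^sup>2 * ((1/2) ^ j * (1 / ((l ((1/s) * 2 ^ j))\<^sup>2 * ((1/2) ^ j * s)))))"
        by (rule gen) (use s in auto)
      also have "(l (2 ^ j))\<^sup>2 * ((1/2) ^ j * (1 / ((l ((1/s) * 2 ^ j))\<^sup>2 * ((1/2) ^ j * s)))) = (1 / (l ((1/s) * 2 ^ j) / l (2 ^ j)))\<^sup>2 / s"
        using s lp by (simp add: power_divide field_simps)
      finally show ?thesis .
    qed
    moreover have "(\<lambda>j. ennreal ((1 / (l ((1/s) * 2 ^ j) / l (2 ^ j)))\<^sup>2 / s)) \<longlonglongrightarrow> ennreal ((1 / 1)\<^sup>2 / s)"
    proof (intro tendsto_ennrealI tendsto_divide tendsto_power tendsto_const)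
      have "filterlim (\<lambda>j::nat. (2 :: real) ^ j) at_top sequentially" 
        using filterlim_real_sequentially by (rule filterlim_at_top_mono) (simp add: less_imp_le[OF of_nat_less_two_power])
      then show "(\<lambda>j. l ((1/s) * 2 ^ j) / l (2 ^ j)) \<longlonglongrightarrow> 1"
        using filterlim_compose[OF lsv[of "1/s"]] s by simp
    qed (use s in auto)
    ultimately have "(\<lambda>j. u j s) \<longlonglongrightarrow> ennreal (1 / s)" by simp
    then have "liminf (\<lambda>j. u j s) = ennreal (1 / s)" by (intro lim_imp_Liminf) auto
    moreover have "ennreal 1 \<le> ennreal (1 / s)" using s by (intro ennreal_leI) simp
    ultimately show ?thesis using True by simp
  qed simp
  have "ennreal (1/2) = (\<integral>\<^sup>+ s. indicator {1/2<..1::real} s \<partial>lebesgue)" by simp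
  also have "\<dots> \<le> (\<integral>\<^sup>+ s. liminf (\<lambda>j. u j s) \<partial>lebesgue)" by (intro nn_integral_mono liminf)
  also have "\<dots> \<le> liminf (\<lambda>j. \<integral>\<^sup>+ s. u j s \<partial>lebesgue)" by (rule nn_integral_liminf) (rule u)
  finally have "ennreal (1/2) \<le> liminf (\<lambda>j. \<integral>\<^sup>+ s. u j s \<partial>lebesgue)" .
  moreover have "ennreal (1/4) < ennreal (1/2)" by (rule ennreal_lessI) simp_all
  ultimately have "ennreal (1/4) < liminf (\<lambda>j. \<integral>\<^sup>+ s. u j s \<partial>lebesgue)" by (rule less_le_trans[rotated])
  then have "\<forall>\<^sub>F j in sequentially. ennreal (1/4) < (\<integral>\<^sup>+ s. u j s \<partial>lebesgue)" by (rule less_LiminfD)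
  then show ?thesis by eventually_elim (simp add: int_u H_def)
qed

lemma sum_dyadic_integrals_le:
  assumes l: "slowly_varying l" and n: "2 ^ J \<le> n"
  shows "(\<Sum>j<J. (\<integral>\<^sup>+ \<theta>. kernel l \<theta> * indicator (dyadic j) \<theta> \<partial>lebesgue)) \<le>
    (\<integral>\<^sup>+ \<theta> \<in> {1 / real n..pi}. kernel l \<theta> \<partial>lebesgue)"
proof -
  have lm: "l \<in> borel_measurable (lebesgue_on {0<..})" using l by (simp add: slowly_varying_def)
  have "(\<Sum>j<J. (\<integral>\<^sup>+ \<theta>. kernel l \<theta> * indicator (dyadic j) \<theta> \<partial>lebesgue)) =
      (\<integral>\<^sup>+ \<theta>. (\<Sum>j<J. kernel l \<theta> * indicator (dyadic j) \<theta>) \<partial>lebesgue)"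
    by (rule nn_integral_sum[symmetric], rule kernel_measurable[OF lm]) (use dyadic_pos in \<open>auto simp: dyadic_def\<close>)
  also have "\<dots> \<le> (\<integral>\<^sup>+ \<theta> \<in> {1 / real n..pi}. kernel l \<theta> \<partial>lebesgue)"
  proof (rule nn_integral_mono)
    fix \<theta> :: real
    have "(\<Sum>j<J. indicator (dyadic j) \<theta> :: ennreal) = indicator (\<Union>j<J. dyadic j) \<theta>"
      by (rule indicator_UN_disjoint[symmetric])
         (auto simp: disjoint_family_on_def, metis Int_iff dyadic_disjoint empty_iff linorder_neqE_nat)
    also have "\<dots> \<le> indicator {1 / real n..pi} \<theta>"
    proof -
      have "(\<Union>j<J. dyadic j) \<subseteq> {1 / real n..pi}"
      proof (rule UN_least)
      fix j assume j: "j \<in> {..<J}"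
      have "real (2 ^ J) \<le> real n" using n by (simp only: of_nat_le_iff)
      moreover have "0 < n" using n by (cases n) auto
      ultimately have "1 / real n \<le> 1 / 2 ^ J" by (intro divide_left_mono) auto
      also have "\<dots> = (1/2) ^ J" by (simp add: power_one_over)
      also have "\<dots> \<le> (1/2) ^ Suc j" using j by (intro power_decreasing) auto
      finally have "1 / real n \<le> (1/2) ^ Suc j" .
      moreover have "(1/2 :: real) ^ j \<le> 1" by (rule power_le_one) auto
      ultimately show "dyadic j \<subseteq> {1 / real n..pi}" using pi_gt3 unfolding dyadic_def by (intro subsetI) (simp only: greaterThanAtMost_iff atLeastAtMost_iff, linarith)
      qed
      then show ?thesis by (auto simp: indicator_def)
    qed
    finally have "kernel l \<theta> * (\<Sum>j<J. indicator (dyadic j) \<theta>) \<le> kernel l \<theta> * indicator {1 / real n..pi} \<theta>"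
      by (rule mult_left_mono) simp
    then show "(\<Sum>j<J. kernel l \<theta> * indicator (dyadic j) \<theta>) \<le> kernel l \<theta> * indicator {1 / real n..pi} \<theta>"
      by (simp add: sum_distrib_left)
  qed
  finally show ?thesis .
qed

text \<open>For all \<open>n\<close> the interval contains \<open>[1, \<pi>]\<close>, on which the integrand is positive. This absorbs the
finitely many terms to which the asymptotic estimate does not apply.\<close>

lemma kernel_integral_pos:
  assumes l: "slowly_varying l"
  shows "\<exists>c>0. \<forall>n\<ge>1. ennreal c \<le> (\<integral>\<^sup>+ \<theta> \<in> {1 / real n..pi}. kernel l \<theta> \<partial>lebesgue)"
proof -
  have lm: "l \<in> borel_measurable (lebesgue_on {0<..})" and lpos: "\<And>x. x > 0 \<Longrightarrow> l x > 0"
    using l by (auto simp: slowly_varying_def)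
  let ?I = "\<integral>\<^sup>+ \<theta>. kernel l \<theta> * indicator {1..pi} \<theta> \<partial>lebesgue"
  have m: "(\<lambda>\<theta>. kernel l \<theta> * indicator {1..pi} \<theta>) \<in> borel_measurable lebesgue"
    by (rule kernel_measurable[OF lm]) auto
  have "?I \<noteq> 0"
  proof
    assume "?I = 0"
    then have "AE \<theta> in lebesgue. kernel l \<theta> * indicator {1..pi} \<theta> = 0"
      by (subst (asm) nn_integral_0_iff_AE[OF m])
    then have "AE \<theta> in lebesgue. \<theta> \<notin> {1..pi}"
    proof eventually_elim
      case (elim \<theta>)
      have "kernel l \<theta> \<noteq> 0" if "1 \<le> \<theta>" using that lpos[of "1 / \<theta>"] by (simp add: kernel_def)
      then show ?case using elim by (auto simp: indicator_def split: if_splits)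
    qed
    then have "emeasure lebesgue {1..pi} = 0" by (subst (asm) AE_iff_measurable[of "{1..pi}"]) auto
    then show False using pi_gt3 by simp
  qed
  have "\<exists>c>0. ennreal c \<le> ?I"
  proof (cases ?I rule: ennreal_cases)
    case (real r)
    then show ?thesis using \<open>?I \<noteq> 0\<close> by (intro exI[of _ r]) auto
  next
    case top
    then show ?thesis by (intro exI[of _ 1]) simp
  qed
  then obtain c where c: "c > 0" "ennreal c \<le> ?I" by blast
  have "?I \<le> (\<integral>\<^sup>+ \<theta> \<in> {1 / real n..pi}. kernel l \<theta> \<partial>lebesgue)" if "n \<ge> 1" for n
  proof -
    have "1 / real n \<le> 1" using that by simp
    then show ?thesis by (intro nn_integral_mono mult_left_mono) (auto simp: indicator_def)
  qed
  then show ?thesis using c order_trans by blast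
qed

section \<open>Decay rates of the transfer operators\<close>

text \<open>Each term beyond index \<open>m\<close> is traded for its predecessor. This serves sums whose last dyadic block
would not be contained in the range of integration.\<close>

lemma sum_le_shifted:
  fixes a :: "nat \<Rightarrow> real"
  assumes a: "\<And>i. 0 \<le> a i" "\<And>i. a (Suc i) \<le> q * a i" and q: "0 \<le> q"
  shows "(\<Sum>i\<le>J. a i) \<le> (\<Sum>i\<le>m. a i) + q * (\<Sum>i\<in>{m..<J}. a i)"
proof (induction J)
  case 0
  have "(\<Sum>i\<le>0. a i) \<le> (\<Sum>i\<le>m. a i)" using a(1) by (intro sum_mono2) auto
  then show ?case by simp
next
  case (Suc J)
  show ?case
  proof (cases "Suc J \<le> m")
    case True
    then have "(\<Sum>i\<le>Suc J. a i) \<le> (\<Sum>i\<le>m. a i)" using a(1) by (intro sum_mono2) auto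
    then show ?thesis using True by simp
  next
    case False
    then have "(\<Sum>i\<in>{m..<Suc J}. a i) = (\<Sum>i\<in>{m..<J}. a i) + a J" by simp
    then show ?thesis using Suc a(2)[of J] by (simp add: distrib_left)
  qed
qed

text \<open>The terms up to some fixed index form a constant; the others are shifted by one index and then
bounded by the integrals over disjoint blocks in \<open>[1/n, \<pi>]\<close>.\<close>

lemma (in regular_tail) sum_le_kernel_integral:
  assumes l: "slowly_varying l" and \<tau>_l: "\<And>i. (1/2) ^ i / (\<tau> i)\<^sup>2 = 1 / (l (2 ^ i))\<^sup>2"
  shows "\<exists>K>0. \<forall>n J. 1 \<le> n \<longrightarrow> 2 ^ J \<le> n \<longrightarrow>
    ennreal (\<Sum>i\<le>J. (1/2) ^ i / (\<tau> i)\<^sup>2) \<le> ennreal K * (\<integral>\<^sup>+ \<theta> \<in> {1 / real n..pi}. kernel l \<theta> \<partial>lebesgue)"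
proof -
  define a where "a i = (1/2) ^ i / (\<tau> i)\<^sup>2" for i
  define I where "I j = (\<integral>\<^sup>+ \<theta>. kernel l \<theta> * indicator (dyadic j) \<theta> \<partial>lebesgue)" for j
  have a0: "0 \<le> a i" for i by (simp add: a_def)
  obtain m where m: "\<And>j. j \<ge> m \<Longrightarrow> ennreal (1 / 4) \<le> ennreal ((l (2 ^ j))\<^sup>2) * I j"
    using dyadic_integral_ge[OF l] unfolding eventually_sequentially I_def by blast
  have aI: "ennreal (a j) \<le> ennreal 4 * I j" if "j \<ge> m" for j
  proof -
    have l0: "l (2 ^ j) > 0" using l by (simp add: slowly_varying_def)
    have "ennreal (a j) = ennreal (4 * a j * (1/4))" by simp
    also have "\<dots> = ennreal (4 * a j) * ennreal (1/4)" using a0[of j] by (intro ennreal_mult) auto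
    also have "\<dots> \<le> ennreal (4 * a j) * (ennreal ((l (2 ^ j))\<^sup>2) * I j)" by (intro mult_left_mono m that) auto
    also have "\<dots> = ennreal (4 * a j * (l (2 ^ j))\<^sup>2) * I j"
      using a0[of j] by (subst ennreal_mult) (auto simp: mult.assoc)
    also have "4 * a j * (l (2 ^ j))\<^sup>2 = 4" using l0 by (simp add: a_def \<tau>_l)
    finally show ?thesis .
  qed
  obtain D where D: "D \<ge> 1" "\<And>j. \<tau> j \<le> D * \<tau> (Suc j)" using \<tau>_doubling by blast
  have aS: "a (Suc i) \<le> D\<^sup>2 * a i" for i
  proof -
    have "\<tau> i / D \<le> \<tau> (Suc i)" using D(2)[of i] D(1) by (simp add: pos_divide_le_eq mult.commute)
    then have "(\<tau> i / D)\<^sup>2 \<le> (\<tau> (Suc i))\<^sup>2" using D(1) \<tau>_pos[of i] by (intro power_mono) auto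
    then have "(1/2) ^ Suc i / (\<tau> (Suc i))\<^sup>2 \<le> (1/2) ^ i / (\<tau> i / D)\<^sup>2"
      using D(1) \<tau>_pos[of i] \<tau>_pos[of "Suc i"] by (intro frac_le) auto
    then show ?thesis by (simp add: a_def power_divide ac_simps)
  qed
  obtain c where c: "c > 0" "\<And>n. n \<ge> 1 \<Longrightarrow> ennreal c \<le> (\<integral>\<^sup>+ \<theta> \<in> {1 / real n..pi}. kernel l \<theta> \<partial>lebesgue)"
    using kernel_integral_pos[OF l] by blast
  define S where "S = (\<Sum>i\<le>m. a i)"
  have S: "0 \<le> S" unfolding S_def using a0 by (intro sum_nonneg)
  define K where "K = S / c + D\<^sup>2 * 4"
  have K: "K > 0" using S c(1) D(1) by (simp add: K_def add_nonneg_pos)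
  have "ennreal (\<Sum>i\<le>J. a i) \<le> ennreal K * (\<integral>\<^sup>+ \<theta> \<in> {1 / real n..pi}. kernel l \<theta> \<partial>lebesgue)"
    if n: "1 \<le> n" "2 ^ J \<le> n" for n J
  proof -
    let ?In = "\<integral>\<^sup>+ \<theta> \<in> {1 / real n..pi}. kernel l \<theta> \<partial>lebesgue"
    have s0: "0 \<le> (\<Sum>i\<in>{m..<J}. a i)" using a0 by (intro sum_nonneg)
    have "(\<Sum>i\<le>J. a i) \<le> S + D\<^sup>2 * (\<Sum>i\<in>{m..<J}. a i)"
      unfolding S_def by (rule sum_le_shifted[where a = a and q = "D\<^sup>2", OF a0 aS]) simp
    then have "ennreal (\<Sum>i\<le>J. a i) \<le> ennreal (S + D\<^sup>2 * (\<Sum>i\<in>{m..<J}. a i))" by (rule ennreal_leI)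
    also have "\<dots> = ennreal S + ennreal (D\<^sup>2) * ennreal (\<Sum>i\<in>{m..<J}. a i)"
      using S s0 by (simp add: ennreal_plus ennreal_mult)
    also have "\<dots> \<le> ennreal (S / c) * ?In + ennreal (D\<^sup>2) * (ennreal 4 * ?In)"
    proof (intro add_mono mult_left_mono)
      have "ennreal S = ennreal (S / c * c)" using c(1) by simp
      also have "\<dots> = ennreal (S / c) * ennreal c" using S c(1) by (intro ennreal_mult) auto
      also have "\<dots> \<le> ennreal (S / c) * ?In" by (intro mult_left_mono c(2) n) simp
      finally show "ennreal S \<le> ennreal (S / c) * ?In" .
      have "ennreal (\<Sum>i\<in>{m..<J}. a i) = (\<Sum>i\<in>{m..<J}. ennreal (a i))" using a0 by (intro sum_ennreal[symmetric])
      also have "\<dots> \<le> (\<Sum>i\<in>{m..<J}. ennreal 4 * I i)" by (intro sum_mono aI) auto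
      also have "\<dots> \<le> (\<Sum>i<J. ennreal 4 * I i)" by (intro sum_mono2) auto
      also have "\<dots> = ennreal 4 * (\<Sum>i<J. I i)" by (simp only: sum_distrib_left)
      also have "\<dots> \<le> ennreal 4 * ?In"
        unfolding I_def by (intro mult_left_mono sum_dyadic_integrals_le l n) simp
      finally show "ennreal (\<Sum>i\<in>{m..<J}. a i) \<le> ennreal 4 * ?In" .
    qed simp
    also have "\<dots> = (ennreal (S / c) + ennreal (D\<^sup>2) * ennreal 4) * ?In"
      by (simp only: distrib_right mult.assoc)
    also have "ennreal (S / c) + ennreal (D\<^sup>2) * ennreal 4 = ennreal K"
    proof -
      have "ennreal (D\<^sup>2) * ennreal 4 = ennreal (D\<^sup>2 * 4)" by (rule ennreal_mult[symmetric]) auto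
      then show ?thesis unfolding K_def using S c(1) by (subst ennreal_plus) auto
    qed
    finally show ?thesis .
  qed
  then show ?thesis using K unfolding a_def by blast
qed

theorem theorem2p2:
  fixes M :: "'a measure" and f :: "'a \<Rightarrow> 'a" and Y :: "'a set"
    and L R :: "('a \<Rightarrow> real) \<Rightarrow> 'a \<Rightarrow> real"
    and l :: "real \<Rightarrow> real" and \<beta> :: real
    and \<iota> :: "'b::banach \<Rightarrow> 'a \<Rightarrow> real"
    and Rn :: "nat \<Rightarrow> 'b \<Rightarrow>\<^sub>L 'b"
  assumes "emeasure M (space M) = \<infinity>"
    and "measure_preserving_map M f"
    and "conservative M f"
    and "Y \<in> sets M" and "emeasure M Y = 1"
    and "transfer_operator M f L"
    and "transfer_operator (restrict_space M Y) (first_return_map f Y) R"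
    and "0 < \<beta>" and "\<beta> \<le> 1"
    and "slowly_varying l"
    and "\<And>n::nat. n \<ge> 1 \<Longrightarrow>
           measure M {y \<in> Y. return_time f Y y > n} = l (real n) * real n powr (- \<beta>)"
    and "banach_subspace_Linf (restrict_space M Y) \<iota>"
    and "H1 M Y (return_time f Y) R \<iota> Rn"
    and "H2 Rn"
  shows "(\<beta> = 1/2 \<longrightarrow>
            op_ll (restrict_space M Y) \<iota> (T_fun L Y)
              (\<lambda>n. ennreal (l (real n) * real n powr (- 1/2)) *
                   (\<integral>\<^sup>+ \<theta> \<in> {1 / real n .. pi}. ennreal (1 / ((l (1/\<theta>))\<^sup>2 * \<theta>)) \<partial>lebesgue))) \<and>
         (0 < \<beta> \<and> \<beta> < 1/2 \<longrightarrow>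
            op_ll (restrict_space M Y) \<iota> (T_fun L Y)
              (\<lambda>n. ennreal (l (real n) * real n powr (- \<beta>)))) \<and>
         (0 < \<beta> \<and> \<beta> < 1 \<longrightarrow>
            (\<forall>v. (\<integral>y. \<iota> v y \<partial>restrict_space M Y) = 0 \<longrightarrow>
              fun_ll (restrict_space M Y) \<iota> (\<lambda>n. T_fun L Y n (\<iota> v))
                (\<lambda>n. ennreal (l (real n) * real n powr (- \<beta>)))))"
proof -
  interpret first_return_operators M f Y L R \<iota> Rn
    by unfold_locales (fact assms)+
  have l_pos: "l x > 0" if "x > 0" for x using assms(10) that by (simp add: slowly_varying_def)
  have tail_eq: "tail n = l (real n) * real n powr (- \<beta>)" if "n \<ge> 1" for n using assms(11)[OF that] .
  have tail_pos: "tail n > 0" for n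
    using tail_0 tail_eq[of n] l_pos[of "real n"] by (cases "n = 0") auto
  have tail_2: "tail (2 ^ j) = l (2 ^ j) * (2 ^ j) powr (- \<beta>)" for j
    using tail_eq[of "2 ^ j"] by simp
  have ratio: "(\<lambda>j. tail (2 ^ Suc j) / tail (2 ^ j)) \<longlonglongrightarrow> 2 powr (- \<beta>)"
  proof -
    have "filterlim (\<lambda>j::nat. (2 :: real) ^ j) at_top sequentially"
      using filterlim_real_sequentially by (rule filterlim_at_top_mono) (simp add: less_imp_le[OF of_nat_less_two_power])
    moreover have "((\<lambda>x. l (2 * x) / l x) \<longlongrightarrow> 1) at_top" using assms(10) by (simp add: slowly_varying_def)
    ultimately have "(\<lambda>j::nat. l (2 * 2 ^ j) / l (2 ^ j)) \<longlonglongrightarrow> 1" by (rule filterlim_compose[rotated])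
    then have "(\<lambda>j::nat. l (2 * 2 ^ j) / l (2 ^ j) * 2 powr (- \<beta>)) \<longlonglongrightarrow> 1 * 2 powr (- \<beta>)"
      by (intro tendsto_intros)
    moreover have "l (2 * 2 ^ j) / l (2 ^ j) * 2 powr (- \<beta>) = tail (2 ^ Suc j) / tail (2 ^ j)" for j :: nat
      unfolding tail_2 using l_pos[of "2 ^ j"] by (simp add: powr_mult)
    ultimately show ?thesis by simp
  qed
  have "\<exists>v. AE y in N. \<iota> v y = 1" using assms(12) by (simp only: banach_subspace_Linf_def)
  then obtain e where e: "AE y in N. \<iota> e y = 1" by (elim exE)
  have "\<exists>C>0. \<forall>n\<ge>1. norm (Rn n) \<le> C * measure M {y \<in> Y. \<phi> y = n}"
    using assms(13) by (simp only: H1_def)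
  then obtain C where C: "C > 0" "\<And>n. n \<ge> 1 \<Longrightarrow> norm (Rn n) \<le> C * measure M {y \<in> Y. \<phi> y = n}"
    by (elim exE conjE) simp
  have OR: "operator_renewal tail \<beta> Rn pr e C" if "\<beta> < 1"
  proof (rule operator_renewal_first_return[OF _ e assms(14) C])
    show "regular_tail tail \<beta>"
      by unfold_locales (use assms(8) that tail_0 tail_decseq tail_lim tail_pos ratio in auto)
  qed
  have restricts: "restricts_to N \<iota> (T_fun L Y n) (renewal Rn n)" for n
    unfolding restricts_to_def represents_def using T_eq_renewal by blast
  have a: "op_ll N \<iota> (T_fun L Y)
      (\<lambda>n. ennreal (l (real n) * real n powr (- 1/2)) * (\<integral>\<^sup>+ \<theta> \<in> {1 / real n .. pi}. kernel l \<theta> \<partial>lebesgue))"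
    if \<beta>: "\<beta> = 1/2"
  proof -
    interpret OR: operator_renewal tail \<beta> Rn pr e C by (rule OR) (use \<beta> in simp)
    obtain D where D: "D > 0" "\<And>n J. 2 ^ J \<le> n \<Longrightarrow> n < 2 ^ Suc J \<Longrightarrow>
        norm (renewal Rn n) \<le> D * tail n * (\<Sum>i\<le>J. (1/2) ^ i / (OR.\<tau> i)\<^sup>2)"
      using OR.norm_renewal_le by blast
    have "(1/2) ^ i / (OR.\<tau> i)\<^sup>2 = 1 / (l (2 ^ i))\<^sup>2" for i
    proof -
      have "((2 ^ i) powr (- (1/2) :: real))\<^sup>2 = (1/2) ^ i"
        by (simp add: power2_eq_square powr_add[symmetric] powr_minus power_one_over inverse_eq_divide)
      then show ?thesis by (simp add: OR.\<tau>_def tail_2 \<beta> power_mult_distrib)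
    qed
    from OR.sum_le_kernel_integral[OF assms(10) this]
    obtain K where K: "K > 0" "\<And>n J. 1 \<le> n \<Longrightarrow> 2 ^ J \<le> n \<Longrightarrow>
      ennreal (\<Sum>i\<le>J. (1/2) ^ i / (OR.\<tau> i)\<^sup>2) \<le> ennreal K * (\<integral>\<^sup>+ \<theta> \<in> {1 / real n..pi}. kernel l \<theta> \<partial>lebesgue)"
      by blast
    show ?thesis unfolding op_ll_def
    proof (intro exI[of _ "D * K"] conjI allI impI)
      show "D * K > 0" using D K by simp
      fix n :: nat assume n: "1 \<le> n"
      let ?In = "\<integral>\<^sup>+ \<theta> \<in> {1 / real n..pi}. kernel l \<theta> \<partial>lebesgue"
      obtain J where J: "2 ^ J \<le> n" "n < 2 ^ Suc J" using dyadic_block[OF n] by blast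
      let ?S = "\<Sum>i\<le>J. (1/2) ^ i / (OR.\<tau> i)\<^sup>2"
      have S: "0 \<le> ?S" by (intro sum_nonneg) auto
      have "ennreal (norm (renewal Rn n)) \<le> ennreal (D * tail n * ?S)" by (intro ennreal_leI D(2) J)
      also have "\<dots> = ennreal (D * tail n) * ennreal ?S"
        using D(1) tail_pos[of n] S by (intro ennreal_mult) auto
      also have "\<dots> \<le> ennreal (D * tail n) * (ennreal K * ?In)" by (intro mult_left_mono K(2) n J) simp
      also have "ennreal (D * tail n) = ennreal D * ennreal (tail n)"
        using D(1) tail_pos[of n] by (intro ennreal_mult) auto
      also have "ennreal D * ennreal (tail n) * (ennreal K * ?In) = ennreal (D * K) * (ennreal (tail n) * ?In)"
        using D(1) K(1) by (simp add: ennreal_mult ac_simps)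
      also have "tail n = l (real n) * real n powr (- 1/2)" using tail_eq[OF n] \<beta> by simp
      finally show "\<exists>A. restricts_to N \<iota> (T_fun L Y n) A \<and>
          ennreal (norm A) \<le> ennreal (D * K) * (ennreal (l (real n) * real n powr (- 1/2)) * ?In)"
        using restricts by blast
    qed
  qed
  have b: "op_ll N \<iota> (T_fun L Y) (\<lambda>n. ennreal (l (real n) * real n powr (- \<beta>)))" if \<beta>: "\<beta> < 1/2"
  proof -
    interpret OR: operator_renewal tail \<beta> Rn pr e C by (rule OR) (use \<beta> in simp)
    obtain D where D: "D > 0" "\<And>n J. 2 ^ J \<le> n \<Longrightarrow> n < 2 ^ Suc J \<Longrightarrow>
        norm (renewal Rn n) \<le> D * tail n * (\<Sum>i\<le>J. (1/2) ^ i / (OR.\<tau> i)\<^sup>2)"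
      using OR.norm_renewal_le by blast
    define S where "S = (\<Sum>i. (1/2) ^ i / (OR.\<tau> i)\<^sup>2) + 1"
    have S: "(\<Sum>i\<le>J. (1/2) ^ i / (OR.\<tau> i)\<^sup>2) \<le> S" for J
    proof -
      have "(\<Sum>i\<le>J. (1/2) ^ i / (OR.\<tau> i)\<^sup>2) \<le> (\<Sum>i. (1/2) ^ i / (OR.\<tau> i)\<^sup>2)"
        by (intro sum_le_suminf OR.summable_over_tail_squared \<beta>) auto
      then show ?thesis by (simp add: S_def)
    qed
    have "0 \<le> (\<Sum>i. (1/2) ^ i / (OR.\<tau> i)\<^sup>2)"
      by (intro suminf_nonneg OR.summable_over_tail_squared \<beta>) auto
    then have S0: "S > 0" by (simp add: S_def)
    show ?thesis unfolding op_ll_def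
    proof (intro exI[of _ "D * S"] conjI allI impI)
      show "D * S > 0" using D S0 by simp
      fix n :: nat assume n: "1 \<le> n"
      obtain J where J: "2 ^ J \<le> n" "n < 2 ^ Suc J" using dyadic_block[OF n] by blast
      have "norm (renewal Rn n) \<le> D * tail n * (\<Sum>i\<le>J. (1/2) ^ i / (OR.\<tau> i)\<^sup>2)" by (intro D(2) J)
      also have "\<dots> \<le> D * tail n * S" using D(1) tail_pos[of n] by (intro mult_left_mono S) auto
      finally have "ennreal (norm (renewal Rn n)) \<le> ennreal (D * S * tail n)" by (intro ennreal_leI) (simp add: ac_simps)
      also have "\<dots> = ennreal (D * S) * ennreal (tail n)"
        using D(1) S0 tail_pos[of n] by (intro ennreal_mult) auto
      finally show "\<exists>A. restricts_to N \<iota> (T_fun L Y n) A \<and>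
          ennreal (norm A) \<le> ennreal (D * S) * ennreal (l (real n) * real n powr (- \<beta>))"
        unfolding tail_eq[OF n] using restricts by blast
    qed
  qed
  have c: "fun_ll N \<iota> (\<lambda>n. T_fun L Y n (\<iota> v)) (\<lambda>n. ennreal (l (real n) * real n powr (- \<beta>)))"
    if \<beta>: "\<beta> < 1" and v: "(\<integral>y. \<iota> v y \<partial>N) = 0" for v
  proof -
    interpret OR: operator_renewal tail \<beta> Rn pr e C by (rule OR) (use \<beta> in simp)
    obtain D where D: "D > 0" "\<And>v n. pr v e = 0 \<Longrightarrow> 1 \<le> n \<Longrightarrow> norm (renewal Rn n v) \<le> D * norm v * tail n"
      using OR.norm_renewal_mean_zero_le by blast
    have "pr v e = (\<integral>y. \<iota> v y \<partial>N)"
      unfolding pr_def using e by (intro integral_cong_AE) auto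
    then have pv: "pr v e = 0" using v by simp
    define B where "B = D * norm v + 1"
    have B: "B > 0" using D(1) by (simp add: B_def add_nonneg_pos)
    show ?thesis unfolding fun_ll_def
    proof (intro exI[of _ B] conjI allI impI)
      show "B > 0" by (rule B)
      fix n :: nat assume n: "1 \<le> n"
      have "norm (renewal Rn n v) \<le> D * norm v * tail n" by (rule D(2)[OF pv n])
      also have "\<dots> \<le> B * tail n" using tail_pos[of n] by (intro mult_right_mono) (auto simp: B_def)
      finally have "ennreal (norm (renewal Rn n v)) \<le> ennreal (B * tail n)" by (rule ennreal_leI)
      also have "\<dots> = ennreal B * ennreal (tail n)" using B tail_pos[of n] by (intro ennreal_mult) auto
      finally show "\<exists>u. represents N \<iota> u (T_fun L Y n (\<iota> v)) \<and>
          ennreal (norm u) \<le> ennreal B * ennreal (l (real n) * real n powr (- \<beta>))"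
        unfolding tail_eq[OF n] using restricts unfolding restricts_to_def by blast
    qed
  qed
  show ?thesis using a b c unfolding kernel_def by blast
qed

end
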